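(* Let $\mathbb{K}$ be a field. For every finite simple graph $G$ with edge ideal $I(G)$ and for every integer $s\geq 1$, we have $$\mathrm{reg}(I(G)^s)\leq 2s+\text{min-match}(G)-1.$$
   Context: All graphs are finite and simple. For a graph $G$ with vertex set $V(G)=\{v_1,\ldots,v_n\}$, let $S=\mathbb{K}[x_1,\ldots,x_n]$ be the standard graded polynomial ring over $\mathbb{K}$; the edge ideal of $G$ is $I(G)=(x_ix_j : v_iv_j\in E(G))\subseteq S$. For a finitely generated graded $S$-module $M$ with graded Betti numbers $\beta_{i,j}(M)$ (so the $i$-th module in the minimal graded free resolution of $M$ is $\bigoplus_j S(-j)^{\beta_{i,j}(M)}$), the Castelnuovo--Mumford regularity is $\mathrm{reg}(M)=\max\{j-i : \beta_{i,j}(M)\neq 0\}$ (with $\mathrm{reg}(0)=-\infty$). A matching of $G$ is a set of pairwise disjoint edges of $G$. The minimum matching number $\text{min-match}(G)$ is the minimum cardinality of a maximal (with respect to inclusion) matching of $G$. *)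

theory Defs
  imports
    "HOL-Library.Poly_Mapping"
    "HOL-Library.Extended_Real"
    "HOL-Library.Disjoint_Sets"
    "Jordan_Normal_Form.Matrix"
begin

section \<open>Polynomials, ideals and homogeneous elements\<close>

text \<open>
  The ring \<open>S = K[x\<^sub>v : v]\<close>: finitely supported maps from exponent vectors to coefficients, with the
  convolution product of \<^theory>\<open>HOL-Library.Poly_Mapping\<close>. The index type \<open>'v\<close> of the
  variables will always be finite.
\<close>
type_synonym ('v, 'k) mpoly = "('v \<Rightarrow>\<^sub>0 nat) \<Rightarrow>\<^sub>0 'k"

definition Var :: "'v \<Rightarrow> ('v, 'k::comm_ring_1) mpoly"
  where "Var v = Poly_Mapping.single (Poly_Mapping.single v 1) 1"

lemma module_mult: "Modules.module ((*) :: 'a::comm_ring_1 \<Rightarrow> 'a \<Rightarrow> 'a)"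
  by standard (simp_all add: algebra_simps)

definition ideal_gen :: "'a::comm_ring_1 set \<Rightarrow> 'a set"
  where "ideal_gen A = Modules.module.span (*) A"

primrec ideal_power :: "'a::comm_ring_1 set \<Rightarrow> nat \<Rightarrow> 'a set" where
  "ideal_power I 0 = UNIV"
| "ideal_power I (Suc s) = ideal_gen {a * b | a b. a \<in> I \<and> b \<in> ideal_power I s}"

definition mon_degree :: "('v::finite \<Rightarrow>\<^sub>0 nat) \<Rightarrow> nat"
  where "mon_degree m = (\<Sum>v\<in>UNIV. Poly_Mapping.lookup m v)"

text \<open>\<open>p\<close> lies in the graded piece \<open>S\<^sub>d\<close> of the standard grading; \<open>S\<^sub>d = 0\<close> for \<open>d < 0\<close>.\<close>
definition homogeneous :: "int \<Rightarrow> ('v::finite, 'k::zero) mpoly \<Rightarrow> bool"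
  where "homogeneous d p \<longleftrightarrow> (\<forall>m\<in>Poly_Mapping.keys p. int (mon_degree m) = d)"

definition irrelevant_ideal :: "('v::finite, 'k::comm_ring_1) mpoly set"
  where "irrelevant_ideal = ideal_gen (range Var)"

section \<open>Minimal graded free resolutions and regularity\<close>

text \<open>
  A minimal graded free resolution
  \<open>\<dots> \<rightarrow> F\<^sub>2 \<rightarrow> F\<^sub>1 \<rightarrow> F\<^sub>0 \<rightarrow> J \<rightarrow> 0\<close>
  of a graded ideal \<open>J\<close> of \<open>S\<close>. The list \<open>sh i\<close> holds the degrees of the basis of
  \<open>F\<^sub>i\<close>, that is, \<open>F\<^sub>i\<close> is the direct sum of the \<open>S(-a)\<close> for \<open>a\<close> in \<open>sh i\<close>. The matrix \<open>D i\<close>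
  represents \<open>F\<^bsub>i+1\<^esub> \<rightarrow> F\<^sub>i\<close>, and \<open>aug\<close> lists the images in \<open>J\<close> of the basis of \<open>F\<^sub>0\<close>.
  The two homogeneity conditions say that all maps have degree \<open>0\<close>; minimality says that
  the image of \<open>F\<^bsub>i+1\<^esub>\<close> lies in \<open>\<mm>F\<^sub>i\<close>, where \<open>\<mm>\<close> is the irrelevant ideal. A zero module
  \<open>F\<^sub>i\<close> is encoded by an empty list.
\<close>
locale minimal_graded_free_resolution =
  fixes J :: "('v::finite, 'k::field) mpoly set"
    and sh :: "nat \<Rightarrow> int list"
    and aug :: "('v, 'k) mpoly vec"
    and D :: "nat \<Rightarrow> ('v, 'k) mpoly mat"
  assumes aug_carrier: "aug \<in> carrier_vec (length (sh 0))"
    and D_carrier: "D i \<in> carrier_mat (length (sh i)) (length (sh (Suc i)))"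
    and aug_homogeneous: "r < length (sh 0) \<Longrightarrow> homogeneous (sh 0 ! r) (aug $ r)"
    and D_homogeneous: "r < length (sh i) \<Longrightarrow> c < length (sh (Suc i)) \<Longrightarrow>
          homogeneous (sh (Suc i) ! c - sh i ! r) (D i $$ (r, c))"
    and aug_onto: "{aug \<bullet> w | w. w \<in> carrier_vec (length (sh 0))} = J"
    and exact_0: "{D 0 *\<^sub>v w | w. w \<in> carrier_vec (length (sh 1))}
          = {w \<in> carrier_vec (length (sh 0)). aug \<bullet> w = 0}"
    and exact_Suc: "{D (Suc i) *\<^sub>v w | w. w \<in> carrier_vec (length (sh (Suc (Suc i))))}
          = {w \<in> carrier_vec (length (sh (Suc i))). D i *\<^sub>v w = 0\<^sub>v (length (sh i))}"
    and minimal: "r < length (sh i) \<Longrightarrow> c < length (sh (Suc i)) \<Longrightarrow>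
          D i $$ (r, c) \<in> irrelevant_ideal"

text \<open>
  Every graded ideal has a minimal graded free resolution, unique up to graded isomorphism, so the
  choice below does not affect the Betti numbers.
\<close>
definition resolution_shifts :: "('v::finite, 'k::field) mpoly set \<Rightarrow> nat \<Rightarrow> int list"
  where "resolution_shifts J = (SOME sh. \<exists>aug D. minimal_graded_free_resolution J sh aug D)"

definition graded_betti :: "('v::finite, 'k::field) mpoly set \<Rightarrow> nat \<Rightarrow> int \<Rightarrow> nat"
  where "graded_betti J i j = count_list (resolution_shifts J i) j"

text \<open>
  The supremum is taken in the extended reals, so the zero ideal has regularity \<open>-\<infinity>\<close>. For
  \<open>J \<noteq> 0\<close> it is a maximum, because the minimal resolution has finite length.
\<close>
definition regularity :: "('v::finite, 'k::field) mpoly set \<Rightarrow> ereal"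
  where "regularity J = Sup {ereal (of_int (j - int i)) | i j. graded_betti J i j \<noteq> 0}"

section \<open>Graphs, edge ideals and matchings\<close>

text \<open>
  The vertex set of a graph is a finite type \<open>'v\<close>; a graph is given by its set of edges, each a
  two-element set of vertices.
\<close>
definition simple_graph :: "'v::finite set set \<Rightarrow> bool"
  where "simple_graph E \<longleftrightarrow> (\<forall>e\<in>E. card e = 2)"

definition edge_ideal :: "'v::finite set set \<Rightarrow> ('v, 'k::field) mpoly set"
  where "edge_ideal E = ideal_gen {Var u * Var v | u v. {u, v} \<in> E}"

definition matching :: "'v::finite set set \<Rightarrow> 'v set set \<Rightarrow> bool"
  where "matching E M \<longleftrightarrow> M \<subseteq> E \<and> disjoint M"

definition maximal_matching :: "'v::finite set set \<Rightarrow> 'v set set \<Rightarrow> bool"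
  where "maximal_matching E M \<longleftrightarrow> matching E M \<and> (\<forall>M'. matching E M' \<and> M \<subseteq> M' \<longrightarrow> M' = M)"

definition min_match :: "'v::finite set set \<Rightarrow> nat"
  where "min_match E = Min (card ` {M. maximal_matching E M})"

end

theory Submission
  imports Defs "HOL-Library.Multiset" "HOL-Library.Countable" "HOL-Library.Function_Algebras"
begin

text \<open>
  Let \<open>I\<close> be the edge ideal, \<open>S\<close> the polynomial ring, and for a multiset \<open>a\<close> of vertices let \<open>\<nu> a\<close> be
  the largest number of edges, counted with multiplicity, whose product divides the monomial \<open>x\<^sup>a\<close>. Then
  \<open>I\<^sup>s\<close> is spanned by the monomials \<open>x\<^sup>a\<close> with \<open>\<nu> a \<ge> s\<close> (\<open>ideal_power_edge_ideal_eq\<close>).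

  \<^bold>\<open>Algebra.\<close> Let \<open>J\<close> be a monomial ideal, \<open>v\<close> a variable and \<open>J\<^sub>v\<close> the ideal generated by the monomials of
  \<open>J\<close> that do not contain \<open>v\<close>. The monomials of \<open>J\<close> divisible by \<open>v\<close> span a copy of \<open>J : v\<close>, shifted by
  one degree; the sum of this ideal and \<open>J\<^sub>v\<close> is \<open>J\<close>, and their intersection is a copy of \<open>J\<^sub>v\<close>, again
  shifted by one. Mayer--Vietoris for Koszul homology gives
  \<open>reg J \<le> max (reg (J : v) + 1) (reg J\<^sub>v)\<close> (\<open>koszul_reg_le_step\<close>).

  \<^bold>\<open>A game.\<close> Applied repeatedly, this inequality turns the estimate of the regularity into a game. A
  position consists of the monomial \<open>a\<close> by which the ideal has been divided and the set \<open>Z\<close> of deleted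
  vertices. The player names a vertex \<open>v \<notin> Z\<close>; the opponent either adds \<open>v\<close> to \<open>a\<close> or deletes \<open>v\<close>. As
  soon as \<open>\<nu> a = s\<close> the ideal is \<open>S\<close>, and the game has cost \<open>|a|\<close>; if no more vertices outside \<open>Z\<close>
  can raise \<open>\<nu>\<close> to \<open>s\<close>, the ideal is \<open>0\<close> and the game has cost nothing. Hence it is enough that the
  player can keep the number \<open>|a| - 2 \<nu> a\<close> of wasted vertices at most \<open>card M\<close> before the last move,
  where \<open>M\<close> is a maximal matching: the last move raises \<open>\<nu>\<close> from \<open>s - 1\<close> to \<open>s\<close>, so the cost is at
  most \<open>2 s + card M - 1\<close>.

  \<^bold>\<open>The strategy.\<close> Call \<open>u\<close> exposable if some maximum packing of \<open>a\<close> misses a copy of \<open>u\<close>, and call \<open>v\<close>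
  augmenting if \<open>\<nu>\<close> grows when \<open>v\<close> is added; neighbours of exposable vertices are augmenting. Naming an
  augmenting vertex is free of risk, because it is deleted or it reduces the waste. Once all augmenting
  vertices are deleted, a further growth of \<open>\<nu>\<close> needs a pair \<open>p, q\<close> of vertices
  (\<open>augmenting_pair\<close>), and one of them can be named so that, if it is wasted, an edge of \<open>M\<close>
  with no exposable vertex receives one (\<open>newly_exposable_dominating_edge\<close>). Later
  moves preserve this, except that the last waste may be undone: if the waste is reduced, this happens
  before any other vertex is wasted, and the vertices that were exposable before the last waste still
  are (\<open>augment_pair_stable\<close>). So the waste is at most the number of edges of \<open>M\<close> that meet the exposable set (\<open>state_bound\<close>). All facts
  about \<open>\<nu>\<close> come from one exchange property of multisets of edges (\<open>exchange_edges\<close>), the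
  analogue of following an alternating path.

  \<^bold>\<open>From Koszul homology to resolutions.\<close> A bound on the degrees of the Koszul homology passes from a
  graded module to its syzygies, with the expected shift by one, and it bounds the degrees of minimal
  generators; so it bounds the degrees in every minimal resolution
  (\<open>minimal_graded_free_resolution.shifts_le\<close>). It also yields a minimal resolution in the first place: a
  graded submodule of a free module is generated by finitely many of its graded pieces, which are finite
  dimensional, and a homogeneous generating family of least cardinality is minimal
  (\<open>minimal_resolution_exists\<close>).
\<close>

section \<open>Packings of edges into a multiset of vertices\<close>

abbreviation vertex_mset :: "'v set multiset \<Rightarrow> 'v multiset"
  where "vertex_mset F \<equiv> \<Sum>\<^sub># (image_mset mset_set F)"

lemma size_vertex_mset:
  assumes "\<And>e. e \<in># F \<Longrightarrow> card e = 2"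
  shows "size (vertex_mset F) = 2 * size F"
  using assms by (induction F) auto

lemma count_vertex_mset:
  assumes "\<And>e. e \<in># F \<Longrightarrow> finite e"
  shows "count (vertex_mset F) v = size (filter_mset (\<lambda>e. v \<in> e) F)"
  using assms by (induction F) (auto simp: count_mset_set(3))

text \<open>Degrees are sums over edges, so a vertex of larger degree has an edge of larger multiplicity.\<close>
lemma degree_excess_edge:
  assumes "\<And>e. e \<in># F \<Longrightarrow> finite e" "\<And>e. e \<in># G \<Longrightarrow> finite e"
    and "count (vertex_mset F) v < count (vertex_mset G) v"
  shows "\<exists>e. v \<in> e \<and> count F e < count G e"
proof (rule ccontr)
  assume "\<not> ?thesis"
  then have "filter_mset (\<lambda>e. v \<in> e) G \<subseteq># filter_mset (\<lambda>e. v \<in> e) F"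
    by (auto simp: subseteq_mset_def not_less)
  then show False
    using assms by (auto dest!: size_mset_mono simp: count_vertex_mset)
qed

text \<open>
  The two-step axiom of jump systems for degree vectors of multisets of edges. Starting at \<open>s\<close>, an
  alternating trail takes an edge of \<open>G - F\<close>, then an edge of \<open>F - G\<close>, and so on, until it reaches a
  vertex \<open>t\<close> at which it may stop. If its last edge is in \<open>G - F\<close>, then \<open>t\<close> has a surplus in \<open>G\<close> and the
  degree of \<open>F\<close> increases at \<open>s\<close> and \<open>t\<close>; otherwise \<open>t\<close> has a surplus in \<open>F\<close> and one unit moves from \<open>t\<close> to \<open>s\<close>.
  Exchanging the trail changes \<open>G\<close> in the opposite way; this is what \<open>F' + G' = F + G\<close> records.
\<close>
lemma exchange_edges:
  assumes F: "\<And>e. e \<in># F \<Longrightarrow> card e = 2" and G: "\<And>e. e \<in># G \<Longrightarrow> card e = 2"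
    and s: "count (vertex_mset F) s < count (vertex_mset G) s"
  obtains F' G' t where "F' + G' = F + G"
    and "vertex_mset F' = vertex_mset F + {#s, t#} \<and> count (vertex_mset F + {#s#}) t < count (vertex_mset G) t
       \<or> vertex_mset F' + {#t#} = vertex_mset F + {#s#} \<and> count (vertex_mset G) t < count (vertex_mset F) t"
proof -
  have "\<exists>F' t. F' \<subseteq># F \<union># G \<and>
      (vertex_mset F' = vertex_mset F + {#s, t#} \<and> count (vertex_mset F + {#s#}) t < count (vertex_mset G) t
       \<or> vertex_mset F' + {#t#} = vertex_mset F + {#s#} \<and> count (vertex_mset G) t < count (vertex_mset F) t)"
    using F s
  proof (induction "size (G - F)" arbitrary: F s rule: less_induct)
    case less
    have fin: "finite e" if "e \<in># F \<or> e \<in># G" for e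
      using less.prems(1) G that by (metis card.infinite zero_neq_numeral)
    obtain e where e: "s \<in> e" "count F e < count G e"
      using degree_excess_edge[of F G s] fin less.prems(2) by blast
    then have eG: "e \<in># G"
      by (metis count_greater_zero_iff gr_implies_not_zero neq0_conv)
    obtain s1 where s1: "e = {s, s1}" "s1 \<noteq> s"
      using G[OF eG] e(1) by (metis card_2_iff insert_commute insert_iff singletonD)
    show ?case
    proof (cases "count (vertex_mset F) s1 < count (vertex_mset G) s1")
      case True
      have "add_mset e F \<subseteq># F \<union># G"
        using e(2) by (auto simp: subseteq_mset_def)
      moreover have "vertex_mset (add_mset e F) = vertex_mset F + {#s, s1#}"
        using s1 by simp
      ultimately show ?thesis
        using True s1(2) by (intro exI[of _ "add_mset e F"] exI[of _ s1]) auto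
    next
      case False
      have "\<exists>f. s1 \<in> f \<and> count G f < count F f"
      proof (rule ccontr)
        assume "\<not> ?thesis"
        then have "filter_mset (\<lambda>e. s1 \<in> e) (add_mset e F) \<subseteq># filter_mset (\<lambda>e. s1 \<in> e) G"
          using e(2) by (auto simp: subseteq_mset_def not_less)
        then show False
          using False fin s1 by (auto dest!: size_mset_mono simp: count_vertex_mset)
      qed
      then obtain f where f: "s1 \<in> f" "count G f < count F f" by blast
      then have fF: "f \<in># F"
        by (metis count_greater_zero_iff gr_implies_not_zero neq0_conv)
      obtain s2 where s2: "f = {s1, s2}" "s2 \<noteq> s1"
        using less.prems(1)[OF fF] f(1) by (metis card_2_iff insert_commute insert_iff singletonD)
      have ef: "e \<noteq> f" using e(2) f(2) by auto
      \<comment> \<open>The trail runs through \<open>e\<close> and \<open>f\<close> to \<open>s2\<close>; unless it may stop there, the induction hypothesis for \<open>H\<close> continues it from \<open>s2\<close>.\<close>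
      define H where "H = add_mset e (F - {#f#})"
      have F_f: "F = add_mset f (F - {#f#})" using fF by simp
      have vF: "vertex_mset F = vertex_mset (F - {#f#}) + {#s1, s2#}"
        using s2 by (subst F_f) simp
      have vH: "vertex_mset H + {#s2#} = vertex_mset F + {#s#}"
        using s1 by (subst vF) (simp add: H_def)
      have Hsub: "H \<subseteq># F \<union># G"
        using e(2) by (auto simp: H_def subseteq_mset_def)
      show ?thesis
      proof (cases "count (vertex_mset G) s2 < count (vertex_mset F) s2")
        case True
        then show ?thesis using Hsub vH by blast
      next
        case s2_le: False
        have "G - F = add_mset e (G - H)"
          by (rule multiset_eqI) (use e(2) f(2) ef in \<open>auto simp: H_def\<close>)
        then have sz: "size (G - H) < size (G - F)" by simp
        have cardH: "card g = 2" if "g \<in># H" for g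
          using that less.prems(1) G[OF eG] by (auto simp: H_def dest: in_diffD)
        have "count (vertex_mset H) s2 + 1 = count (vertex_mset F + {#s#}) s2"
          using arg_cong[OF vH, of "\<lambda>M. count M s2"] by simp
        then have "count (vertex_mset H) s2 < count (vertex_mset G) s2"
          using s2_le less.prems(2) by (cases "s2 = s") auto
        from less.hyps[OF sz cardH this] obtain F' t where F': "F' \<subseteq># H \<union># G"
          "vertex_mset F' = vertex_mset H + {#s2, t#} \<and> count (vertex_mset H + {#s2#}) t < count (vertex_mset G) t
       \<or> vertex_mset F' + {#t#} = vertex_mset H + {#s2#} \<and> count (vertex_mset G) t < count (vertex_mset H) t"
          by blast
        have step: "count (vertex_mset H) v + count {#s2#} v = count (vertex_mset F) v + count {#s#} v" for v
          using arg_cong[OF vH, of "\<lambda>M. count M v"] by (simp only: count_union)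
        have "vertex_mset F' = vertex_mset F + {#s, t#} \<and> count (vertex_mset F + {#s#}) t < count (vertex_mset G) t
       \<or> vertex_mset F' + {#t#} = vertex_mset F + {#s#} \<and> count (vertex_mset G) t < count (vertex_mset F) t"
          using F'(2)
        proof (elim disjE conjE)
          assume A: "vertex_mset F' = vertex_mset H + {#s2, t#}"
            and B: "count (vertex_mset H + {#s2#}) t < count (vertex_mset G) t"
          have "vertex_mset F' = vertex_mset F + {#s, t#}"
            using A arg_cong[OF vH, of "add_mset t"] by (simp add: add_mset_commute)
          then show ?thesis using B by (simp only: vH simp_thms)
        next
          assume A: "vertex_mset F' + {#t#} = vertex_mset H + {#s2#}"
            and B: "count (vertex_mset G) t < count (vertex_mset H) t"
          have "t \<noteq> s"
            using B step[of s] less.prems(2) by (auto split: if_splits)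
          then have "count (vertex_mset G) t < count (vertex_mset F) t"
            using B step[of t] by (auto split: if_splits)
          then show ?thesis using A by (simp only: vH simp_thms)
        qed
        moreover have "H \<union># G \<subseteq># F \<union># G"
          using Hsub by (intro subset_mset.sup_least) auto
        ultimately show ?thesis
          using F'(1) subset_mset.order_trans by blast
      qed
    qed
  qed
  then obtain F' t where F': "F' \<subseteq># F \<union># G" and
    *: "vertex_mset F' = vertex_mset F + {#s, t#} \<and> count (vertex_mset F + {#s#}) t < count (vertex_mset G) t
       \<or> vertex_mset F' + {#t#} = vertex_mset F + {#s#} \<and> count (vertex_mset G) t < count (vertex_mset F) t"
    by blast
  have "F' \<subseteq># F + G"
    by (rule subset_mset.order_trans[OF F']) (auto simp: subseteq_mset_def)
  then have "F' + (F + G - F') = F + G" by simp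
  then show thesis using * that by blast
qed

locale finite_simple_graph =
  fixes E :: "'v::finite set set"
  assumes card_edge: "e \<in> E \<Longrightarrow> card e = 2"
begin

text \<open>Multisets of edges whose product divides the monomial \<open>x\<^sup>a\<close>.\<close>
definition packing :: "'v multiset \<Rightarrow> 'v set multiset \<Rightarrow> bool"
  where "packing a F \<longleftrightarrow> set_mset F \<subseteq> E \<and> vertex_mset F \<subseteq># a"

definition packing_number :: "'v multiset \<Rightarrow> nat"  ("\<nu>")
  where "\<nu> a = Max (size ` Collect (packing a))"

lemma packing_card: "packing a F \<Longrightarrow> e \<in># F \<Longrightarrow> card e = 2"
  using card_edge by (auto simp: packing_def)

lemma size_vertex_packing: "packing a F \<Longrightarrow> size (vertex_mset F) = 2 * size F"
  using packing_card by (intro size_vertex_mset) blast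

lemma packing_size_le: "packing a F \<Longrightarrow> 2 * size F \<le> size a"
  using size_vertex_packing[of a F] by (auto simp: packing_def dest: size_mset_mono)

lemma finite_packing_sizes: "finite (size ` Collect (packing a))"
  by (rule finite_subset[of _ "{..size a}"]) (use packing_size_le in force)+

lemma packing_empty [simp]: "packing a {#}"
  by (simp add: packing_def)

lemma packing_le: "packing a F \<Longrightarrow> size F \<le> \<nu> a"
  unfolding packing_number_def by (rule Max_ge[OF finite_packing_sizes]) auto

lemma obtain_packing:
  obtains F where "packing a F" "size F = \<nu> a"
proof -
  have "\<nu> a \<in> size ` Collect (packing a)"
    unfolding packing_number_def by (rule Max_in[OF finite_packing_sizes]) (auto intro: packing_empty)
  then show thesis using that by auto
qed

lemma packing_mono: "packing a F \<Longrightarrow> a \<subseteq># b \<Longrightarrow> packing b F"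
  by (auto simp: packing_def)

lemma nu_mono: "a \<subseteq># b \<Longrightarrow> \<nu> a \<le> \<nu> b"
  by (metis obtain_packing packing_le packing_mono)

lemma nu_bound: "2 * \<nu> a \<le> size a"
  by (metis obtain_packing packing_size_le)

lemma nu_empty [simp]: "\<nu> {#} = 0"
  using nu_bound[of "{#}"] by simp

text \<open>
  A packing that needs the additional copy of \<open>v\<close> contains an edge at \<open>v\<close>; removing this edge leaves a
  packing of \<open>a\<close> that misses a copy of its other end \<open>u\<close>.
\<close>
lemma packing_remove:
  assumes "packing (add_mset v a) F" "\<not> packing a F"
  obtains u G where "{u, v} \<in> E" "u \<noteq> v" "F = add_mset {u, v} G" "packing (a - {#u#}) G" "u \<in># a"
proof -
  have *: "set_mset F \<subseteq> E" "vertex_mset F \<subseteq># add_mset v a" "\<not> vertex_mset F \<subseteq># a"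
    using assms by (auto simp: packing_def)
  have "v \<in># vertex_mset F"
  proof (rule ccontr)
    assume "v \<notin># vertex_mset F"
    then have "vertex_mset F \<subseteq># a"
      using *(2) unfolding subseteq_mset_def not_in_iff by (metis count_add_mset le0)
    then show False using *(3) by blast
  qed
  then obtain e where e: "e \<in># F" "v \<in> e"
    by (auto simp: in_Union_mset_iff)
  then obtain u where u: "e = {u, v}" "u \<noteq> v"
  proof -
    have "card e = 2" using card_edge e(1) *(1) by blast
    then obtain x y where "e = {x, y}" "x \<noteq> y" by (auto simp: card_2_iff)
    then show thesis using e(2) that by (cases "v = x") (auto simp: insert_commute)
  qed
  obtain G where G: "F = add_mset e G"
    using e(1) by (metis mset_add)
  have vF: "add_mset v (add_mset u (vertex_mset G)) \<subseteq># add_mset v a"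
    using *(2) u G by (simp add: add_mset_commute)
  then have "add_mset u (vertex_mset G) \<subseteq># a" by simp
  then have "u \<in># a" "vertex_mset G \<subseteq># a - {#u#}"
    by (auto simp: insert_subset_eq_iff)
  then show thesis
    using that u G *(1) e by (auto simp: packing_def)
qed

lemma nu_add_le: "\<nu> (add_mset v a) \<le> Suc (\<nu> a)"
proof -
  obtain F where F: "packing (add_mset v a) F" "size F = \<nu> (add_mset v a)"
    by (rule obtain_packing)
  show ?thesis
  proof (cases "packing a F")
    case True
    then show ?thesis using F packing_le[of a F] by simp
  next
    case False
    then obtain u G where "F = add_mset {u, v} G" "packing (a - {#u#}) G"
      by (rule packing_remove[OF F(1)]) blast
    then show ?thesis using F packing_le[of "a - {#u#}" G] nu_mono[of "a - {#u#}" a] by simp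
  qed
qed

lemma nu_edge: "{u, v} \<in> E \<Longrightarrow> Suc (\<nu> a) \<le> \<nu> (a + {#u, v#})"
proof -
  assume e: "{u, v} \<in> E"
  then have "u \<noteq> v" using card_edge by fastforce
  obtain F where F: "packing a F" "size F = \<nu> a" by (rule obtain_packing)
  have "packing (a + {#u, v#}) (add_mset {u, v} F)"
    using F(1) e \<open>u \<noteq> v\<close> by (simp add: packing_def)
  from packing_le[OF this] F show ?thesis by simp
qed

text \<open>The vertices with a copy in \<open>a\<close> that is left uncovered by some maximum packing of \<open>a\<close>.\<close>
definition exposable :: "'v multiset \<Rightarrow> 'v set"
  where "exposable a = {u. u \<in># a \<and> \<nu> (a - {#u#}) = \<nu> a}"

definition augmenting :: "'v multiset \<Rightarrow> 'v set"
  where "augmenting a = {v. \<nu> (add_mset v a) = Suc (\<nu> a)}"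

lemma not_augmenting: "v \<notin> augmenting a \<longleftrightarrow> \<nu> (add_mset v a) = \<nu> a"
  using nu_add_le[of v a] nu_mono[of a "add_mset v a"] by (force simp: augmenting_def)

text \<open>An uncovered copy of \<open>u\<close> can be matched with a new copy of its neighbour.\<close>
lemma exposable_neighbour:
  assumes "u \<in> exposable a" "{u, v} \<in> E"
  shows "v \<in> augmenting a"
proof -
  have "Suc (\<nu> (a - {#u#})) \<le> \<nu> (a - {#u#} + {#u, v#})"
    by (rule nu_edge[OF assms(2)])
  also have "a - {#u#} + {#u, v#} = add_mset v a"
    using assms(1) by (simp add: exposable_def)
  finally show ?thesis
    using assms(1) nu_add_le[of v a] by (simp add: exposable_def augmenting_def)
qed

lemma exposable_add:
  assumes "v \<notin> augmenting a"
  shows "insert v (exposable a) \<subseteq> exposable (add_mset v a)"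
proof -
  have "u \<in> exposable (add_mset v a)" if "u \<in> exposable a" for u
  proof -
    have u: "u \<in># a" "\<nu> (a - {#u#}) = \<nu> a" using that by (simp_all add: exposable_def)
    have "\<nu> (a - {#u#}) \<le> \<nu> (add_mset v a - {#u#})"
      by (intro nu_mono) (simp add: subseteq_mset_def)
    moreover have "\<nu> (add_mset v a - {#u#}) \<le> \<nu> (add_mset v a)"
      by (intro nu_mono) simp
    moreover have "\<nu> (add_mset v a) = \<nu> a"
      using assms by (simp only: not_augmenting)
    ultimately show ?thesis
      using u by (simp add: exposable_def)
  qed
  moreover have "v \<in> exposable (add_mset v a)"
    using assms by (simp add: exposable_def not_augmenting)
  ultimately show ?thesis by blast
qed

text \<open>
  Among the packings of \<open>b\<close> of the size of \<open>G\<close>, one whose degree vector exceeds that of \<open>F\<close> as little as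
  possible will do: a trail from \<open>s\<close> that moved a unit from \<open>t\<close> to \<open>s\<close> would, applied to this packing in the
  opposite direction, reduce the excess. Hence all trails from surplus vertices increase \<open>F\<close>.
\<close>
lemma normal_form:
  assumes F: "packing a F" and "packing b G" and ab: "a \<subseteq># b"
  obtains G' where "packing b G'" "size G' = size G"
    and "\<And>s. count (vertex_mset F) s < count (vertex_mset G') s \<Longrightarrow>
        \<exists>t F'. set_mset F' \<subseteq> E \<and> vertex_mset F' = vertex_mset F + {#s, t#}
          \<and> count (vertex_mset F + {#s#}) t < count (vertex_mset G') t"
proof -
  have "\<exists>G'. packing b G' \<and> size G' = size G \<and>
      (\<forall>s. count (vertex_mset F) s < count (vertex_mset G') s \<longrightarrow>
        (\<exists>t F'. set_mset F' \<subseteq> E \<and> vertex_mset F' = vertex_mset F + {#s, t#}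
          \<and> count (vertex_mset F + {#s#}) t < count (vertex_mset G') t))"
    using assms(2)
  proof (induction "size (vertex_mset G - vertex_mset F)" arbitrary: G rule: less_induct)
    case less
    show ?case
    proof (cases "\<forall>s. count (vertex_mset F) s < count (vertex_mset G) s \<longrightarrow>
        (\<exists>t F'. set_mset F' \<subseteq> E \<and> vertex_mset F' = vertex_mset F + {#s, t#}
          \<and> count (vertex_mset F + {#s#}) t < count (vertex_mset G) t)")
      case True
      then show ?thesis using less.prems by blast
    next
      case False
      then obtain s where s: "count (vertex_mset F) s < count (vertex_mset G) s"
        and no: "\<nexists>t F'. set_mset F' \<subseteq> E \<and> vertex_mset F' = vertex_mset F + {#s, t#}
          \<and> count (vertex_mset F + {#s#}) t < count (vertex_mset G) t" by blast
      obtain F' G' t where FG: "F' + G' = F + G" and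
        t: "vertex_mset F' = vertex_mset F + {#s, t#} \<and> count (vertex_mset F + {#s#}) t < count (vertex_mset G) t
       \<or> vertex_mset F' + {#t#} = vertex_mset F + {#s#} \<and> count (vertex_mset G) t < count (vertex_mset F) t"
        using exchange_edges[OF packing_card[OF F] packing_card[OF less.prems] s] by blast
      have sub: "set_mset F' \<subseteq> E" "set_mset G' \<subseteq> E"
      proof -
        have "set_mset (F' + G') \<subseteq> E"
          unfolding FG using F less.prems by (auto simp: packing_def)
        then show "set_mset F' \<subseteq> E" "set_mset G' \<subseteq> E" by auto
      qed
      have t': "vertex_mset F' + {#t#} = vertex_mset F + {#s#}" "count (vertex_mset G) t < count (vertex_mset F) t"
        using t no sub by blast+
      have sum: "vertex_mset F' + vertex_mset G' = vertex_mset F + vertex_mset G"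
        using arg_cong[OF FG, of vertex_mset] by simp
      have c1: "count (vertex_mset F') v + count {#t#} v = count (vertex_mset F) v + count {#s#} v" for v
        using arg_cong[OF t'(1), of "\<lambda>M. count M v"] by (simp only: count_union)
      have c2: "count (vertex_mset F') v + count (vertex_mset G') v = count (vertex_mset F) v + count (vertex_mset G) v" for v
        using arg_cong[OF sum, of "\<lambda>M. count M v"] by (simp only: count_union)
      have ts: "t \<noteq> s" using t'(2) s by auto
      have c3: "count (vertex_mset G') v + count {#s#} v = count (vertex_mset G) v + count {#t#} v" for v
        using c1[of v] c2[of v] by linarith
      have "count (vertex_mset G') v \<le> count b v" for v
      proof (cases "v = t")
        case True
        have "count (vertex_mset F) t \<le> count b t"
          using F ab by (meson mset_subset_eq_count packing_def subset_mset.order_trans)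
        then show ?thesis using c3[of t] t'(2) True ts by simp
      next
        case False
        have "count (vertex_mset G) v \<le> count b v"
          using less.prems by (meson mset_subset_eq_count packing_def)
        then show ?thesis using c3[of v] False by simp
      qed
      then have G': "packing b G'"
        using sub by (simp add: packing_def subseteq_mset_def)
      have sz: "size G' = size G"
      proof -
        have "size (vertex_mset G') + 1 = size (vertex_mset G) + 1"
        proof -
          have "vertex_mset G' + {#s#} = vertex_mset G + {#t#}"
            by (rule multiset_eqI) (simp only: count_union c3)
          from arg_cong[OF this, of size] show ?thesis by simp
        qed
        then show ?thesis using size_vertex_packing[OF G'] size_vertex_packing[OF less.prems] by simp
      qed
      have "add_mset s (vertex_mset G' - vertex_mset F) = vertex_mset G - vertex_mset F"
      proof (rule multiset_eqI)
        fix v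
        show "count (add_mset s (vertex_mset G' - vertex_mset F)) v = count (vertex_mset G - vertex_mset F) v"
          using c3[of v] s t'(2) ts by (auto split: if_splits)
      qed
      then have "size (vertex_mset G' - vertex_mset F) < size (vertex_mset G - vertex_mset F)"
        by (metis size_add_mset lessI)
      from less.hyps[OF this G'] sz show ?thesis by auto
    qed
  qed
  then show thesis using that by blast
qed

text \<open>
  Augmenting trails have two ends. If none of the vertices of \<open>T\<close> is augmenting, then both ends of every
  trail are in \<open>T\<close>, so each two elements of \<open>T\<close> account for at most one more edge.
\<close>
lemma nu_add_no_augmenting:
  assumes "\<And>t. t \<in># T \<Longrightarrow> t \<notin> augmenting a"
  shows "2 * \<nu> (a + T) \<le> 2 * \<nu> a + size T"
proof -
  obtain F where F: "packing a F" "size F = \<nu> a" by (rule obtain_packing)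
  obtain G0 where G0: "packing (a + T) G0" "size G0 = \<nu> (a + T)" by (rule obtain_packing)
  obtain G where G: "packing (a + T) G" "size G = \<nu> (a + T)" and
    pp: "\<And>s. count (vertex_mset F) s < count (vertex_mset G) s \<Longrightarrow>
        \<exists>t F'. set_mset F' \<subseteq> E \<and> vertex_mset F' = vertex_mset F + {#s, t#}
          \<and> count (vertex_mset F + {#s#}) t < count (vertex_mset G) t"
    using normal_form[OF F(1) G0(1)] G0(2) by (metis mset_subset_eq_add_left)
  have Fa: "count (vertex_mset F) v \<le> count a v" and Gb: "count (vertex_mset G) v \<le> count a v + count T v" for v
    using F(1) G(1) by (auto simp: packing_def subseteq_mset_def)
  have sat: "count a s \<le> count (vertex_mset F) s" if s: "count (vertex_mset F) s < count (vertex_mset G) s" for s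
  proof (rule ccontr)
    assume "\<not> ?thesis"
    then have Fs: "vertex_mset F + {#s#} \<subseteq># a"
      using Fa by (auto simp: subseteq_mset_def Suc_le_eq)
    obtain t F' where F': "set_mset F' \<subseteq> E" "vertex_mset F' = vertex_mset F + {#s, t#}"
      and t: "count (vertex_mset F + {#s#}) t < count (vertex_mset G) t"
      using pp[OF s] by blast
    have sz: "size F' = Suc (\<nu> a)"
    proof -
      have "size (vertex_mset F') = 2 * size F'"
        using F'(1) card_edge by (intro size_vertex_mset) blast
      then show ?thesis using F'(2) F(2) size_vertex_packing[OF F(1)] by simp
    qed
    show False
    proof (cases "t \<in># T")
      case True
      have "packing (add_mset t a) F'"
        using F' mset_subset_eq_mono_add[OF Fs, of "{#t#}" "{#t#}"]
        by (simp add: packing_def add_mset_commute)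
      from packing_le[OF this] sz assms[OF True] show False
        by (simp add: not_augmenting)
    next
      case False
      then have "count T t = 0" by (simp add: not_in_iff)
      then have "count (vertex_mset F + {#s#}) t < count a t"
        using t Gb[of t] by simp
      then have "vertex_mset F + {#s#} + {#t#} \<subseteq># a"
        using Fs unfolding subseteq_mset_def by (auto simp: Suc_le_eq)
      then have "packing a F'"
        using F' by (simp add: packing_def add_mset_commute)
      from packing_le[OF this] sz show False by simp
    qed
  qed
  have "vertex_mset G - vertex_mset F \<subseteq># T"
    unfolding subseteq_mset_def
  proof
    fix v show "count (vertex_mset G - vertex_mset F) v \<le> count T v"
      using sat[of v] Gb[of v] by fastforce
  qed
  from size_mset_mono[OF this] have "size (vertex_mset G) \<le> size (vertex_mset F) + size T"
    using size_Diff_submset diff_size_le_size_Diff[of "vertex_mset G" "vertex_mset F"] by linarith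
  then show ?thesis
    using size_vertex_packing[OF F(1)] size_vertex_packing[OF G(1)] F(2) G(2) by simp
qed

text \<open>The first augmenting trail uses only its two ends.\<close>
lemma augmenting_pair:
  assumes "\<nu> a < \<nu> (a + T)"
  obtains T' where "T' \<subseteq># T" "size T' \<le> 2" "\<nu> a < \<nu> (a + T')"
proof -
  obtain F where F: "packing a F" "size F = \<nu> a" by (rule obtain_packing)
  obtain G0 where G0: "packing (a + T) G0" "size G0 = \<nu> (a + T)" by (rule obtain_packing)
  obtain G where G: "packing (a + T) G" "size G = \<nu> (a + T)" and
    pp: "\<And>s. count (vertex_mset F) s < count (vertex_mset G) s \<Longrightarrow>
        \<exists>t F'. set_mset F' \<subseteq> E \<and> vertex_mset F' = vertex_mset F + {#s, t#}
          \<and> count (vertex_mset F + {#s#}) t < count (vertex_mset G) t"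
    using normal_form[OF F(1) G0(1)] G0(2) by (metis mset_subset_eq_add_left)
  have Fa: "count (vertex_mset F) v \<le> count a v" and Gb: "count (vertex_mset G) v \<le> count a v + count T v" for v
    using F(1) G(1) by (auto simp: packing_def subseteq_mset_def)
  have "\<exists>s. count (vertex_mset F) s < count (vertex_mset G) s"
  proof (rule ccontr)
    assume "\<not> ?thesis"
    then have "vertex_mset G \<subseteq># vertex_mset F" by (auto simp: subseteq_mset_def not_less)
    from size_mset_mono[OF this] show False
      using size_vertex_packing[OF F(1)] size_vertex_packing[OF G(1)] F(2) G(2) assms by simp
  qed
  then obtain s t F' where s: "count (vertex_mset F) s < count (vertex_mset G) s"
    and F': "set_mset F' \<subseteq> E" "vertex_mset F' = vertex_mset F + {#s, t#}"
    and t: "count (vertex_mset F + {#s#}) t < count (vertex_mset G) t"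
    using pp by blast
  have sz: "size F' = Suc (\<nu> a)"
  proof -
    have "size (vertex_mset F') = 2 * size F'"
      using F'(1) card_edge by (intro size_vertex_mset) blast
    then show ?thesis using F'(2) F(2) size_vertex_packing[OF F(1)] by simp
  qed
  define T' where "T' = vertex_mset F' - a"
  have "T' \<subseteq># T"
    unfolding T'_def F'(2) subseteq_mset_def
  proof
    fix v show "count (vertex_mset F + {#s, t#} - a) v \<le> count T v"
      using Fa[of v] Gb[of v] s t by (auto split: if_splits)
  qed
  moreover have "T' \<subseteq># {#s, t#}"
    unfolding T'_def F'(2) subseteq_mset_def
  proof
    fix v show "count (vertex_mset F + {#s, t#} - a) v \<le> count {#s, t#} v"
      using Fa[of v] by (auto split: if_splits)
  qed
  then have "size T' \<le> 2" using size_mset_mono by fastforce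
  moreover have "packing (a + T') F'"
    using F'(1) by (auto simp: packing_def T'_def subseteq_mset_def)
  then have "\<nu> a < \<nu> (a + T')" using packing_le[of "a + T'" F'] sz by simp
  ultimately show thesis using that by blast
qed

text \<open>
  Suppose that, once \<open>v\<close> is added, a copy of \<open>u\<close> can be exposed; in terms of trails, an even alternating trail
  leads from \<open>v\<close> to \<open>u\<close>. If \<open>u\<close> is augmenting but not exposable, a second trail leads from \<open>u\<close> to an
  uncovered vertex, reaching \<open>u\<close> by an edge outside the packing, and it can be continued along the first
  trail back to \<open>v\<close>. The proof exchanges a maximum packing \<open>F\<close> of \<open>a + u\<close> with one of \<open>a - u + v\<close>, starting
  at \<open>v\<close>, and every outcome other than an augmentation by \<open>v\<close> contradicts the hypotheses.
\<close>
lemma augmenting_swap: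
  assumes u: "u \<in># a" and ue: "u \<notin> exposable a" and ua: "u \<in> augmenting a"
    and v: "\<nu> (add_mset v a - {#u#}) = \<nu> a"
  shows "v \<in> augmenting a"
proof (rule ccontr)
  assume va: "v \<notin> augmenting a"
  then have vu: "v \<noteq> u" using ua by auto
  obtain b where b: "a = add_mset u b" using u by (metis mset_add)
  have nb: "\<nu> b < \<nu> a"
    using ue nu_mono[of b a] by (auto simp: b exposable_def)
  obtain F where F: "packing (add_mset u a) F" "size F = \<nu> (add_mset u a)" by (rule obtain_packing)
  obtain G where G: "packing (add_mset v b) G" "size G = \<nu> (add_mset v b)" by (rule obtain_packing)
  have sF: "size F = Suc (\<nu> a)" using F(2) ua by (simp add: augmenting_def)
  have sG: "size G = \<nu> a" using G(2) v vu by (simp add: b)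
  have cF: "count (vertex_mset F) x \<le> count a x + count {#u#} x"
    and cG: "count (vertex_mset G) x \<le> count b x + count {#v#} x" for x
    using F(1) G(1) by (auto simp: packing_def subseteq_mset_def dest!: spec[of _ x])
  have Gv: "count b v < count (vertex_mset G) v"
  proof (rule ccontr)
    assume "\<not> ?thesis"
    then have "count (vertex_mset G) x \<le> count b x" for x using cG[of x] by (cases "x = v") auto
    then have "packing b G" using G(1) by (simp add: packing_def subseteq_mset_def)
    from packing_le[OF this] sG nb show False by simp
  qed
  then have d: "count (vertex_mset F) v < count (vertex_mset G) v"
    using cF[of v] vu by (simp add: b)
  obtain F' G' t where FG: "F' + G' = F + G" and
    t: "vertex_mset F' = vertex_mset F + {#v, t#} \<and> count (vertex_mset F + {#v#}) t < count (vertex_mset G) t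
     \<or> vertex_mset F' + {#t#} = vertex_mset F + {#v#} \<and> count (vertex_mset G) t < count (vertex_mset F) t"
    using exchange_edges[OF packing_card[OF F(1)] packing_card[OF G(1)] d] by blast
  have sub: "set_mset F' \<subseteq> E" "set_mset G' \<subseteq> E"
  proof -
    have "set_mset (F' + G') \<subseteq> E"
      unfolding FG using F(1) G(1) by (auto simp: packing_def)
    then show "set_mset F' \<subseteq> E" "set_mset G' \<subseteq> E" by auto
  qed
  have szF': "size (vertex_mset F') = 2 * size F'"
    using sub(1) card_edge by (intro size_vertex_mset) blast
  have szF: "size (vertex_mset F) = 2 * Suc (\<nu> a)"
    using size_vertex_packing[OF F(1)] sF by simp
  have nuv: "\<nu> (add_mset v a) = \<nu> a" using va by (simp add: not_augmenting)
  from t show False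
  proof (elim disjE conjE)
    \<comment> \<open>Then \<open>\<nu> (a + u + v) = \<nu> a + 2\<close>, so \<open>v\<close> is augmenting.\<close>
    assume F': "vertex_mset F' = vertex_mset F + {#v, t#}"
      and lt: "count (vertex_mset F + {#v#}) t < count (vertex_mset G) t"
    have "count (vertex_mset F') x \<le> count (add_mset u (add_mset v a)) x" for x
      using cF[of x] cG[of x] lt unfolding F' b by (auto split: if_splits)
    then have "packing (add_mset u (add_mset v a)) F'"
      using sub by (simp add: packing_def subseteq_mset_def)
    from packing_le[OF this] nu_add_le[of u "add_mset v a"] nuv
    have "size F' \<le> Suc (\<nu> a)" by simp
    then show False using szF' szF unfolding F' by simp
  next
    assume F': "vertex_mset F' + {#t#} = vertex_mset F + {#v#}"
      and lt: "count (vertex_mset G) t < count (vertex_mset F) t"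
    have c1: "count (vertex_mset F') x + count {#t#} x = count (vertex_mset F) x + count {#v#} x" for x
      using arg_cong[OF F', of "\<lambda>M. count M x"] by (simp only: count_union)
    have sF': "size F' = Suc (\<nu> a)"
      using arg_cong[OF F', of size] szF' szF by simp
    have tv: "t \<noteq> v" using lt d by auto
    show False
    proof (cases "t = u")
      case True
      have "count (vertex_mset F') x \<le> count (add_mset v a) x" for x
        using c1[of x] cF[of x] True by (auto split: if_splits)
      then have "packing (add_mset v a) F'"
        using sub by (simp add: packing_def subseteq_mset_def)
      from packing_le[OF this] sF' nuv show False by simp
    next
      case False
      have sum: "vertex_mset F' + vertex_mset G' = vertex_mset F + vertex_mset G"
        using arg_cong[OF FG, of vertex_mset] by simp
      have c2: "count (vertex_mset F') x + count (vertex_mset G') x = count (vertex_mset F) x + count (vertex_mset G) x" for x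
        using arg_cong[OF sum, of "\<lambda>M. count M x"] by (simp only: count_union)
      have c3: "count (vertex_mset G') x + count {#v#} x = count (vertex_mset G) x + count {#t#} x" for x
        using c1[of x] c2[of x] by linarith
      have "count (vertex_mset G') x \<le> count b x" for x
      proof (cases "x = t")
        case True
        then show ?thesis using c3[of t] lt cF[of t] tv False by (simp add: b)
      next
        case False
        then show ?thesis using c3[of x] cG[of x] by (cases "x = v") auto
      qed
      then have "packing b G'"
        using sub by (simp add: packing_def subseteq_mset_def)
      moreover have "size G' = \<nu> a"
        using arg_cong[OF FG, of size] sF sG sF' by simp
      ultimately show False using packing_le[of b G'] nb by simp
    qed
  qed
qed

text \<open>
  In a maximum packing of \<open>a + p + q\<close> some edge \<open>uq\<close> covers the new copy of \<open>q\<close>, and then \<open>u\<close> becomes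
  exposable when \<open>p\<close> alone is added. Since \<open>M\<close> dominates \<open>uq\<close>, some edge of \<open>M\<close> contains \<open>u\<close> or \<open>q\<close>; adding
  \<open>p\<close> exposes \<open>u\<close>, adding \<open>q\<close> exposes \<open>q\<close>. Before that, neither end of this edge is exposable: otherwise \<open>u\<close>
  or \<open>q\<close> would be augmenting, which for \<open>u\<close> is excluded by \<open>augmenting_swap\<close>.
\<close>
lemma newly_exposable_dominating_edge:
  assumes M: "M \<subseteq> E" "\<And>e. e \<in> E \<Longrightarrow> e \<inter> \<Union>M \<noteq> {}"
    and p: "p \<notin> augmenting a" and q: "q \<notin> augmenting a"
    and pq: "\<nu> a < \<nu> (a + {#p, q#})"
  obtains v e where "v \<in> {p, q}" "e \<in> M" "e \<inter> exposable a = {}" "e \<inter> exposable (add_mset v a) \<noteq> {}"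
proof -
  have nup: "\<nu> (add_mset p a) = \<nu> a" using p by (simp only: not_augmenting)
  obtain F where F: "packing (add_mset q (add_mset p a)) F" "size F = \<nu> (add_mset q (add_mset p a))"
    by (rule obtain_packing)
  have sF: "\<nu> a < size F" using pq F(2) by (simp add: add_mset_commute)
  then have "\<not> packing (add_mset p a) F" using packing_le[of "add_mset p a" F] nup by auto
  then obtain u G where u: "{u, q} \<in> E" "F = add_mset {u, q} G" "packing (add_mset p a - {#u#}) G"
    "u \<in># add_mset p a"
    by (rule packing_remove[OF F(1)]) blast
  have "\<nu> (add_mset p a - {#u#}) \<le> \<nu> a"
    using nu_mono[of "add_mset p a - {#u#}" "add_mset p a"] nup by simp
  then have nuu: "\<nu> (add_mset p a - {#u#}) = \<nu> a"
    using packing_le[OF u(3)] sF u(2) by simp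
  have ue': "u \<in> exposable (add_mset p a)"
    using nuu nup u(4) by (simp add: exposable_def)
  have ue: "u \<notin> exposable a"
    using exposable_neighbour u(1) q by blast
  have ua: "u \<notin> augmenting a"
    using augmenting_swap[OF _ ue _ nuu] u(4) p by auto
  have "{q, u} \<in> E" using u(1) by (simp add: insert_commute)
  then have qe: "q \<notin> exposable a"
    using exposable_neighbour ua by blast
  have no: "e \<inter> exposable a = {}" if h: "e \<in> M" "x \<in> e" "x \<notin> exposable a" "x \<notin> augmenting a" for e x
  proof -
    have eE: "e \<in> E" using M(1) h(1) by blast
    obtain y where y: "e = {y, x}"
      using card_edge[OF eE] h(2) by (auto simp: card_2_iff)
    then have "y \<notin> exposable a" using exposable_neighbour[of y a x] eE h(4) by blast
    then show ?thesis using y h(3) by simp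
  qed
  obtain e where e: "e \<in> M" "u \<in> e \<or> q \<in> e" using M(2)[OF u(1)] by auto
  from e(2) show thesis
  proof
    assume "u \<in> e"
    then show thesis using that[of p e] no[OF e(1) _ ue ua] e(1) ue' by auto
  next
    assume "q \<in> e"
    moreover have "q \<in> exposable (add_mset q a)" using exposable_add[OF q] by simp
    ultimately show thesis using that[of q e] no[OF e(1) _ qe q] e(1) by auto
  qed
qed

text \<open>
  When \<open>v\<close> is first wasted and then matched with the help of \<open>w\<close>, the trail between them avoids everything
  that can be reached from the vertices wasted before. So the exposable vertices of \<open>a\<close> are still
  exposable, and no vertex becomes augmenting. The latter is a count: with \<open>q\<close> newly augmenting, three
  non-augmenting vertices \<open>q\<close>, \<open>w\<close>, \<open>v\<close> would account for two more edges.
\<close>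
lemma augment_pair_stable:
  assumes v: "v \<notin> augmenting a" and w: "w \<notin> augmenting a" and "w \<in> augmenting (add_mset v a)"
  shows "exposable a \<subseteq> exposable (add_mset w (add_mset v a))"
    and "augmenting (add_mset w (add_mset v a)) \<subseteq> augmenting a"
proof -
  have nuv: "\<nu> (add_mset v a) = \<nu> a" using v by (simp only: not_augmenting)
  then have nuw: "\<nu> (add_mset w (add_mset v a)) = Suc (\<nu> a)"
    using assms(3) by (simp add: augmenting_def)
  show "augmenting (add_mset w (add_mset v a)) \<subseteq> augmenting a"
  proof
    fix q assume "q \<in> augmenting (add_mset w (add_mset v a))"
    then have "\<nu> (a + {#q, w, v#}) = Suc (Suc (\<nu> a))"
      using nuw by (simp add: augmenting_def)
    then show "q \<in> augmenting a"
      using nu_add_no_augmenting[of "{#q, w, v#}" a] v w by auto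
  qed
  show "exposable a \<subseteq> exposable (add_mset w (add_mset v a))"
  proof
    fix u assume "u \<in> exposable a"
    then obtain b where b: "a = add_mset u b" and nb: "\<nu> b = \<nu> a"
      by (auto simp: exposable_def dest!: multi_member_split)
    have "\<nu> b < \<nu> (b + {#u, v, w#})"
      using nuw nb b by (simp add: add_mset_commute)
    then obtain T where T: "T \<subseteq># {#u, v, w#}" "size T \<le> 2" "\<nu> b < \<nu> (b + T)"
      by (rule augmenting_pair)
    have "T \<subseteq># {#v, w#}"
    proof (rule ccontr)
      assume no: "\<not> T \<subseteq># {#v, w#}"
      have "u \<in># T"
      proof (rule ccontr)
        assume "u \<notin># T"
        then have "T \<subseteq># {#v, w#}"
          using T(1) unfolding subseteq_mset_def not_in_iff by (metis count_add_mset le0)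
        with no show False ..
      qed
      then obtain S where S: "T = add_mset u S" by (metis mset_add)
      then have "S \<subseteq># {#v, w#}" "size S \<le> 1" using T by (auto simp: add_mset_commute)
      then have "S = {#} \<or> S = {#v#} \<or> S = {#w#}"
        by (cases S) (auto simp: insert_subset_eq_iff split: if_splits)
      then have "\<nu> (a + S) = \<nu> a"
        using v w by (auto simp: not_augmenting)
      then show False using T(3) nb S b by simp
    qed
    then have "\<nu> (b + T) \<le> \<nu> (b + {#v, w#})" by (intro nu_mono subset_mset.add_left_mono)
    then have "Suc (\<nu> a) \<le> \<nu> (b + {#v, w#})" using T(3) nb by simp
    moreover have "\<nu> (b + {#v, w#}) \<le> \<nu> (add_mset w (add_mset v a))"
      by (intro nu_mono) (simp add: b subseteq_mset_def)
    ultimately show "u \<in> exposable (add_mset w (add_mset v a))"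
      using nuw by (simp add: exposable_def b add_mset_commute)
  qed
qed

text \<open>
  The game, for an arbitrary relation \<open>R U r\<close> in place of "the monomial ideal with exponents in \<open>U\<close> has
  regularity at most \<open>r\<close>". The edges of \<open>M\<close> may be any edges that dominate all others.
\<close>
context
  fixes R :: "'v multiset set \<Rightarrow> int \<Rightarrow> bool" and M :: "'v set set" and s :: nat
  assumes R_empty: "\<And>r. R {} r"
    and R_UNIV: "\<And>r. 0 \<le> r \<Longrightarrow> R UNIV r"
    and R_step: "\<And>U v r. (\<And>m m'. m \<in> U \<Longrightarrow> m \<subseteq># m' \<Longrightarrow> m' \<in> U) \<Longrightarrow>
        R {m. add_mset v m \<in> U} (r - 1) \<Longrightarrow> R {m. filter_mset (\<lambda>x. x \<noteq> v) m \<in> U} r \<Longrightarrow> R U r"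
    and M: "M \<subseteq> E" and dominating: "\<And>e. e \<in> E \<Longrightarrow> e \<inter> \<Union>M \<noteq> {}"
begin

text \<open>
  The exponents of the ideal \<open>I\<^sup>s : x\<^sup>a\<close> after the variables in \<open>Z\<close> have been deleted from its
  generators.
\<close>
definition state :: "'v multiset \<Rightarrow> 'v set \<Rightarrow> 'v multiset set"
  where "state a Z = {m. s \<le> \<nu> (a + filter_mset (\<lambda>x. x \<notin> Z) m)}"

definition touched :: "'v multiset \<Rightarrow> 'v set set"
  where "touched a = {e \<in> M. e \<inter> exposable a \<noteq> {}}"

definition few_wasted :: "'v multiset \<Rightarrow> bool"
  where "few_wasted a \<longleftrightarrow> size a \<le> 2 * \<nu> a + card (touched a)"

lemma touched_mono: "exposable a \<subseteq> exposable b \<Longrightarrow> card (touched a) \<le> card (touched b)"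
  unfolding touched_def by (intro card_mono) auto

lemma few_wasted_size: "few_wasted a \<Longrightarrow> size a \<le> 2 * \<nu> a + card M"
proof -
  have "card (touched a) \<le> card M"
    unfolding touched_def by (intro card_mono) auto
  then show "few_wasted a \<Longrightarrow> size a \<le> 2 * \<nu> a + card M"
    by (simp add: few_wasted_def)
qed

lemma state_step:
  assumes v: "v \<notin> Z"
    and "R (state (add_mset v a) Z) (r - 1)" "R (state a (insert v Z)) r"
  shows "R (state a Z) r"
proof (rule R_step)
  fix m m' :: "'v multiset"
  assume "m \<in> state a Z" "m \<subseteq># m'"
  then show "m' \<in> state a Z"
    unfolding state_def mem_Collect_eq
    by (elim order_trans) (intro nu_mono subset_mset.add_left_mono multiset_filter_mono)
next
  have "{m. add_mset v m \<in> state a Z} = state (add_mset v a) Z"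
    using v by (simp add: state_def)
  then show "R {m. add_mset v m \<in> state a Z} (r - 1)" using assms(2) by simp
next
  have "{m. filter_mset (\<lambda>x. x \<noteq> v) m \<in> state a Z} = state a (insert v Z)"
    by (simp add: state_def filter_filter_mset conj_commute)
  then show "R {m. filter_mset (\<lambda>x. x \<noteq> v) m \<in> state a Z} r" using assms(3) by simp
qed

text \<open>
  The invariant of the strategy is \<open>few_wasted\<close>. In the first case of the last hypothesis all augmenting
  vertices are deleted. In the second case \<open>v\<close> has just been wasted in such a position \<open>b\<close>, and the
  augmenting vertices that its addition has created are still to be named one by one.
\<close>
lemma state_bound:
  assumes "\<nu> a < s" and "few_wasted a"
    and "augmenting a \<subseteq> Z \<or>
      (\<exists>b v. a = add_mset v b \<and> v \<notin> augmenting b \<and> augmenting b \<subseteq> Z \<and> few_wasted b)"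
  shows "R (state a Z) (2 * int s + int (card M) - 1 - int (size a))"
  using assms
proof (induction "(2 * s + card M - size a) + card (- Z)" arbitrary: a Z rule: less_induct)
  case less
  \<comment> \<open>At least two more vertices fit into \<open>a\<close>: the measure decreases when one is added, and an immediate end of the game stays within the bound.\<close>
  have room: "size a + 2 \<le> 2 * s + card M"
    using few_wasted_size[OF less.prems(2)] less.prems(1) by linarith
  have smaller: "card (- insert v Z) < card (- Z)" if "v \<notin> Z" for v
    using that by (intro psubset_card_mono) auto
  have minus: "2 * int s + int (card M) - 1 - int (size a) - 1
      = 2 * int s + int (card M) - 1 - int (size (add_mset v a))" for v
    by simp
  show ?case
  proof (cases "augmenting a \<subseteq> Z")
    case stable: True
    show ?thesis
    proof (cases "\<exists>m. s \<le> \<nu> (a + filter_mset (\<lambda>x. x \<notin> Z) m)")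
      case False
      then have "state a Z = {}" by (auto simp: state_def)
      then show ?thesis using R_empty by simp
    next
      case True
      then obtain m where "\<nu> a < \<nu> (a + filter_mset (\<lambda>x. x \<notin> Z) m)"
        using less.prems(1) by (meson less_le_trans)
      then obtain T where T: "T \<subseteq># filter_mset (\<lambda>x. x \<notin> Z) m" "size T \<le> 2" "\<nu> a < \<nu> (a + T)"
        by (rule augmenting_pair)
      have TZ: "x \<notin> Z" if "x \<in># T" for x
        using mset_subset_eqD[OF T(1) that] by simp
      have "T \<noteq> {#}" using T(3) by auto
      then obtain p T1 where T1: "T = add_mset p T1" by (meson multiset_cases)
      obtain q where q: "q \<notin> Z" "T \<subseteq># {#p, q#}"
      proof (cases "T1 = {#}")
        case True
        then show thesis using that[of p] TZ T1 by simp
      next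
        case False
        then obtain q T2 where T2: "T1 = add_mset q T2" by (meson multiset_cases)
        then have "T2 = {#}" using T(2) T1 by simp
        then show thesis using that[of q] TZ T1 T2 by simp
      qed
      have p: "p \<notin> Z" using TZ T1 by simp
      have "\<nu> (a + T) \<le> \<nu> (a + {#p, q#})" using q(2) by (intro nu_mono subset_mset.add_left_mono)
      then have pq: "\<nu> a < \<nu> (a + {#p, q#})" using T(3) by simp
      obtain v e where v: "v \<in> {p, q}" and e: "e \<in> M" "e \<inter> exposable a = {}" "e \<inter> exposable (add_mset v a) \<noteq> {}"
        using newly_exposable_dominating_edge[OF M dominating _ _ pq] p q(1) stable by blast
      have vZ: "v \<notin> Z" using v p q(1) by auto
      then have va: "v \<notin> augmenting a" using stable by blast
      then have nuv: "\<nu> (add_mset v a) = \<nu> a" by (simp only: not_augmenting)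
      have "touched a \<subset> touched (add_mset v a)"
        using exposable_add[OF va] e by (auto simp: touched_def)
      then have "card (touched a) < card (touched (add_mset v a))"
        by (intro psubset_card_mono) auto
      then have few: "few_wasted (add_mset v a)"
        using less.prems(2) nuv by (simp add: few_wasted_def)
      show ?thesis
      proof (rule state_step[OF vZ])
        show "R (state (add_mset v a) Z) (2 * int s + int (card M) - 1 - int (size a) - 1)"
          unfolding minus[of v]
        proof (rule less.hyps)
          show "2 * s + card M - size (add_mset v a) + card (- Z) < 2 * s + card M - size a + card (- Z)"
            using room by simp
          show "\<nu> (add_mset v a) < s" using nuv less.prems(1) by simp
          show "augmenting (add_mset v a) \<subseteq> Z \<or>
            (\<exists>b w. add_mset v a = add_mset w b \<and> w \<notin> augmenting b \<and> augmenting b \<subseteq> Z \<and> few_wasted b)"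
            using va stable less.prems(2) by blast
        qed (rule few)
        show "R (state a (insert v Z)) (2 * int s + int (card M) - 1 - int (size a))"
          by (rule less.hyps) (use smaller[OF vZ] less.prems(1,2) stable in auto)
      qed
    qed
  next
    case False
    then obtain b v where b: "a = add_mset v b" "v \<notin> augmenting b" "augmenting b \<subseteq> Z" "few_wasted b"
      using less.prems(3) by blast
    obtain w where w: "w \<in> augmenting a" "w \<notin> Z" using False by blast
    have wb: "w \<notin> augmenting b" using b(3) w(2) by blast
    have nuw: "\<nu> (add_mset w a) = Suc (\<nu> a)" using w(1) by (simp add: augmenting_def)
    have nub: "\<nu> a = \<nu> b" using b(1,2) by (simp add: not_augmenting)
    note stab = augment_pair_stable[OF b(2) wb, folded b(1), OF w(1)]
    have few: "few_wasted (add_mset w a)"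
      using b(4) touched_mono[OF stab(1)] nuw nub b(1) by (simp add: few_wasted_def)
    show ?thesis
    proof (rule state_step[OF w(2)])
      show "R (state (add_mset w a) Z) (2 * int s + int (card M) - 1 - int (size a) - 1)"
      proof (cases "\<nu> (add_mset w a) < s")
        case True
        show ?thesis unfolding minus[of w]
        proof (rule less.hyps[OF _ True few])
          show "2 * s + card M - size (add_mset w a) + card (- Z) < 2 * s + card M - size a + card (- Z)"
            using room by simp
        qed (use stab(2) b(3) in blast)
      next
        case False
        have "s \<le> \<nu> (add_mset w a + m)" for m
          using False nu_mono[of "add_mset w a" "add_mset w a + m"] by simp
        then have "state (add_mset w a) Z = UNIV" by (auto simp: state_def)
        then show ?thesis using R_UNIV room by simp
      qed
      show "R (state a (insert w Z)) (2 * int s + int (card M) - 1 - int (size a))"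
      proof (rule less.hyps)
        show "2 * s + card M - size a + card (- insert w Z) < 2 * s + card M - size a + card (- Z)"
          using smaller[OF w(2)] by simp
      qed (use less.prems(1,2) b in blast)+
    qed
  qed
qed

theorem power_bound:
  assumes "s \<ge> 1"
  shows "R {m. s \<le> \<nu> m} (2 * int s + int (card M) - 1)"
proof -
  have "augmenting {#} = {}"
  proof -
    have "\<nu> {#v#} = 0" for v using nu_bound[of "{#v#}"] by simp
    then show ?thesis by (auto simp: augmenting_def)
  qed
  then have "R (state {#} {}) (2 * int s + int (card M) - 1)"
    using state_bound[of "{#}" "{}"] assms by (simp add: few_wasted_def)
  then show ?thesis by (simp add: state_def)
qed

end

end

section \<open>Koszul homology and regularity of monomial ideals\<close>

lemma lookup_single_mult_add:
  fixes p :: "'a::cancel_comm_monoid_add \<Rightarrow>\<^sub>0 'b::semiring_1"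
  shows "Poly_Mapping.lookup (Poly_Mapping.single k c * p) (k + m) = c * Poly_Mapping.lookup p m"
proof -
  have "Poly_Mapping.lookup (Poly_Mapping.single k c * p) (k + m)
      = (\<Sum>l. (c when k = l) * (\<Sum>q. Poly_Mapping.lookup p q when k + m = l + q))"
    by (simp add: lookup_mult lookup_single)
  also have "\<dots> = (\<Sum>l. (c * (\<Sum>q. Poly_Mapping.lookup p q when k + m = l + q)) when k = l)"
    by (rule Sum_any.cong) (simp add: when_def)
  also have "\<dots> = c * (\<Sum>q. Poly_Mapping.lookup p q when k + m = k + q)"
    by simp
  also have "\<dots> = c * Poly_Mapping.lookup p m"
    by simp
  finally show ?thesis .
qed

lemma lookup_Var_mult:
  "Poly_Mapping.lookup (Var v * p) m =
    (if 0 < Poly_Mapping.lookup m v then Poly_Mapping.lookup p (m - Poly_Mapping.single v 1) else 0)"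
proof (cases "0 < Poly_Mapping.lookup m v")
  case True
  then have "m = Poly_Mapping.single v 1 + (m - Poly_Mapping.single v 1)"
    by (intro poly_mapping_eqI) (auto simp: lookup_add lookup_minus lookup_single when_def)
  then show ?thesis
    using True lookup_single_mult_add[of "Poly_Mapping.single v 1" 1 p "m - Poly_Mapping.single v 1"]
    by (simp add: Var_def)
next
  case False
  have "m \<notin> Poly_Mapping.keys (Var v * p)"
  proof
    assume "m \<in> Poly_Mapping.keys (Var v * p)"
    then obtain b where "m = Poly_Mapping.single v 1 + b"
      using keys_mult[of "Var v" p] by (auto simp: Var_def)
    then show False using False by (simp add: lookup_add)
  qed
  then show ?thesis using False by (simp add: not_in_keys_iff_lookup_eq_zero)
qed

lift_definition restrict_keys :: "('a \<Rightarrow> bool) \<Rightarrow> ('a \<Rightarrow>\<^sub>0 'b::zero) \<Rightarrow> ('a \<Rightarrow>\<^sub>0 'b)"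
  is "\<lambda>P f k. if P k then f k else 0"
  by (erule finite_subset[rotated]) auto

lemma keys_restrict_keys: "Poly_Mapping.keys (restrict_keys P p) = {m \<in> Poly_Mapping.keys p. P m}"
  by (auto simp: in_keys_iff restrict_keys.rep_eq split: if_splits)

lemma restrict_keys_split: "restrict_keys P p + restrict_keys (\<lambda>m. \<not> P m) p = (p :: _ \<Rightarrow>\<^sub>0 'b::monoid_add)"
  by (rule poly_mapping_eqI) (simp add: lookup_add restrict_keys.rep_eq)

text \<open>
  The sign of \<open>v\<close> relative to \<open>\<sigma>\<close> in the exterior algebra on the variables, with respect to an arbitrary
  linear order of the variables, here the one given by \<open>to_nat\<close>.
\<close>
definition koszul_sign :: "'v::finite \<Rightarrow> 'v set \<Rightarrow> 'a::comm_ring_1"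
  where "koszul_sign v \<sigma> = (- 1) ^ card {u \<in> \<sigma>. to_nat u < to_nat v}"

lemma koszul_sign_square [simp]: "koszul_sign v \<sigma> * koszul_sign v \<sigma> = 1"
  by (simp add: koszul_sign_def flip: power_mult_distrib)

lemma koszul_sign_insert:
  assumes "u \<notin> \<sigma>"
  shows "koszul_sign v (insert u \<sigma>) = (if to_nat u < to_nat v then - koszul_sign v \<sigma> else koszul_sign v \<sigma>)"
proof -
  have "{w \<in> insert u \<sigma>. to_nat w < to_nat v} =
      (if to_nat u < to_nat v then insert u {w \<in> \<sigma>. to_nat w < to_nat v} else {w \<in> \<sigma>. to_nat w < to_nat v})"
    by auto
  then show ?thesis using assms by (simp add: koszul_sign_def)
qed

lemma koszul_sign_swap:
  assumes "u \<noteq> v" "u \<notin> \<sigma>" "v \<notin> \<sigma>"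
  shows "koszul_sign v \<sigma> * koszul_sign u (insert v \<sigma>) = - (koszul_sign u \<sigma> * koszul_sign v (insert u \<sigma>))"
proof -
  have "to_nat u < to_nat v \<or> to_nat v < to_nat u"
    using assms(1) by (metis linorder_neqE_nat to_nat_split)
  then show ?thesis using assms by (auto simp: koszul_sign_insert)
qed

text \<open>
  The boundary of the Koszul complex on the variables. A chain \<open>z\<close> maps \<open>\<sigma>\<close> to the coefficient of the
  basis element \<open>e\<^sub>\<sigma>\<close> of the exterior algebra; chains of different exterior degree are not separated.
\<close>
definition koszul_bd :: "('v::finite set \<Rightarrow> ('v, 'k::field) mpoly) \<Rightarrow> 'v set \<Rightarrow> ('v, 'k) mpoly"
  where "koszul_bd z \<sigma> = (\<Sum>v\<in>- \<sigma>. koszul_sign v \<sigma> * (Var v * z (insert v \<sigma>)))"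

lemma koszul_bd_zero: "koszul_bd (\<lambda>_. 0) = (\<lambda>_. 0)"
  by (simp add: koszul_bd_def fun_eq_iff)

lemma koszul_bd_add: "koszul_bd (\<lambda>\<sigma>. z \<sigma> + w \<sigma>) \<sigma> = koszul_bd z \<sigma> + koszul_bd w \<sigma>"
  by (simp add: koszul_bd_def algebra_simps sum.distrib)

lemma koszul_bd_diff: "koszul_bd (\<lambda>\<sigma>. z \<sigma> - w \<sigma>) \<sigma> = koszul_bd z \<sigma> - koszul_bd w \<sigma>"
  by (simp add: koszul_bd_def algebra_simps sum_subtractf)

lemma koszul_bd_mult: "koszul_bd (\<lambda>\<sigma>. p * z \<sigma>) \<sigma> = p * koszul_bd z \<sigma>"
  by (simp add: koszul_bd_def sum_distrib_left algebra_simps)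

lemma koszul_bd_sum: "koszul_bd (\<lambda>\<sigma>. \<Sum>c\<in>A. z c \<sigma>) \<sigma> = (\<Sum>c\<in>A. koszul_bd (z c) \<sigma>)"
  by (induction A rule: infinite_finite_induct) (simp_all add: koszul_bd_add koszul_bd_zero)

text \<open>
  The induction cancels the terms in pairs; the argument \<open>x = - x\<close> would fail in characteristic two.
\<close>
lemma sum_antisymmetric:
  fixes f :: "'a \<Rightarrow> 'a \<Rightarrow> 'b::ab_group_add"
  assumes "finite A" "\<And>u v. u \<in> A \<Longrightarrow> v \<in> A \<Longrightarrow> u \<noteq> v \<Longrightarrow> f u v = - f v u"
  shows "(\<Sum>v\<in>A. \<Sum>u\<in>A - {v}. f v u) = 0"
  using assms
proof (induction A)
  case (insert x A)
  have "(\<Sum>v\<in>A. \<Sum>u\<in>insert x A - {v}. f v u) = (\<Sum>v\<in>A. f v x + (\<Sum>u\<in>A - {v}. f v u))"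
  proof (rule sum.cong)
    fix v assume "v \<in> A"
    then have "insert x A - {v} = insert x (A - {v})" using insert.hyps by auto
    then show "(\<Sum>u\<in>insert x A - {v}. f v u) = f v x + (\<Sum>u\<in>A - {v}. f v u)"
      using insert.hyps by simp
  qed simp
  also have "\<dots> = (\<Sum>v\<in>A. f v x) + (\<Sum>v\<in>A. \<Sum>u\<in>A - {v}. f v u)"
    by (rule sum.distrib)
  also have "(\<Sum>v\<in>A. \<Sum>u\<in>A - {v}. f v u) = 0"
    by (rule insert.IH) (rule insert.prems, auto)
  also have "(\<Sum>v\<in>A. f v x) = - (\<Sum>v\<in>A. f x v)"
    unfolding sum_negf[symmetric]
    by (intro sum.cong refl insert.prems) (use insert.hyps in auto)
  finally show ?case using insert.hyps by simp
qed simp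

lemma koszul_bd_bd: "koszul_bd (koszul_bd z) = (\<lambda>_. 0)"
proof
  fix \<sigma>
  define f where "f v u = koszul_sign v \<sigma> * koszul_sign u (insert v \<sigma>) * (Var v * Var u * z (insert u (insert v \<sigma>)))" for v u
  have "koszul_bd (koszul_bd z) \<sigma> = (\<Sum>v\<in>- \<sigma>. \<Sum>u\<in>- \<sigma> - {v}. f v u)"
    unfolding koszul_bd_def f_def
    by (intro sum.cong refl) (simp add: sum_distrib_left mult_ac Compl_insert)
  also have "\<dots> = 0"
  proof (rule sum_antisymmetric)
    fix u v assume "u \<in> - \<sigma>" "v \<in> - \<sigma>" "u \<noteq> v"
    then have "koszul_sign u \<sigma> * koszul_sign v (insert u \<sigma>)
        = - (koszul_sign v \<sigma> * koszul_sign u (insert v \<sigma>) :: ('a, 'b) mpoly)"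
      by (intro koszul_sign_swap) auto
    then show "f u v = - f v u"
      unfolding f_def insert_commute[of v u] mult.commute[of "Var u" "Var v"]
      by (simp only: mult_minus_left)
  qed simp
  finally show "koszul_bd (koszul_bd z) \<sigma> = 0" .
qed

lemma mon_degree_add: "mon_degree (a + b) = mon_degree a + mon_degree b"
  by (simp add: mon_degree_def lookup_add sum.distrib)

lemma mon_degree_single [simp]: "mon_degree (Poly_Mapping.single v n) = n"
  by (simp add: mon_degree_def lookup_single when_def)

lemma mon_degree_0_iff [simp]: "mon_degree m = 0 \<longleftrightarrow> m = 0"
  by (simp add: mon_degree_def poly_mapping_eq_iff fun_eq_iff)

lemma homogeneous_0 [simp]: "homogeneous d 0"
  by (simp add: homogeneous_def)

lemma homogeneous_add: "homogeneous d p \<Longrightarrow> homogeneous d q \<Longrightarrow> homogeneous d (p + q)"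
  using keys_add[of p q] by (auto simp: homogeneous_def)

lemma homogeneous_mult: "homogeneous d p \<Longrightarrow> homogeneous e q \<Longrightarrow> homogeneous (d + e) (p * q)"
  unfolding homogeneous_def using keys_mult[of p q] by (force simp: mon_degree_add)

lemma homogeneous_Var: "homogeneous 1 (Var v)"
  by (simp add: homogeneous_def Var_def)

lemma homogeneous_sum: "(\<And>x. x \<in> A \<Longrightarrow> homogeneous d (f x)) \<Longrightarrow> homogeneous d (sum f A)"
  by (induction A rule: infinite_finite_induct) (auto intro: homogeneous_add)

lemma homogeneous_uminus: "homogeneous d (- p) \<longleftrightarrow> homogeneous d (p :: ('v::finite, 'k::field) mpoly)"
  by (simp add: homogeneous_def in_keys_iff)

lemma homogeneous_sign_mult: "homogeneous d (koszul_sign v \<sigma> * p) \<longleftrightarrow> homogeneous d (p :: ('v::finite, 'k::field) mpoly)"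
  by (cases "even (card {u \<in> \<sigma>. to_nat u < to_nat v})") (simp_all add: koszul_sign_def homogeneous_uminus)

lemma homogeneous_koszul_bd:
  assumes "\<And>\<sigma>. homogeneous d (z \<sigma>)"
  shows "homogeneous (d + 1) (koszul_bd z \<sigma>)"
  unfolding koszul_bd_def homogeneous_sign_mult
  by (intro homogeneous_sum)
    (simp add: homogeneous_sign_mult homogeneous_mult[OF homogeneous_Var assms, simplified add.commute[of 1]])

lemma homogeneous_diff:
  "homogeneous d p \<Longrightarrow> homogeneous d q \<Longrightarrow> homogeneous d (p - q :: ('v::finite, 'k::field) mpoly)"
  using homogeneous_add[of d p "- q"] by (simp add: homogeneous_uminus)

definition hom_part :: "int \<Rightarrow> ('v::finite, 'k::zero) mpoly \<Rightarrow> ('v, 'k) mpoly"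
  where "hom_part d = restrict_keys (\<lambda>m. int (mon_degree m) = d)"

lemma lookup_hom_part:
  "Poly_Mapping.lookup (hom_part d p) m = (if int (mon_degree m) = d then Poly_Mapping.lookup p m else 0)"
  by (simp add: hom_part_def restrict_keys.rep_eq)

lemma homogeneous_hom_part [simp]: "homogeneous d (hom_part d p)"
  by (auto simp: homogeneous_def hom_part_def keys_restrict_keys)

lemma hom_part_id: "homogeneous d p \<Longrightarrow> hom_part d p = p"
  by (rule poly_mapping_eqI) (auto simp: lookup_hom_part homogeneous_def in_keys_iff)

lemma hom_part_other: "homogeneous e p \<Longrightarrow> e \<noteq> d \<Longrightarrow> hom_part d p = 0"
  by (rule poly_mapping_eqI) (auto simp: lookup_hom_part homogeneous_def in_keys_iff)

lemma hom_part_add: "hom_part d (p + q) = hom_part d p + hom_part d q"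
  by (rule poly_mapping_eqI) (simp add: lookup_hom_part lookup_add)

lemma hom_part_0 [simp]: "hom_part d 0 = 0"
  by (rule poly_mapping_eqI) (simp add: lookup_hom_part)

lemma hom_part_sum: "hom_part d (sum f A) = (\<Sum>x\<in>A. hom_part d (f x))"
  by (induction A rule: infinite_finite_induct) (simp_all add: hom_part_add)

lemma sum_hom_parts:
  fixes p :: "('v::finite, 'k::comm_monoid_add) mpoly"
  obtains D where "finite D" "p = (\<Sum>d\<in>D. hom_part d p)"
proof -
  define D where "D = (\<lambda>m. int (mon_degree m)) ` Poly_Mapping.keys p"
  have "p = (\<Sum>d\<in>D. hom_part d p)"
  proof (rule poly_mapping_eqI)
    fix m
    show "Poly_Mapping.lookup p m = Poly_Mapping.lookup (\<Sum>d\<in>D. hom_part d p) m"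
    proof (cases "m \<in> Poly_Mapping.keys p")
      case True
      then show ?thesis by (simp add: lookup_sum lookup_hom_part D_def)
    next
      case False
      then have "Poly_Mapping.lookup p m = 0" by (simp add: in_keys_iff)
      then show ?thesis by (auto simp: lookup_sum lookup_hom_part intro!: sum.neutral)
    qed
  qed
  then show thesis using that[of D] by (simp add: D_def)
qed

lemma hom_part_mult:
  fixes p q :: "('v::finite, 'k::field) mpoly"
  assumes "homogeneous e p"
  shows "hom_part d (p * q) = p * hom_part (d - e) q"
proof -
  obtain D where D: "finite D" "q = (\<Sum>f\<in>D. hom_part f q)" by (rule sum_hom_parts)
  have "hom_part d (p * hom_part f q) = (if f = d - e then p * hom_part f q else 0)" for f
    using homogeneous_mult[OF assms homogeneous_hom_part[of f q]]
    by (auto simp: hom_part_id intro: hom_part_other)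
  then have "hom_part d (p * q) = (if d - e \<in> D then p * hom_part (d - e) q else 0)"
    by (subst D(2)) (simp add: sum_distrib_left hom_part_sum D(1))
  moreover have "hom_part (d - e) q = 0" if "d - e \<notin> D"
  proof -
    have "hom_part (d - e) q = (\<Sum>f\<in>D. hom_part (d - e) (hom_part f q))"
      by (subst D(2)) (rule hom_part_sum)
    also have "\<dots> = 0"
      using that by (intro sum.neutral ballI hom_part_other[OF homogeneous_hom_part]) auto
    finally show ?thesis .
  qed
  ultimately show ?thesis by simp
qed

lemma homogeneous_koszul_sign: "homogeneous 0 (koszul_sign v \<sigma> :: ('v::finite, 'k::field) mpoly)"
  using homogeneous_sign_mult[of 0 v \<sigma> 1] by (simp add: homogeneous_def)

lemma hom_part_koszul_bd: "koszul_bd (\<lambda>\<sigma>. hom_part d (z \<sigma>)) \<sigma> = hom_part (d + 1) (koszul_bd z \<sigma>)"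
  by (simp add: koszul_bd_def hom_part_sum hom_part_mult[OF homogeneous_koszul_sign] hom_part_mult[OF homogeneous_Var])

definition squarefree_exponent :: "'v::finite set \<Rightarrow> 'v \<Rightarrow>\<^sub>0 nat"
  where "squarefree_exponent \<tau> = (\<Sum>v\<in>\<tau>. Poly_Mapping.single v 1)"

lemma squarefree_exponent_insert: "v \<notin> \<tau> \<Longrightarrow> squarefree_exponent (insert v \<tau>) = squarefree_exponent \<tau> + Poly_Mapping.single v 1"
  by (simp add: squarefree_exponent_def add.commute)

lemma lookup_squarefree_exponent: "Poly_Mapping.lookup (squarefree_exponent \<tau>) v = (if v \<in> \<tau> then 1 else 0)"
  by (simp add: squarefree_exponent_def lookup_sum lookup_single when_def)

lemma involutions_swap:
  fixes A B C D :: "'a::comm_ring_1"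
  assumes "A * B = - (C * D)" "A * A = 1" "D * D = 1"
  shows "B * D = - (A * C)"
proof -
  have "B * D = (A * A) * B * D" by (simp only: assms(2) mult_1_left)
  also have "\<dots> = (A * B) * (A * D)" by (simp only: mult_ac)
  also have "\<dots> = - (A * C * (D * D))"
    unfolding assms(1) by (simp only: mult_ac mult_minus_left mult_minus_right)
  finally show ?thesis by (simp only: assms(3) mult_1_right)
qed

text \<open>
  The Koszul complex of the polynomial ring has no homology beyond the constants. For each exponent
  \<open>b \<noteq> 0\<close> the part of multidegree \<open>b\<close> is the augmented chain complex of the full simplex on the support of
  \<open>b\<close>, which is contracted to a vertex \<open>vtx b\<close> of this support. The multidegree of \<open>x\<^sup>m e\<^sub>\<tau>\<close> is
  \<open>m + squarefree_exponent \<tau>\<close>.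
\<close>
lemma koszul_exact:
  fixes z :: "'v::finite set \<Rightarrow> ('v, 'k::field) mpoly"
  assumes cycle: "koszul_bd z = (\<lambda>_. 0)" and const: "Poly_Mapping.lookup (z {}) 0 = 0"
  obtains w where "koszul_bd w = z"
proof -
  define vtx where "vtx = (\<lambda>b :: 'v \<Rightarrow>\<^sub>0 nat. SOME v. 0 < Poly_Mapping.lookup b v)"
  have vtx: "0 < Poly_Mapping.lookup b (vtx b)" if "b \<noteq> 0" for b
  proof -
    have "\<exists>v. 0 < Poly_Mapping.lookup b v" using that by (auto simp: poly_mapping_eq_iff fun_eq_iff)
    then show ?thesis unfolding vtx_def by (rule someI_ex)
  qed
  \<comment> \<open>The value at \<open>z\<close> of the contracting homotopy, given by its coefficients.\<close>
  define c where "c \<tau> m = (let v = vtx (m + squarefree_exponent \<tau>) in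
      if v \<in> \<tau> then koszul_sign v (\<tau> - {v}) * Poly_Mapping.lookup (z (\<tau> - {v})) (m + Poly_Mapping.single v 1) else 0)" for \<tau> m
  define w where "w \<tau> = Abs_poly_mapping (c \<tau>)" for \<tau>
  have lookup_w: "Poly_Mapping.lookup (w \<tau>) = c \<tau>" for \<tau>
  proof -
    have "{m. c \<tau> m \<noteq> 0} \<subseteq> (\<Union>v\<in>\<tau>. (\<lambda>m. m + Poly_Mapping.single v 1) -` Poly_Mapping.keys (z (\<tau> - {v})))"
      by (auto simp: c_def Let_def in_keys_iff split: if_splits)
    moreover have "finite \<dots>"
      by (intro finite_UN_I finite_vimageI) (auto intro: injI)
    ultimately have "finite {m. c \<tau> m \<noteq> 0}" by (rule finite_subset)
    then show ?thesis unfolding w_def by (rule Abs_poly_mapping_inverse[OF CollectI])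
  qed
  have sgn: "Poly_Mapping.lookup (koszul_sign v \<sigma> * p) m = koszul_sign v \<sigma> * Poly_Mapping.lookup p m"
    for v \<sigma> m and p :: "('v, 'k) mpoly"
    by (cases "even (card {u \<in> \<sigma>. to_nat u < to_nat v})") (simp_all add: koszul_sign_def)
  have bd: "Poly_Mapping.lookup (koszul_bd y \<sigma>) m =
      (\<Sum>v\<in>{v. v \<notin> \<sigma> \<and> 0 < Poly_Mapping.lookup m v}.
         koszul_sign v \<sigma> * Poly_Mapping.lookup (y (insert v \<sigma>)) (m - Poly_Mapping.single v 1))"
    for y :: "'v set \<Rightarrow> ('v, 'k) mpoly" and \<sigma> m
    unfolding koszul_bd_def lookup_sum sgn lookup_Var_mult
    by (intro sum.mono_neutral_cong_right) auto
  have "Poly_Mapping.lookup (koszul_bd w \<sigma>) m = Poly_Mapping.lookup (z \<sigma>) m" for \<sigma> m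
  proof (cases "m + squarefree_exponent \<sigma> = 0")
    case True
    then have "m = 0" "squarefree_exponent \<sigma> = 0"
      by (metis add_is_0 mon_degree_0_iff mon_degree_add)+
    moreover have "\<sigma> = {}"
    proof (rule ccontr)
      assume "\<sigma> \<noteq> {}"
      then obtain v where "v \<in> \<sigma>" by blast
      then show False using lookup_squarefree_exponent[of \<sigma> v] \<open>squarefree_exponent \<sigma> = 0\<close> by simp
    qed
    ultimately show ?thesis using const by (simp add: bd)
  next
    case False
    define v0 where "v0 = vtx (m + squarefree_exponent \<sigma>)"
    let ?A = "{v. v \<notin> \<sigma> \<and> 0 < Poly_Mapping.lookup m v}"
    have same: "m - Poly_Mapping.single v 1 + squarefree_exponent (insert v \<sigma>) = m + squarefree_exponent \<sigma>" if "v \<in> ?A" for v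
      using that by (intro poly_mapping_eqI)
        (auto simp: squarefree_exponent_insert lookup_add lookup_minus lookup_single when_def)
    have shift: "m - Poly_Mapping.single v 1 + Poly_Mapping.single v 1 = m" if "v \<in> ?A" for v
      using that by (intro poly_mapping_eqI) (auto simp: lookup_add lookup_minus lookup_single when_def)
    have supp: "v0 \<in> \<sigma> \<or> 0 < Poly_Mapping.lookup m v0"
      using vtx[OF False] by (auto simp: v0_def lookup_add lookup_squarefree_exponent split: if_splits)
    show ?thesis
    proof (cases "v0 \<in> \<sigma>")
      case False
      have "Poly_Mapping.lookup (koszul_bd w \<sigma>) m = (\<Sum>v\<in>?A. if v = v0 then Poly_Mapping.lookup (z \<sigma>) m else 0)"
        unfolding bd lookup_w
      proof (rule sum.cong)
        fix v assume v: "v \<in> ?A"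
        show "koszul_sign v \<sigma> * c (insert v \<sigma>) (m - Poly_Mapping.single v 1) = (if v = v0 then Poly_Mapping.lookup (z \<sigma>) m else 0)"
          using v False shift[OF v] unfolding c_def same[OF v] v0_def[symmetric] Let_def
          by (auto simp: mult.assoc[symmetric] simp del: One_nat_def)
      qed simp
      also have "\<dots> = Poly_Mapping.lookup (z \<sigma>) m" using supp False by simp
      finally show ?thesis .
    next
      case True
      define \<rho> where "\<rho> = \<sigma> - {v0}"
      have \<sigma>: "\<sigma> = insert v0 \<rho>" "v0 \<notin> \<rho>" using True by (auto simp: \<rho>_def)
      let ?m = "m + Poly_Mapping.single v0 1"
      have A: "{v. v \<notin> \<rho> \<and> 0 < Poly_Mapping.lookup ?m v} = insert v0 ?A" "v0 \<notin> ?A"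
        using \<sigma> by (auto simp: lookup_add lookup_single when_def)
      have mm: "?m - Poly_Mapping.single v 1 = m - Poly_Mapping.single v 1 + Poly_Mapping.single v0 1" if "v \<in> ?A" for v
        using that by (intro poly_mapping_eqI) (auto simp: lookup_add lookup_minus lookup_single when_def)
      have "0 = Poly_Mapping.lookup (koszul_bd z \<rho>) ?m" using cycle by simp
      also have "\<dots> = koszul_sign v0 \<rho> * Poly_Mapping.lookup (z \<sigma>) m +
          (\<Sum>v\<in>?A. koszul_sign v \<rho> * Poly_Mapping.lookup (z (insert v \<rho>)) (m - Poly_Mapping.single v 1 + Poly_Mapping.single v0 1))"
        unfolding bd A using A(2) \<sigma> mm by (simp add: sum.insert del: One_nat_def)
      finally have zero: "koszul_sign v0 \<rho> * Poly_Mapping.lookup (z \<sigma>) m = 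
          - (\<Sum>v\<in>?A. koszul_sign v \<rho> * Poly_Mapping.lookup (z (insert v \<rho>)) (m - Poly_Mapping.single v 1 + Poly_Mapping.single v0 1))"
        by (simp add: eq_neg_iff_add_eq_0)
      have "Poly_Mapping.lookup (koszul_bd w \<sigma>) m = (\<Sum>v\<in>?A. - koszul_sign v0 \<rho> *
         (koszul_sign v \<rho> * Poly_Mapping.lookup (z (insert v \<rho>)) (m - Poly_Mapping.single v 1 + Poly_Mapping.single v0 1)))"
        unfolding bd lookup_w
      proof (rule sum.cong)
        fix v assume v: "v \<in> ?A"
        have vv: "v \<noteq> v0" "v \<notin> \<rho>" using v \<sigma> by auto
        have ins: "insert v \<sigma> - {v0} = insert v \<rho>" using vv \<sigma> by auto
        have "koszul_sign v \<sigma> * koszul_sign v0 (insert v \<rho>) = - (koszul_sign v0 \<rho> * koszul_sign v \<rho> :: 'k)"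
        proof -
          have "koszul_sign v0 \<rho> * koszul_sign v \<sigma> = - (koszul_sign v \<rho> * koszul_sign v0 (insert v \<rho>) :: 'k)"
            using koszul_sign_swap[of v v0 \<rho>] vv \<sigma> by simp
          then show ?thesis
            by (rule involutions_swap) simp_all
        qed
        then show "koszul_sign v \<sigma> * c (insert v \<sigma>) (m - Poly_Mapping.single v 1) = - koszul_sign v0 \<rho> *
         (koszul_sign v \<rho> * Poly_Mapping.lookup (z (insert v \<rho>)) (m - Poly_Mapping.single v 1 + Poly_Mapping.single v0 1))"
          using True unfolding c_def same[OF v] v0_def[symmetric] Let_def
          by (simp add: ins mult.assoc[symmetric] del: One_nat_def)
      qed simp
      also have "\<dots> = koszul_sign v0 \<rho> * (koszul_sign v0 \<rho> * Poly_Mapping.lookup (z \<sigma>) m)"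
        unfolding zero by (simp add: sum_distrib_left sum_negf)
      also have "\<dots> = Poly_Mapping.lookup (z \<sigma>) m" by (simp add: mult.assoc[symmetric])
      finally show ?thesis .
    qed
  qed
  then have "koszul_bd w = z" by (intro ext poly_mapping_eqI)
  then show thesis by (rule that)
qed

text \<open>
  The Koszul homology of \<open>J\<close> in homological degree \<open>i\<close> and internal degree \<open>j\<close> is \<open>Tor\<^sub>i(J, K)\<^sub>j\<close>, and its
  classes have cycles with coefficients of degree \<open>d = j - i\<close>. Hence \<open>reg J \<le> r\<close> means that every cycle with
  coefficients of degree \<open>d > r\<close> is a boundary. Since \<open>i\<close> does not occur in this condition, all exterior
  degrees are treated at once.
\<close>
definition koszul_reg_le :: "('v::finite, 'k::field) mpoly set \<Rightarrow> int \<Rightarrow> bool"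
  where "koszul_reg_le J r \<longleftrightarrow> (\<forall>d>r. \<forall>z. (\<forall>\<sigma>. z \<sigma> \<in> J \<and> homogeneous d (z \<sigma>)) \<longrightarrow> koszul_bd z = (\<lambda>_. 0) \<longrightarrow>
    (\<exists>w. (\<forall>\<sigma>. w \<sigma> \<in> J) \<and> koszul_bd w = z))"

lemma koszul_reg_leD:
  assumes "koszul_reg_le J r" "r < d" "\<And>\<sigma>. z \<sigma> \<in> J" "\<And>\<sigma>. homogeneous d (z \<sigma>)" "koszul_bd z = (\<lambda>_. 0)"
  shows "\<exists>w. (\<forall>\<sigma>. w \<sigma> \<in> J) \<and> koszul_bd w = z"
  using assms unfolding koszul_reg_le_def by blast

definition mon_mset :: "('v::finite \<Rightarrow>\<^sub>0 nat) \<Rightarrow> 'v multiset"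
  where "mon_mset m = (\<Sum>v\<in>UNIV. replicate_mset (Poly_Mapping.lookup m v) v)"

lemma count_mon_mset [simp]: "count (mon_mset m) v = Poly_Mapping.lookup m v"
  by (simp add: mon_mset_def count_sum)

lemma mon_mset_add: "mon_mset (a + b) = mon_mset a + mon_mset b"
  by (rule multiset_eqI) (simp add: lookup_add)

lemma mon_mset_single [simp]: "mon_mset (Poly_Mapping.single v n) = replicate_mset n v"
  by (rule multiset_eqI) (simp add: lookup_single when_def)

definition monomial_ideal :: "'v::finite multiset set \<Rightarrow> ('v, 'k::field) mpoly set"
  where "monomial_ideal U = {p. \<forall>m\<in>Poly_Mapping.keys p. mon_mset m \<in> U}"

lemma monomial_ideal_add: "p \<in> monomial_ideal U \<Longrightarrow> q \<in> monomial_ideal U \<Longrightarrow> p + q \<in> monomial_ideal U"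
  using keys_add[of p q] by (auto simp: monomial_ideal_def)

lemma monomial_ideal_0 [simp]: "0 \<in> monomial_ideal U"
  by (simp add: monomial_ideal_def)

lemma monomial_ideal_uminus: "p \<in> monomial_ideal U \<Longrightarrow> - p \<in> monomial_ideal U"
  by (simp add: monomial_ideal_def in_keys_iff)

lemma monomial_ideal_diff: "p \<in> monomial_ideal U \<Longrightarrow> q \<in> monomial_ideal U \<Longrightarrow> p - q \<in> monomial_ideal U"
  using monomial_ideal_add[OF _ monomial_ideal_uminus, of p U q] by simp

lemma monomial_ideal_sum: "(\<And>x. x \<in> A \<Longrightarrow> f x \<in> monomial_ideal U) \<Longrightarrow> sum f A \<in> monomial_ideal U"
  by (induction A rule: infinite_finite_induct) (auto intro: monomial_ideal_add)

lemma monomial_ideal_mult: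
  assumes U: "\<And>m m'. m \<in> U \<Longrightarrow> m \<subseteq># m' \<Longrightarrow> m' \<in> U" and p: "p \<in> monomial_ideal U"
  shows "q * p \<in> monomial_ideal U"
  unfolding monomial_ideal_def
proof safe
  fix m assume "m \<in> Poly_Mapping.keys (q * p)"
  then obtain a b where "m = a + b" "b \<in> Poly_Mapping.keys p" using keys_mult[of q p] by blast
  then show "mon_mset m \<in> U"
    using p U[of "mon_mset b" "mon_mset m"] by (simp add: monomial_ideal_def mon_mset_add)
qed

lemma koszul_bd_monomial_ideal:
  assumes "\<And>m m'. m \<in> U \<Longrightarrow> m \<subseteq># m' \<Longrightarrow> m' \<in> U" "\<And>\<sigma>. z \<sigma> \<in> monomial_ideal U"
  shows "koszul_bd z \<sigma> \<in> monomial_ideal U"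
  unfolding koszul_bd_def by (intro monomial_ideal_sum monomial_ideal_mult[OF assms(1)] assms(2))

lemma koszul_reg_le_empty: "koszul_reg_le (monomial_ideal {} :: ('v::finite, 'k::field) mpoly set) r"
proof -
  have "(monomial_ideal {} :: ('v, 'k) mpoly set) = {0}"
    by (auto simp: monomial_ideal_def)
  then show ?thesis
    unfolding koszul_reg_le_def by (metis ext koszul_bd_zero singletonD singletonI)
qed

lemma koszul_reg_le_UNIV: "0 \<le> r \<Longrightarrow> koszul_reg_le (monomial_ideal UNIV :: ('v::finite, 'k::field) mpoly set) r"
  unfolding koszul_reg_le_def
proof (intro allI impI)
  fix d and z :: "'v set \<Rightarrow> ('v, 'k) mpoly"
  assume "0 \<le> r" "r < d" and z: "\<forall>\<sigma>. z \<sigma> \<in> monomial_ideal UNIV \<and> homogeneous d (z \<sigma>)"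
    and cycle: "koszul_bd z = (\<lambda>_. 0)"
  then have "Poly_Mapping.lookup (z {}) 0 = 0"
    by (metis homogeneous_def in_keys_iff mon_degree_0_iff of_nat_0 order_le_less_trans order_less_irrefl)
  then obtain w where "koszul_bd w = z" using koszul_exact[OF cycle] by blast
  then show "\<exists>w. (\<forall>\<sigma>. w \<sigma> \<in> monomial_ideal UNIV) \<and> koszul_bd w = z"
    by (auto simp: monomial_ideal_def)
qed

lemma inj_add_monomial: "inj (\<lambda>m. m + k :: 'v \<Rightarrow>\<^sub>0 nat)"
  by (rule injI) simp

definition div_Var :: "'v \<Rightarrow> ('v, 'k::field) mpoly \<Rightarrow> ('v, 'k) mpoly"
  where "div_Var v = Poly_Mapping.map_key (\<lambda>m. m + Poly_Mapping.single v 1)"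

lemma lookup_div_Var: "Poly_Mapping.lookup (div_Var v p) m = Poly_Mapping.lookup p (m + Poly_Mapping.single v 1)"
  by (simp add: div_Var_def map_key.rep_eq[OF inj_add_monomial])

lemma keys_div_Var: "m \<in> Poly_Mapping.keys (div_Var v p) \<longleftrightarrow> m + Poly_Mapping.single v 1 \<in> Poly_Mapping.keys p"
  by (simp add: in_keys_iff lookup_div_Var)

lemma div_Var_mult: "div_Var v (Var v * p) = p"
  by (rule poly_mapping_eqI) (simp add: lookup_div_Var lookup_Var_mult lookup_add)

lemma Var_mult_div_Var:
  assumes "\<And>m. m \<in> Poly_Mapping.keys p \<Longrightarrow> 0 < Poly_Mapping.lookup m v"
  shows "Var v * div_Var v p = p"
proof (rule poly_mapping_eqI)
  fix m
  show "Poly_Mapping.lookup (Var v * div_Var v p) m = Poly_Mapping.lookup p m"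
  proof (cases "0 < Poly_Mapping.lookup m v")
    case True
    then have "m - Poly_Mapping.single v 1 + Poly_Mapping.single v 1 = m"
      by (intro poly_mapping_eqI) (auto simp: lookup_add lookup_minus lookup_single when_def)
    then show ?thesis using True by (simp add: lookup_Var_mult lookup_div_Var)
  next
    case False
    then show ?thesis using assms[of m] by (auto simp: lookup_Var_mult in_keys_iff)
  qed
qed

lemma homogeneous_div_Var: "homogeneous d p \<Longrightarrow> homogeneous (d - 1) (div_Var v p)"
  unfolding homogeneous_def
proof
  fix m assume "\<forall>m\<in>Poly_Mapping.keys p. int (mon_degree m) = d" "m \<in> Poly_Mapping.keys (div_Var v p)"
  then have "int (mon_degree (m + Poly_Mapping.single v 1)) = d"
    unfolding keys_div_Var by blast
  then show "int (mon_degree m) = d - 1" by (simp add: mon_degree_add)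
qed

text \<open>Multiplication by the variable \<open>v\<close> is an isomorphism of degree one from \<open>J : v\<close> onto this ideal.\<close>
lemma koszul_reg_le_Var_mult:
  assumes "koszul_reg_le (monomial_ideal {m. add_mset v m \<in> U} :: ('v::finite, 'k::field) mpoly set) (r - 1)"
  shows "koszul_reg_le (monomial_ideal {m \<in> U. v \<in># m} :: ('v, 'k) mpoly set) r"
  unfolding koszul_reg_le_def
proof (intro allI impI)
  fix d and z :: "'v set \<Rightarrow> ('v, 'k) mpoly"
  assume "r < d" and z: "\<forall>\<sigma>. z \<sigma> \<in> monomial_ideal {m \<in> U. v \<in># m} \<and> homogeneous d (z \<sigma>)"
    and cycle: "koszul_bd z = (\<lambda>_. 0)"
  define y where "y \<sigma> = div_Var v (z \<sigma>)" for \<sigma>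
  have zy: "z \<sigma> = Var v * y \<sigma>" for \<sigma>
  proof -
    have "0 < Poly_Mapping.lookup m v" if m: "m \<in> Poly_Mapping.keys (z \<sigma>)" for m
    proof -
      have "v \<in># mon_mset m" using z m by (auto simp: monomial_ideal_def)
      then show ?thesis by (metis count_greater_zero_iff count_mon_mset)
    qed
    then show ?thesis unfolding y_def by (rule Var_mult_div_Var[symmetric])
  qed
  have "koszul_bd y \<sigma> = 0" for \<sigma>
  proof -
    have "Var v * koszul_bd y \<sigma> = 0"
    proof -
      have "z = (\<lambda>\<sigma>. Var v * y \<sigma>)" by (rule ext) (rule zy)
      then show ?thesis using cycle koszul_bd_mult[of "Var v" y \<sigma>] by simp
    qed
    then show ?thesis by (metis div_Var_mult mult_zero_right)
  qed
  then have "koszul_bd y = (\<lambda>_. 0)" by blast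
  moreover have "y \<sigma> \<in> monomial_ideal {m. add_mset v m \<in> U}" for \<sigma>
    unfolding monomial_ideal_def mem_Collect_eq
  proof
    fix m assume "m \<in> Poly_Mapping.keys (y \<sigma>)"
    then have "mon_mset (m + Poly_Mapping.single v 1) \<in> U"
      using z unfolding y_def keys_div_Var monomial_ideal_def by blast
    then show "add_mset v (mon_mset m) \<in> U" by (simp add: mon_mset_add)
  qed
  moreover have "homogeneous (d - 1) (y \<sigma>)" for \<sigma>
    using z homogeneous_div_Var by (auto simp: y_def)
  ultimately obtain x where x: "\<And>\<sigma>. x \<sigma> \<in> monomial_ideal {m. add_mset v m \<in> U}" "koszul_bd x = y"
    using koszul_reg_leD[OF assms, of "d - 1" y] \<open>r < d\<close> by auto
  have "koszul_bd (\<lambda>\<sigma>. Var v * x \<sigma>) = z"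
    by (rule ext) (simp add: koszul_bd_mult x(2) zy)
  moreover have "Var v * x \<sigma> \<in> monomial_ideal {m \<in> U. v \<in># m}" for \<sigma>
    unfolding monomial_ideal_def
  proof safe
    fix m assume "m \<in> Poly_Mapping.keys (Var v * x \<sigma>)"
    then obtain b where "m = Poly_Mapping.single v 1 + b" "b \<in> Poly_Mapping.keys (x \<sigma>)"
      using keys_mult[of "Var v" "x \<sigma>"] by (auto simp: Var_def)
    then show "mon_mset m \<in> U" "v \<in># mon_mset m"
      using x(1)[of \<sigma>] by (auto simp: monomial_ideal_def mon_mset_add)
  qed
  ultimately show "\<exists>w. (\<forall>\<sigma>. w \<sigma> \<in> monomial_ideal {m \<in> U. v \<in># m}) \<and> koszul_bd w = z"
    by (intro exI[of _ "\<lambda>\<sigma>. Var v * x \<sigma>"]) blast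
qed

text \<open>
  Mayer--Vietoris for \<open>J = A + B\<close>, where \<open>A\<close> has the monomials of \<open>J\<close> divisible by \<open>v\<close> and \<open>B\<close> is generated by
  the others. A cycle \<open>z\<close> of degree \<open>d\<close> is a sum of chains \<open>a\<close> in \<open>A\<close> and \<open>b\<close> in \<open>B\<close>; the boundary of \<open>a\<close> is a
  cycle in \<open>C = A \<inter> B\<close> with coefficients of degree \<open>d + 1\<close>, hence the boundary of a chain \<open>c\<close> in \<open>C\<close>, and the
  cycles \<open>a - c\<close> and \<open>b + c\<close> are boundaries in \<open>A\<close> and in \<open>B\<close>.
\<close>
lemma koszul_reg_le_step:
  fixes U :: "'v::finite multiset set"
  assumes U: "\<And>m m'. m \<in> U \<Longrightarrow> m \<subseteq># m' \<Longrightarrow> m' \<in> U"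
    and colon: "koszul_reg_le (monomial_ideal {m. add_mset v m \<in> U} :: ('v, 'k::field) mpoly set) (r - 1)"
    and del: "koszul_reg_le (monomial_ideal {m. filter_mset (\<lambda>x. x \<noteq> v) m \<in> U} :: ('v, 'k) mpoly set) r"
  shows "koszul_reg_le (monomial_ideal U :: ('v, 'k) mpoly set) r"
proof -
  define B where "B = {m. filter_mset (\<lambda>x. x \<noteq> v) m \<in> U}"
  define A where "A = {m \<in> U. v \<in># m}"
  define C where "C = {m \<in> B. v \<in># m}"
  have BU: "B \<subseteq> U" using U by (auto simp: B_def)
  have AU: "A \<subseteq> U" by (auto simp: A_def)
  have upA: "m' \<in> A" if "m \<in> A" "m \<subseteq># m'" for m m'
    using that U by (auto simp: A_def dest: mset_subset_eqD)
  have upB: "m' \<in> B" if "m \<in> B" "m \<subseteq># m'" for m m'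
    using that(1) U multiset_filter_mono[OF that(2)] unfolding B_def mem_Collect_eq by blast
  have upC: "m' \<in> C" if "m \<in> C" "m \<subseteq># m'" for m m'
    using that upB by (auto simp: C_def dest: mset_subset_eqD)
  have CA: "C \<subseteq> A" and CB: "C \<subseteq> B" and AB: "A \<inter> B = C" using BU by (auto simp: A_def C_def)
  have mono: "p \<in> monomial_ideal Y" if "p \<in> monomial_ideal X" "X \<subseteq> Y" for p :: "('v, 'k) mpoly" and X Y
    using that by (auto simp: monomial_ideal_def)
  have regA: "koszul_reg_le (monomial_ideal A :: ('v, 'k) mpoly set) r"
    unfolding A_def by (rule koszul_reg_le_Var_mult[OF colon])
  have "{m. add_mset v m \<in> B} = B" by (auto simp: B_def)
  then have regC: "koszul_reg_le (monomial_ideal C :: ('v, 'k) mpoly set) (r + 1)"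
    unfolding C_def using del by (intro koszul_reg_le_Var_mult) (simp flip: B_def)
  show ?thesis
    unfolding koszul_reg_le_def
  proof (intro allI impI)
    fix d and z :: "'v set \<Rightarrow> ('v, 'k) mpoly"
    assume d: "r < d" and z: "\<forall>\<sigma>. z \<sigma> \<in> monomial_ideal U \<and> homogeneous d (z \<sigma>)"
      and cycle: "koszul_bd z = (\<lambda>_. 0)"
    define a where "a \<sigma> = restrict_keys (\<lambda>m. v \<in># mon_mset m) (z \<sigma>)" for \<sigma>
    define b where "b \<sigma> = restrict_keys (\<lambda>m. \<not> v \<in># mon_mset m) (z \<sigma>)" for \<sigma>
    have zab: "z \<sigma> = a \<sigma> + b \<sigma>" for \<sigma> by (simp only: a_def b_def restrict_keys_split)
    have aA: "a \<sigma> \<in> monomial_ideal A" and ah: "homogeneous d (a \<sigma>)" and bh: "homogeneous d (b \<sigma>)" for \<sigma>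
      using z by (auto simp: a_def b_def A_def monomial_ideal_def homogeneous_def keys_restrict_keys)
    have bB: "b \<sigma> \<in> monomial_ideal B" for \<sigma>
      unfolding monomial_ideal_def
    proof safe
      fix m assume "m \<in> Poly_Mapping.keys (b \<sigma>)"
      then have "mon_mset m \<in> U" "v \<notin># mon_mset m"
        using z by (auto simp: b_def keys_restrict_keys monomial_ideal_def)
      moreover from this(2) have "filter_mset (\<lambda>x. x \<noteq> v) (mon_mset m) = mon_mset m"
        by (auto simp: filter_mset_eq_conv)
      ultimately show "mon_mset m \<in> B" by (simp add: B_def)
    qed
    have sum0: "koszul_bd a \<sigma> + koszul_bd b \<sigma> = 0" for \<sigma>
      using cycle koszul_bd_add[of a b \<sigma>] by (simp flip: zab)
    then have eq: "koszul_bd a \<sigma> = - koszul_bd b \<sigma>" for \<sigma>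
      by (simp add: eq_neg_iff_add_eq_0)
    have "koszul_bd a \<sigma> \<in> monomial_ideal C" for \<sigma>
    proof -
      have "koszul_bd a \<sigma> \<in> monomial_ideal A"
        by (rule koszul_bd_monomial_ideal[OF upA aA])
      moreover have "koszul_bd a \<sigma> \<in> monomial_ideal B"
        unfolding eq by (intro monomial_ideal_uminus koszul_bd_monomial_ideal[OF upB bB])
      ultimately show ?thesis unfolding AB[symmetric] by (simp add: monomial_ideal_def)
    qed
    moreover have "homogeneous (d + 1) (koszul_bd a \<sigma>)" for \<sigma>
      by (rule homogeneous_koszul_bd[OF ah])
    ultimately obtain c0 where c0: "\<And>\<sigma>. c0 \<sigma> \<in> monomial_ideal C" "koszul_bd c0 = koszul_bd a"
      using koszul_reg_leD[OF regC, of "d + 1" "koszul_bd a"] d koszul_bd_bd[of a] by auto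
    define c where "c \<sigma> = hom_part d (c0 \<sigma>)" for \<sigma>
    have c: "c \<sigma> \<in> monomial_ideal C" "koszul_bd c = koszul_bd a" "homogeneous d (c \<sigma>)" for \<sigma>
    proof -
      show "c \<sigma> \<in> monomial_ideal C"
        using c0(1)[of \<sigma>] by (auto simp: c_def monomial_ideal_def hom_part_def keys_restrict_keys)
      show "koszul_bd c = koszul_bd a"
      proof
        fix \<tau>
        have "c = (\<lambda>\<sigma>. hom_part d (c0 \<sigma>))" by (simp add: c_def fun_eq_iff)
        then show "koszul_bd c \<tau> = koszul_bd a \<tau>"
          by (simp add: hom_part_koszul_bd c0(2) hom_part_id[OF homogeneous_koszul_bd[OF ah]])
      qed
    qed (simp add: c_def)
    define w1 where "w1 \<sigma> = a \<sigma> - c \<sigma>" for \<sigma>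
    define w2 where "w2 \<sigma> = b \<sigma> + c \<sigma>" for \<sigma>
    obtain x where x: "\<And>\<sigma>. x \<sigma> \<in> monomial_ideal A" "koszul_bd x = w1"
    proof -
      have "koszul_bd w1 = (\<lambda>_. 0)"
        unfolding w1_def by (rule ext) (simp add: c(2) koszul_bd_diff)
      moreover have "w1 \<sigma> \<in> monomial_ideal A" for \<sigma>
        unfolding w1_def by (intro monomial_ideal_diff aA mono[OF c(1) CA])
      moreover have "homogeneous d (w1 \<sigma>)" for \<sigma>
        unfolding w1_def by (rule homogeneous_diff[OF ah c(3)])
      ultimately show thesis
        using koszul_reg_leD[OF regA d, of w1] that by blast
    qed
    obtain y where y: "\<And>\<sigma>. y \<sigma> \<in> monomial_ideal B" "koszul_bd y = w2"
    proof -
      have "koszul_bd w2 = (\<lambda>_. 0)"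
        unfolding w2_def by (rule ext) (simp add: koszul_bd_add c(2) sum0 add.commute)
      moreover have "w2 \<sigma> \<in> monomial_ideal B" for \<sigma>
        unfolding w2_def by (intro monomial_ideal_add bB mono[OF c(1) CB])
      moreover have "homogeneous d (w2 \<sigma>)" for \<sigma>
        unfolding w2_def by (rule homogeneous_add[OF bh c(3)])
      ultimately show thesis
        using koszul_reg_leD[OF del[folded B_def] d, of w2] that by blast
    qed
    have "koszul_bd (\<lambda>\<sigma>. x \<sigma> + y \<sigma>) = z"
      by (rule ext) (simp add: koszul_bd_add x(2) y(2) w1_def w2_def zab)
    moreover have "x \<sigma> + y \<sigma> \<in> monomial_ideal U" for \<sigma>
      by (intro monomial_ideal_add mono[OF x(1) AU] mono[OF y(1) BU])
    ultimately show "\<exists>w. (\<forall>\<sigma>. w \<sigma> \<in> monomial_ideal U) \<and> koszul_bd w = z"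
      by (intro exI[of _ "\<lambda>\<sigma>. x \<sigma> + y \<sigma>"]) blast
  qed
qed

section \<open>Graded submodules of free modules and their syzygies\<close>

text \<open>
  Elements of \<open>S\<^sup>n\<close> are functions on the natural numbers that vanish from \<open>n\<close> on, and matrices are functions of
  row and column, so that free modules of all ranks live in one type.
\<close>
definition free_mod :: "nat \<Rightarrow> (nat \<Rightarrow> 'a::zero) set"
  where "free_mod n = {f. \<forall>c\<ge>n. f c = 0}"

definition mat_apply :: "nat \<Rightarrow> (nat \<Rightarrow> nat \<Rightarrow> 'a::comm_ring_1) \<Rightarrow> (nat \<Rightarrow> 'a) \<Rightarrow> nat \<Rightarrow> 'a"
  where "mat_apply k A w r = (\<Sum>c<k. A r c * w c)"

text \<open>
  The condition \<open>koszul_reg_le\<close> for a submodule \<open>N\<close> of a free module whose \<open>r\<close>-th basis element has degree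
  \<open>a r\<close>: an element of degree \<open>d\<close> has \<open>r\<close>-th coordinate of degree \<open>d - a r\<close>.
\<close>
definition module_reg_le :: "(nat \<Rightarrow> int) \<Rightarrow> (nat \<Rightarrow> ('v::finite, 'k::field) mpoly) set \<Rightarrow> int \<Rightarrow> bool"
  where "module_reg_le a N \<rho> \<longleftrightarrow> (\<forall>d>\<rho>. \<forall>z. (\<forall>\<sigma>. (\<lambda>r. z r \<sigma>) \<in> N) \<longrightarrow>
    (\<forall>r \<sigma>. homogeneous (d - a r) (z r \<sigma>)) \<longrightarrow> (\<forall>r. koszul_bd (z r) = (\<lambda>_. 0)) \<longrightarrow>
    (\<exists>w. (\<forall>\<sigma>. (\<lambda>r. w r \<sigma>) \<in> N) \<and> (\<forall>r. koszul_bd (w r) = z r)))"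

lemma module_reg_leD:
  assumes "module_reg_le a N \<rho>" "\<rho> < d" "\<And>\<sigma>. (\<lambda>r. z r \<sigma>) \<in> N"
    "\<And>r \<sigma>. homogeneous (d - a r) (z r \<sigma>)" "\<And>r \<sigma>. koszul_bd (z r) \<sigma> = 0"
  obtains w where "\<And>\<sigma>. (\<lambda>r. w r \<sigma>) \<in> N" "\<And>r. koszul_bd (w r) = z r"
proof -
  have "\<exists>w. (\<forall>\<sigma>. (\<lambda>r. w r \<sigma>) \<in> N) \<and> (\<forall>r. koszul_bd (w r) = z r)"
    using assms unfolding module_reg_le_def by (auto simp: fun_eq_iff)
  then show thesis using that by blast
qed

text \<open>An ideal as a submodule of the free module of rank one.\<close>
definition in_first :: "'a::zero \<Rightarrow> nat \<Rightarrow> 'a"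
  where "in_first p = (\<lambda>r. if r = 0 then p else 0)"

lemma module_reg_le_ideal:
  assumes "koszul_reg_le J \<rho>"
  shows "module_reg_le (\<lambda>_. 0) (in_first ` J) \<rho>"
  unfolding module_reg_le_def
proof (intro allI impI)
  fix d and z :: "nat \<Rightarrow> 'a set \<Rightarrow> ('a, 'b) mpoly"
  assume d: "\<rho> < d" and z: "\<forall>\<sigma>. (\<lambda>r. z r \<sigma>) \<in> in_first ` J" "\<forall>r \<sigma>. homogeneous (d - 0) (z r \<sigma>)"
    "\<forall>r. koszul_bd (z r) = (\<lambda>_. 0)"
  have z0: "z 0 \<sigma> \<in> J" and zr: "r \<noteq> 0 \<Longrightarrow> z r \<sigma> = 0" for r \<sigma>
  proof -
    obtain p where p: "p \<in> J" "(\<lambda>r. z r \<sigma>) = in_first p" using z(1) by blast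
    from fun_cong[OF p(2), of 0] p(1) show "z 0 \<sigma> \<in> J" by (simp add: in_first_def)
    from fun_cong[OF p(2), of r] show "r \<noteq> 0 \<Longrightarrow> z r \<sigma> = 0" by (simp add: in_first_def)
  qed
  obtain w where w: "\<And>\<sigma>. w \<sigma> \<in> J" "koszul_bd w = z 0"
    using koszul_reg_leD[OF assms d, of "z 0"] z0 z by auto
  have "z r = (\<lambda>_. 0)" if "r \<noteq> 0" for r using zr that by blast
  then show "\<exists>w. (\<forall>\<sigma>. (\<lambda>r. w r \<sigma>) \<in> in_first ` J) \<and> (\<forall>r. koszul_bd (w r) = z r)"
    using w by (intro exI[of _ "\<lambda>r. if r = 0 then w else (\<lambda>_. 0)"])
      (auto simp: in_first_def koszul_bd_zero if_distribR)
qed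

lemma koszul_bd_mat_apply:
  "koszul_bd (\<lambda>\<sigma>. mat_apply k A (\<lambda>c. z c \<sigma>) r) \<sigma> = mat_apply k A (\<lambda>c. koszul_bd (z c) \<sigma>) r"
  unfolding mat_apply_def by (simp add: koszul_bd_sum koszul_bd_mult)

lemma mat_apply_add: "mat_apply k A (\<lambda>c. v c + w c) r = mat_apply k A v r + mat_apply k A w r"
  by (simp add: mat_apply_def algebra_simps sum.distrib)

lemma mat_apply_diff: "mat_apply k A (\<lambda>c. v c - w c) r = mat_apply k A v r - mat_apply k A w r"
  by (simp add: mat_apply_def algebra_simps sum_subtractf)

lemma mat_apply_scale: "mat_apply k A (\<lambda>c. p * w c) r = p * mat_apply k A w r"
  by (simp add: mat_apply_def sum_distrib_left mult_ac)

lemma mat_apply_sum: "mat_apply k A (\<lambda>c. \<Sum>x\<in>X. w x c) r = (\<Sum>x\<in>X. mat_apply k A (w x) r)"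
  unfolding mat_apply_def by (simp add: sum_distrib_left sum.swap[of _ X])

lemma mat_apply_unit: "c < k \<Longrightarrow> mat_apply k A (\<lambda>i. if i = c then 1 else 0) r = A r c"
  by (simp add: mat_apply_def if_distrib[of "(*) _"] cong: if_cong)

lemma mat_apply_truncate: "mat_apply k A (\<lambda>c. if c < k then w c else 0) = mat_apply k A w"
  by (simp add: mat_apply_def fun_eq_iff)

lemma range_mat_apply: "range (mat_apply k A) = mat_apply k A ` free_mod k"
proof -
  have "mat_apply k A w \<in> mat_apply k A ` free_mod k" for w
    by (rule image_eqI[of _ _ "\<lambda>c. if c < k then w c else 0"]) (simp_all add: mat_apply_truncate free_mod_def)
  then show ?thesis by blast
qed

definition kernel :: "nat \<Rightarrow> (nat \<Rightarrow> nat \<Rightarrow> 'a::comm_ring_1) \<Rightarrow> (nat \<Rightarrow> 'a) set"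
  where "kernel k A = {w \<in> free_mod k. mat_apply k A w = (\<lambda>_. 0)}"

text \<open>
  Containment in the multiple of the free module by the irrelevant ideal; for the kernel of a presentation
  this says that the generators are minimal.
\<close>
definition no_constants :: "(nat \<Rightarrow> ('v, 'k::zero) mpoly) set \<Rightarrow> bool"
  where "no_constants Z \<longleftrightarrow> (\<forall>w\<in>Z. \<forall>c. Poly_Mapping.lookup (w c) 0 = 0)"

lemma hom_part_mat_apply:
  fixes A :: "nat \<Rightarrow> nat \<Rightarrow> ('v::finite, 'k::field) mpoly"
  assumes "\<And>r c. c < k \<Longrightarrow> homogeneous (b c - a r) (A r c)"
  shows "mat_apply k A (\<lambda>c. hom_part (d - b c) (w c)) r = hom_part (d - a r) (mat_apply k A w r)"
  unfolding mat_apply_def hom_part_sum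
  by (intro sum.cong refl) (simp add: hom_part_mult[OF assms])

lemma lookup_Var_mult_0 [simp]: "Poly_Mapping.lookup (Var v * p) 0 = 0"
  by (simp add: lookup_Var_mult)

text \<open>
  A generator of degree \<open>d > \<rho>\<close>, as a cycle concentrated in \<open>e\<^bsub>{}\<^esub>\<close>, is a boundary, so it is a combination of
  elements of the module with coefficients \<open>x\<^sub>v\<close>. This gives a syzygy in which its coefficient has constant
  term \<open>1\<close>, contrary to minimality.
\<close>
lemma generator_degree_le:
  fixes A :: "nat \<Rightarrow> nat \<Rightarrow> ('v::finite, 'k::field) mpoly"
  assumes A: "\<And>r c. c < k \<Longrightarrow> homogeneous (b c - a r) (A r c)"
    and reg: "module_reg_le a (range (mat_apply k A)) \<rho>" and minimal: "no_constants (kernel k A)"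
    and c: "c < k"
  shows "b c \<le> \<rho>"
proof (rule ccontr)
  assume "\<not> b c \<le> \<rho>"
  then have d: "\<rho> < b c" by simp
  define e :: "nat \<Rightarrow> ('v, 'k) mpoly" where "e = (\<lambda>i. if i = c then 1 else 0)"
  have Ae: "mat_apply k A e r = A r c" for r unfolding e_def by (rule mat_apply_unit[OF c])
  define z where "z = (\<lambda>r (\<sigma> :: 'v set). if \<sigma> = {} then A r c else (0 :: ('v, 'k) mpoly))"
  have "(\<lambda>r. z r \<sigma>) \<in> range (mat_apply k A)" for \<sigma> :: "'v set"
  proof (cases "\<sigma> = {}")
    case True
    then show ?thesis by (intro image_eqI[of _ _ e]) (auto simp: z_def Ae)
  next
    case False
    then show ?thesis by (intro image_eqI[of _ _ "\<lambda>_. 0"]) (auto simp: z_def mat_apply_def)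
  qed
  moreover have "homogeneous (b c - a r) (z r \<sigma>)" for r and \<sigma> :: "'v set"
    using A[OF c] by (simp add: z_def)
  moreover have "koszul_bd (z r) \<sigma> = 0" for r \<sigma>
    by (simp add: koszul_bd_def z_def)
  ultimately obtain w where w: "\<And>\<sigma>. (\<lambda>r. w r \<sigma>) \<in> range (mat_apply k A)" "\<And>r. koszul_bd (w r) = z r"
    using module_reg_leD[OF reg d, of z] by blast
  from w(1) have "\<forall>v. \<exists>y\<in>free_mod k. (\<lambda>r. w r {v}) = mat_apply k A y"
    unfolding range_mat_apply by blast
  then obtain y where y: "\<And>v. y v \<in> free_mod k" "\<And>v. (\<lambda>r. w r {v}) = mat_apply k A (y v)"
    by metis
  \<comment> \<open>The syzygy that writes the column \<open>c\<close> as a combination of the columns with coefficients in the irrelevant ideal.\<close>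
  define u where "u i = e i - (\<Sum>v\<in>UNIV. koszul_sign v {} * (Var v * y v i))" for i
  have "A r c = (\<Sum>v\<in>UNIV. koszul_sign v {} * (Var v * mat_apply k A (y v) r))" for r
  proof -
    have "A r c = koszul_bd (w r) {}" unfolding w(2) by (simp add: z_def)
    also have "\<dots> = (\<Sum>v\<in>UNIV. koszul_sign v {} * (Var v * w r {v}))" by (simp add: koszul_bd_def)
    finally show ?thesis using y(2) by (simp add: fun_eq_iff)
  qed
  then have "mat_apply k A u = (\<lambda>_. 0)"
    unfolding u_def mat_apply_diff mat_apply_sum mat_apply_scale Ae fun_eq_iff by simp
  moreover have "u \<in> free_mod k"
    using y(1) c by (auto simp: u_def e_def free_mod_def)
  ultimately have "Poly_Mapping.lookup (u c) 0 = 0"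
    using minimal by (simp add: no_constants_def kernel_def)
  moreover have "Poly_Mapping.lookup (u c) 0 = 1"
    by (simp add: u_def e_def lookup_minus lookup_sum mult.left_commute[of "koszul_sign _ _" "Var _"])
  ultimately show False by simp
qed

text \<open>
  The connecting homomorphism for \<open>0 \<rightarrow> Z \<rightarrow> F \<rightarrow> N \<rightarrow> 0\<close>, where \<open>Z\<close> is the kernel. A cycle \<open>z\<close> in \<open>Z\<close> is the
  boundary of a chain \<open>W\<close> in \<open>F\<close>, because by minimality it has no constant terms. The image \<open>f\<close> of \<open>W\<close> in
  \<open>N\<close> is a cycle, whose coefficients have degree one less, so it is the boundary of some \<open>x\<close>. Lifting \<open>x\<close>
  to a chain \<open>y\<close> in \<open>F\<close> and subtracting the boundary of \<open>y\<close> from \<open>W\<close> corrects \<open>W\<close> to a chain in \<open>Z\<close>.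
\<close>
lemma kernel_reg_le:
  fixes A :: "nat \<Rightarrow> nat \<Rightarrow> ('v::finite, 'k::field) mpoly"
  assumes A: "\<And>r c. c < k \<Longrightarrow> homogeneous (b c - a r) (A r c)"
    and reg: "module_reg_le a (range (mat_apply k A)) \<rho>" and minimal: "no_constants (kernel k A)"
  shows "module_reg_le b (kernel k A) (\<rho> + 1)"
  unfolding module_reg_le_def
proof (intro allI impI)
  fix d and z :: "nat \<Rightarrow> 'v set \<Rightarrow> ('v, 'k) mpoly"
  assume d: "\<rho> + 1 < d" and z: "\<forall>\<sigma>. (\<lambda>r. z r \<sigma>) \<in> kernel k A" "\<forall>r \<sigma>. homogeneous (d - b r) (z r \<sigma>)"
    "\<forall>r. koszul_bd (z r) = (\<lambda>_. 0)"
  have z_free: "z c \<sigma> = 0" if "k \<le> c" for c \<sigma>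
  proof -
    have "(\<lambda>r. z r \<sigma>) \<in> free_mod k" using z(1) unfolding kernel_def by blast
    then show ?thesis using that by (simp add: free_mod_def)
  qed
  have Az: "mat_apply k A (\<lambda>c. z c \<sigma>) = (\<lambda>_. 0)" for \<sigma>
    using z(1) unfolding kernel_def by blast
  have "\<exists>w. koszul_bd w = z c" for c
  proof -
    have "(\<lambda>r. z r {}) \<in> kernel k A" using z(1) by blast
    from bspec[OF minimal[unfolded no_constants_def] this]
    have "Poly_Mapping.lookup (z c {}) 0 = 0" by simp
    then show ?thesis using koszul_exact[of "z c"] z(3) by metis
  qed
  then obtain w0 where w0: "\<And>c. koszul_bd (w0 c) = z c" by metis
  \<comment> \<open>The boundary of \<open>w0 c\<close> is homogeneous, so the other homogeneous components of \<open>w0 c\<close> can be dropped.\<close>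
  define W where "W c \<sigma> = (if c < k then hom_part (d - 1 - b c) (w0 c \<sigma>) else 0)" for c \<sigma>
  have bdW: "koszul_bd (W c) \<sigma> = z c \<sigma>" for c \<sigma>
  proof (cases "c < k")
    case True
    then have "W c = (\<lambda>\<sigma>. hom_part (d - 1 - b c) (w0 c \<sigma>))"
      by (intro ext) (simp add: W_def)
    then have "koszul_bd (W c) \<sigma> = hom_part (d - 1 - b c + 1) (koszul_bd (w0 c) \<sigma>)"
      by (simp add: hom_part_koszul_bd)
    also have "\<dots> = z c \<sigma>"
      using z(2) unfolding w0 by (intro hom_part_id) (simp add: algebra_simps)
    finally show ?thesis .
  next
    case False
    then have "W c = (\<lambda>_. 0)" by (intro ext) (simp add: W_def)
    then show ?thesis using False by (simp add: koszul_bd_zero z_free)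
  qed
  define f where "f r \<sigma> = mat_apply k A (\<lambda>c. W c \<sigma>) r" for r \<sigma>
  have "(\<lambda>r. f r \<sigma>) \<in> range (mat_apply k A)" for \<sigma>
    unfolding f_def by simp
  moreover have "homogeneous (d - 1 - a r) (f r \<sigma>)" for r \<sigma>
    unfolding f_def mat_apply_def
  proof (rule homogeneous_sum)
    fix c assume "c \<in> {..<k}"
    then have "homogeneous ((b c - a r) + (d - 1 - b c)) (A r c * W c \<sigma>)"
      by (intro homogeneous_mult A) (simp_all add: W_def)
    then show "homogeneous (d - 1 - a r) (A r c * W c \<sigma>)" by (simp add: algebra_simps)
  qed
  moreover have bdf: "koszul_bd (f r) \<sigma> = 0" for r \<sigma>
    unfolding f_def koszul_bd_mat_apply bdW Az ..
  moreover have "\<rho> < d - 1" using d by simp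
  ultimately obtain x where x: "\<And>\<sigma>. (\<lambda>r. x r \<sigma>) \<in> range (mat_apply k A)" "\<And>r. koszul_bd (x r) = f r"
    using module_reg_leD[OF reg, of "d - 1" f] by blast
  from x(1) have "\<forall>\<sigma>. \<exists>y\<in>free_mod k. (\<lambda>r. x r \<sigma>) = mat_apply k A y"
    unfolding range_mat_apply by blast
  then obtain y where y: "\<And>\<sigma>. y \<sigma> \<in> free_mod k" "\<And>\<sigma>. (\<lambda>r. x r \<sigma>) = mat_apply k A (y \<sigma>)"
    by metis
  define u where "u c \<sigma> = W c \<sigma> - koszul_bd (\<lambda>\<tau>. y \<tau> c) \<sigma>" for c \<sigma>
  have "koszul_bd (u c) = z c" for c
    unfolding u_def by (rule ext) (simp add: koszul_bd_diff bdW koszul_bd_bd)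
  moreover have "(\<lambda>c. u c \<sigma>) \<in> kernel k A" for \<sigma>
  proof -
    have "mat_apply k A (\<lambda>c. koszul_bd (\<lambda>\<tau>. y \<tau> c) \<sigma>) r = f r \<sigma>" for r
    proof -
      have "mat_apply k A (\<lambda>c. koszul_bd (\<lambda>\<tau>. y \<tau> c) \<sigma>) r = koszul_bd (\<lambda>\<tau>. mat_apply k A (y \<tau>) r) \<sigma>"
        by (simp add: koszul_bd_mat_apply)
      also have "(\<lambda>\<tau>. mat_apply k A (y \<tau>) r) = x r"
      proof
        show "mat_apply k A (y \<tau>) r = x r \<tau>" for \<tau>
          using fun_cong[OF y(2)[of \<tau>], of r] by simp
      qed
      finally show ?thesis by (simp add: x(2))
    qed
    then have "mat_apply k A (\<lambda>c. u c \<sigma>) = (\<lambda>_. 0)"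
      unfolding u_def mat_apply_diff fun_eq_iff by (simp add: f_def)
    moreover have "(\<lambda>c. u c \<sigma>) \<in> free_mod k"
      using y(1) by (auto simp: free_mod_def u_def W_def koszul_bd_def)
    ultimately show ?thesis by (simp add: kernel_def)
  qed
  ultimately show "\<exists>w. (\<forall>\<sigma>. (\<lambda>r. w r \<sigma>) \<in> kernel k A) \<and> (\<forall>r. koszul_bd (w r) = z r)"
    by blast
qed

definition component :: "(nat \<Rightarrow> int) \<Rightarrow> int \<Rightarrow> (nat \<Rightarrow> ('v::finite, 'k::field) mpoly) \<Rightarrow> nat \<Rightarrow> ('v, 'k) mpoly"
  where "component a d f = (\<lambda>r. hom_part (d - a r) (f r))"

definition is_submodule :: "(nat \<Rightarrow> 'a::comm_ring_1) set \<Rightarrow> bool"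
  where "is_submodule S \<longleftrightarrow> (\<lambda>_. 0) \<in> S \<and> (\<forall>f\<in>S. \<forall>g\<in>S. (\<lambda>r. f r + g r) \<in> S) \<and> (\<forall>p. \<forall>f\<in>S. (\<lambda>r. p * f r) \<in> S)"

definition graded_piece :: "(nat \<Rightarrow> int) \<Rightarrow> (nat \<Rightarrow> ('v::finite, 'k::field) mpoly) set \<Rightarrow> int \<Rightarrow> (nat \<Rightarrow> ('v, 'k) mpoly) set"
  where "graded_piece a N d = {f \<in> N. \<forall>r. homogeneous (d - a r) (f r)}"

definition graded_submodule :: "(nat \<Rightarrow> int) \<Rightarrow> nat \<Rightarrow> (nat \<Rightarrow> ('v::finite, 'k::field) mpoly) set \<Rightarrow> bool"
  where "graded_submodule a n N \<longleftrightarrow> N \<subseteq> free_mod n \<and> is_submodule N \<and>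
    (\<forall>d. \<forall>f\<in>N. component a d f \<in> N)"

lemma is_submodule_add: "is_submodule S \<Longrightarrow> f \<in> S \<Longrightarrow> g \<in> S \<Longrightarrow> (\<lambda>r. f r + g r) \<in> S"
  by (simp add: is_submodule_def)

lemma is_submodule_scale: "is_submodule S \<Longrightarrow> f \<in> S \<Longrightarrow> (\<lambda>r. p * f r) \<in> S"
  by (simp add: is_submodule_def)

lemma is_submodule_sum:
  assumes S: "is_submodule S" and "\<And>x. x \<in> X \<Longrightarrow> f x \<in> S"
  shows "(\<lambda>r. \<Sum>x\<in>X. f x r) \<in> S"
  using assms(2)
proof (induction X rule: infinite_finite_induct)
  case (insert x X)
  then have "f x \<in> S" "(\<lambda>r. \<Sum>x\<in>X. f x r) \<in> S" by auto
  then have "(\<lambda>r. f x r + (\<Sum>x\<in>X. f x r)) \<in> S"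
    by (rule is_submodule_add[OF S])
  then show ?case using insert.hyps by simp
qed (use S in \<open>auto simp: is_submodule_def\<close>)

lemma graded_submodule_kernel:
  fixes A :: "nat \<Rightarrow> nat \<Rightarrow> ('v::finite, 'k::field) mpoly"
  assumes A: "\<And>r c. c < k \<Longrightarrow> homogeneous (b c - a r) (A r c)"
  shows "graded_submodule b k (kernel k A)"
  unfolding graded_submodule_def is_submodule_def
proof (intro conjI ballI allI)
  show "kernel k A \<subseteq> free_mod k" by (auto simp: kernel_def)
  show "(\<lambda>_. 0) \<in> kernel k A" by (simp add: kernel_def free_mod_def mat_apply_def fun_eq_iff)
  fix f assume f: "f \<in> kernel k A"
  show "(\<lambda>r. f r + g r) \<in> kernel k A" if "g \<in> kernel k A" for g
    using f that by (auto simp: kernel_def free_mod_def mat_apply_add fun_eq_iff)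
  show "(\<lambda>r. p * f r) \<in> kernel k A" for p
    using f by (auto simp: kernel_def free_mod_def mat_apply_scale fun_eq_iff)
  show "component b d f \<in> kernel k A" for d
    using f by (auto simp: kernel_def free_mod_def component_def hom_part_mat_apply[of k b a A, OF A] fun_eq_iff)
qed

context
  fixes a :: "nat \<Rightarrow> int" and n :: nat and N :: "(nat \<Rightarrow> ('v::finite, 'k::field) mpoly) set"
  assumes N: "graded_submodule a n N"
begin

lemma submodule_0: "(\<lambda>_. 0) \<in> N"
  and submodule_free: "f \<in> N \<Longrightarrow> n \<le> r \<Longrightarrow> f r = 0"
  and submodule_scale: "f \<in> N \<Longrightarrow> (\<lambda>r. p * f r) \<in> N"
  and submodule_component: "f \<in> N \<Longrightarrow> component a d f \<in> N"
  using N by (auto simp: graded_submodule_def is_submodule_def free_mod_def)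

lemma submodule_sum: "(\<And>x. x \<in> X \<Longrightarrow> f x \<in> N) \<Longrightarrow> (\<lambda>r. \<Sum>x\<in>X. f x r) \<in> N"
  by (rule is_submodule_sum) (use N in \<open>auto simp: graded_submodule_def\<close>)

text \<open>
  For \<open>d > \<rho>\<close>, an element of degree \<open>d\<close> is a Koszul cycle and hence a boundary, that is, a combination of
  elements of degree \<open>d - 1\<close> with coefficients \<open>x\<^sub>v\<close>.
\<close>
lemma generated_by_low_degrees:
  assumes reg: "module_reg_le a N \<rho>"
    and S: "is_submodule S" and low: "\<And>d. d \<le> \<rho> \<Longrightarrow> graded_piece a N d \<subseteq> S"
  shows "N \<subseteq> S"
proof
  have hom: "f \<in> S" if "f \<in> N" "\<And>r. homogeneous (d - a r) (f r)" for d f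
    using that
  proof (induction "nat (d - \<rho>)" arbitrary: d f)
    case 0
    then show ?case using low[of d] by (auto simp: graded_piece_def)
  next
    case (Suc j)
    then have d: "\<rho> < d" by simp
    define z where "z = (\<lambda>r (\<sigma> :: 'v set). if \<sigma> = {} then f r else 0)"
    have "(\<lambda>r. z r \<sigma>) \<in> N" for \<sigma>
      using Suc.prems(1) submodule_0 by (cases "\<sigma> = {}") (simp_all add: z_def)
    moreover have "homogeneous (d - a r) (z r \<sigma>)" for r \<sigma>
      using Suc.prems(2) by (simp add: z_def)
    moreover have "koszul_bd (z r) \<sigma> = 0" for r \<sigma>
      by (simp add: koszul_bd_def z_def)
    ultimately obtain w where w: "\<And>\<sigma>. (\<lambda>r. w r \<sigma>) \<in> N" "\<And>r. koszul_bd (w r) = z r"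
      using module_reg_leD[OF reg d, of z] by blast
    define g where "g v = component a (d - 1) (\<lambda>r. w r {v})" for v
    have "g v \<in> S" for v
    proof (rule Suc.hyps(1))
      show "j = nat (d - 1 - \<rho>)" using Suc.hyps(2) by simp
      show "g v \<in> N" unfolding g_def by (rule submodule_component[OF w(1)])
      show "homogeneous (d - 1 - a r) (g v r)" for r by (simp add: g_def component_def)
    qed
    then have "(\<lambda>r. \<Sum>v\<in>UNIV. koszul_sign v {} * (Var v * g v r)) \<in> S"
      by (intro is_submodule_sum[OF S] is_submodule_scale[OF S])
    moreover have "f = (\<lambda>r. \<Sum>v\<in>UNIV. koszul_sign v {} * (Var v * g v r))"
    proof
      fix r
      have "f r = hom_part (d - a r) (koszul_bd (w r) {})"
        unfolding w(2) using Suc.prems(2) by (simp add: z_def hom_part_id)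
      also have "\<dots> = koszul_bd (\<lambda>\<sigma>. hom_part (d - 1 - a r) (w r \<sigma>)) {}"
        unfolding hom_part_koszul_bd by (simp add: algebra_simps)
      finally show "f r = (\<Sum>v\<in>UNIV. koszul_sign v {} * (Var v * g v r))"
        by (simp add: koszul_bd_def g_def component_def)
    qed
    ultimately show ?case by simp
  qed
  fix f assume f: "f \<in> N"
  have "\<forall>r. \<exists>D. finite D \<and> f r = (\<Sum>d\<in>D. hom_part d (f r))"
    by (metis sum_hom_parts)
  then obtain D where D: "\<And>r. finite (D r)" "\<And>r. f r = (\<Sum>d\<in>D r. hom_part d (f r))" by metis
  define D' where "D' = (\<Union>r<n. (\<lambda>d. d + a r) ` D r)"
  have "f = (\<lambda>r. \<Sum>d\<in>D'. component a d f r)"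
  proof
    fix r
    show "f r = (\<Sum>d\<in>D'. component a d f r)"
    proof (cases "r < n")
      case False
      then show ?thesis using submodule_free[OF f, of r] by (simp add: component_def)
    next
      case True
      have *: "hom_part e (f r) = 0" if "e \<notin> D r" for e
      proof -
        have "hom_part e (f r) = (\<Sum>d\<in>D r. hom_part e (hom_part d (f r)))"
          by (subst D(2)) (rule hom_part_sum)
        also have "\<dots> = 0"
          using that by (intro sum.neutral ballI hom_part_other[OF homogeneous_hom_part]) auto
        finally show ?thesis .
      qed
      have "f r = (\<Sum>d\<in>D r. hom_part d (f r))" by (rule D(2))
      also have "\<dots> = (\<Sum>d\<in>(\<lambda>d. d + a r) ` D r. component a d f r)"
        by (simp add: sum.reindex component_def)
      also have "\<dots> = (\<Sum>d\<in>D'. component a d f r)"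
      proof (rule sum.mono_neutral_left)
        show "finite D'" unfolding D'_def using D(1) by blast
        show "(\<lambda>d. d + a r) ` D r \<subseteq> D'" unfolding D'_def using True by blast
        show "\<forall>i\<in>D' - (\<lambda>d. d + a r) ` D r. component a i f r = 0"
        proof
          fix i assume "i \<in> D' - (\<lambda>d. d + a r) ` D r"
          then have "i - a r \<notin> D r" by (metis Diff_iff diff_add_cancel image_eqI)
          then show "component a i f r = 0" by (simp add: component_def *)
        qed
      qed
      finally show ?thesis .
    qed
  qed
  moreover have "(\<lambda>r. \<Sum>d\<in>D'. component a d f r) \<in> S"
  proof (rule is_submodule_sum[OF S])
    fix d
    show "component a d f \<in> S"
      by (rule hom[of _ d]) (simp_all add: submodule_component f, simp add: component_def)
  qed
  ultimately show "f \<in> S" by simp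
qed

end

lemma finite_monomials: "finite {m :: 'v::finite \<Rightarrow>\<^sub>0 nat. mon_degree m = k}"
proof -
  have "Poly_Mapping.lookup m v \<le> mon_degree m" for m :: "'v \<Rightarrow>\<^sub>0 nat" and v
    unfolding mon_degree_def by (rule member_le_sum) auto
  then have "Poly_Mapping.lookup ` {m :: 'v \<Rightarrow>\<^sub>0 nat. mon_degree m = k}
      \<subseteq> {f. \<forall>v. (v \<in> UNIV \<longrightarrow> f v \<in> {..k}) \<and> (v \<notin> UNIV \<longrightarrow> f v = 0)}"
    by auto
  then have "finite (Poly_Mapping.lookup ` {m :: 'v \<Rightarrow>\<^sub>0 nat. mon_degree m = k})"
    by (rule finite_subset) (rule finite_set_of_finite_funs[OF finite finite_atMost])
  then show ?thesis
    by (rule finite_imageD) (simp only: inj_on_def lookup_inject, blast)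
qed

lemma sum_fun_at: "(\<Sum>x\<in>X. f x) r = (\<Sum>x\<in>X. f x r :: 'a::comm_monoid_add)"
  by (induction X rule: infinite_finite_induct) simp_all

lemma sum_monomials: "p = (\<Sum>m\<in>Poly_Mapping.keys p. Poly_Mapping.single m (Poly_Mapping.lookup p m))"
proof (rule poly_mapping_eqI)
  fix m
  show "Poly_Mapping.lookup p m = Poly_Mapping.lookup (\<Sum>m\<in>Poly_Mapping.keys p. Poly_Mapping.single m (Poly_Mapping.lookup p m)) m"
    by (cases "m \<in> Poly_Mapping.keys p") (auto simp: lookup_sum lookup_single when_def in_keys_iff)
qed

text \<open>
  A graded piece of a free module is spanned over the field by finitely many monomials, so every subspace of
  it has a finite basis. The conclusion says that \<open>B\<close> generates the piece, without mention of the span.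
\<close>
lemma graded_piece_finite:
  fixes N :: "(nat \<Rightarrow> ('v::finite, 'k::field) mpoly) set"
  assumes N: "graded_submodule a n N"
  shows "\<exists>B. finite B \<and> B \<subseteq> graded_piece a N d \<and> (\<forall>S. is_submodule S \<longrightarrow> B \<subseteq> S \<longrightarrow> graded_piece a N d \<subseteq> S)"
proof -
  define scale :: "'k \<Rightarrow> (nat \<Rightarrow> ('v, 'k) mpoly) \<Rightarrow> nat \<Rightarrow> ('v, 'k) mpoly"
    where "scale k f = (\<lambda>r. Poly_Mapping.single 0 k * f r)" for k f
  interpret vs: vector_space scale
    by standard (simp_all add: scale_def fun_eq_iff algebra_simps single_add mult_single flip: mult.assoc)
  define V where "V = graded_piece a N d"
  obtain B where B: "B \<subseteq> V" "vs.independent B" "V \<subseteq> vs.span B"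
    by (rule vs.maximal_independent_subset)
  define unit :: "nat \<Rightarrow> ('v \<Rightarrow>\<^sub>0 nat) \<Rightarrow> nat \<Rightarrow> ('v, 'k) mpoly"
    where "unit i m = (\<lambda>r. if r = i then Poly_Mapping.single m 1 else 0)" for i m
  define T where "T = (\<Union>i<n. unit i ` {m. mon_degree m = nat (d - a i)})"
  have "finite T" unfolding T_def by (intro finite_UN_I finite_imageI finite_monomials) simp
  have "V \<subseteq> vs.span T"
  proof
    fix f assume f: "f \<in> V"
    have "f = (\<Sum>i<n. \<Sum>m\<in>Poly_Mapping.keys (f i). scale (Poly_Mapping.lookup (f i) m) (unit i m))"
    proof
      fix r
      have "(\<Sum>i<n. \<Sum>m\<in>Poly_Mapping.keys (f i). scale (Poly_Mapping.lookup (f i) m) (unit i m)) r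
          = (\<Sum>i<n. if r = i then f r else 0)"
        unfolding sum_fun_at
      proof (rule sum.cong)
        fix i
        show "(\<Sum>m\<in>Poly_Mapping.keys (f i). scale (Poly_Mapping.lookup (f i) m) (unit i m) r) = (if r = i then f r else 0)"
          by (cases "r = i") (simp_all add: scale_def unit_def mult_single flip: sum_monomials)
      qed simp
      also have "\<dots> = f r"
        using f submodule_free[OF N, of f r] by (auto simp: V_def graded_piece_def)
      finally show "f r = (\<Sum>i<n. \<Sum>m\<in>Poly_Mapping.keys (f i). scale (Poly_Mapping.lookup (f i) m) (unit i m)) r" ..
    qed
    also have "\<dots> \<in> vs.span T"
    proof (intro vs.span_sum vs.span_scale vs.span_base)
      fix i m assume "i \<in> {..<n}" "m \<in> Poly_Mapping.keys (f i)"
      moreover from this f have "int (mon_degree m) = d - a i" by (simp add: V_def graded_piece_def homogeneous_def)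
      ultimately show "unit i m \<in> T" unfolding T_def by force
    qed
    finally show "f \<in> vs.span T" .
  qed
  then have "finite B"
    using vs.independent_span_bound[OF \<open>finite T\<close> B(2)] B(1) by blast
  moreover have "V \<subseteq> S" if S: "is_submodule S" "B \<subseteq> S" for S
  proof -
    have "vs.subspace S"
      using S(1) by (auto simp: is_submodule_def vs.subspace_def scale_def zero_fun_def plus_fun_def)
    then have "vs.span B \<subseteq> S" by (rule vs.span_minimal[OF S(2)])
    then show ?thesis using B(3) by blast
  qed
  ultimately show ?thesis using B(1) unfolding V_def by blast
qed

text \<open>The columns of \<open>A\<close>, of degrees \<open>b 0, \<dots>, b (k - 1)\<close>, generate \<open>N\<close>.\<close>
definition presents :: "(nat \<Rightarrow> int) \<Rightarrow> (nat \<Rightarrow> ('v::finite, 'k::field) mpoly) set \<Rightarrow> nat \<Rightarrow> (nat \<Rightarrow> int) \<Rightarrow> (nat \<Rightarrow> nat \<Rightarrow> ('v, 'k) mpoly) \<Rightarrow> bool"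
  where "presents a N k b A \<longleftrightarrow> (\<forall>r c. c < k \<longrightarrow> homogeneous (b c - a r) (A r c)) \<and> range (mat_apply k A) = N"

lemma presents_finite:
  assumes "finite C" "\<And>c r. c \<in> C \<Longrightarrow> homogeneous (b c - a r) (g c r)"
    and N: "range (\<lambda>p r. \<Sum>c\<in>C. g c r * p c) = N"
  shows "\<exists>b' A. presents a N (card C) b' A"
proof -
  obtain h where h: "bij_betw h {0..<card C} C" using ex_bij_betw_nat_finite[OF assms(1)] by blast
  define A where "A r i = g (h i) r" for r i
  have eq: "mat_apply (card C) A (\<lambda>i. p (h i)) = (\<lambda>r. \<Sum>c\<in>C. g c r * p c)" for p
  proof
    fix r
    show "mat_apply (card C) A (\<lambda>i. p (h i)) r = (\<Sum>c\<in>C. g c r * p c)"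
      using sum.reindex_bij_betw[OF h, of "\<lambda>c. g c r * p c"]
      by (simp add: mat_apply_def A_def lessThan_atLeast0)
  qed
  have "mat_apply (card C) A w \<in> N" for w
  proof -
    define p where "p c = w (inv_into {0..<card C} h c)" for c
    have "mat_apply (card C) A w = mat_apply (card C) A (\<lambda>i. p (h i))"
      unfolding mat_apply_def p_def
      using bij_betw_inv_into_left[OF h] by (intro ext sum.cong) simp_all
    then show ?thesis using N unfolding eq by blast
  qed
  moreover have "N \<subseteq> range (mat_apply (card C) A)"
    unfolding N[symmetric] using rangeI[of "mat_apply (card C) A"] by (auto simp flip: eq)
  ultimately have "range (mat_apply (card C) A) = N" by blast
  moreover have "homogeneous (b (h c) - a r) (A r c)" if "c < card C" for c r
    using assms(2)[of "h c" r] bij_betwE[OF h] that by (simp add: A_def)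
  ultimately have "presents a N (card C) (\<lambda>c. b (h c)) A" unfolding presents_def by blast
  then show ?thesis by blast
qed

lemma presentation_exists:
  fixes N :: "(nat \<Rightarrow> ('v::finite, 'k::field) mpoly) set"
  assumes N: "graded_submodule a n N" and reg: "module_reg_le a N \<rho>"
  shows "\<exists>k b A. presents a N k b A"
proof -
  obtain B where B: "\<And>d. finite (B d)" "\<And>d. B d \<subseteq> graded_piece a N d"
    and gen: "\<And>d S. is_submodule S \<Longrightarrow> B d \<subseteq> S \<Longrightarrow> graded_piece a N d \<subseteq> S"
    using graded_piece_finite[OF N] by metis
  have BN: "f \<in> N" and Bh: "homogeneous (d - a r) (f r)" if "f \<in> B d" for f d r
    using B(2)[of d] that by (auto simp: graded_piece_def)
  \<comment> \<open>No element of \<open>N\<close> has a nonzero component of degree less than \<open>lo\<close>.\<close>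
  obtain lo where lo: "\<And>r. r < n \<Longrightarrow> lo \<le> a r"
  proof
    show "Min (insert 0 (a ` {..<n})) \<le> a r" if "r < n" for r using that by simp
  qed
  define C where "C = (SIGMA d:{lo..\<rho>}. B d)"
  define S where "S = range (\<lambda>p r. \<Sum>c\<in>C. snd c r * p c)"
  have "finite C" unfolding C_def using B(1) by blast
  have subS: "is_submodule S"
    unfolding is_submodule_def
  proof (intro conjI ballI allI)
    show "(\<lambda>_. 0) \<in> S" unfolding S_def by (rule image_eqI[of _ _ "\<lambda>_. 0"]) simp_all
    fix f assume "f \<in> S"
    then obtain p where p: "f = (\<lambda>r. \<Sum>c\<in>C. snd c r * p c)" unfolding S_def by blast
    show "(\<lambda>r. q * f r) \<in> S" for q
      unfolding p S_def by (intro image_eqI[of _ _ "\<lambda>c. q * p c"]) (simp_all add: sum_distrib_left mult_ac)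
    fix g assume "g \<in> S"
    then obtain q where q: "g = (\<lambda>r. \<Sum>c\<in>C. snd c r * q c)" unfolding S_def by blast
    show "(\<lambda>r. f r + g r) \<in> S"
      unfolding p q S_def by (intro image_eqI[of _ _ "\<lambda>c. p c + q c"]) (simp_all add: algebra_simps sum.distrib)
  qed
  have BS: "B d \<subseteq> S" if "d \<in> {lo..\<rho>}" for d
  proof
    fix f assume "f \<in> B d"
    then have "(d, f) \<in> C" using that by (simp add: C_def)
    then have "f = (\<lambda>r. \<Sum>c\<in>C. snd c r * (if c = (d, f) then 1 else 0))"
      using \<open>finite C\<close> by (simp add: if_distrib[of "(*) _"] cong: if_cong)
    then show "f \<in> S"
      unfolding S_def by (rule image_eqI[where x = "\<lambda>c. if c = (d, f) then 1 else 0"]) simp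
  qed
  have "N \<subseteq> S"
  proof (rule generated_by_low_degrees[OF N reg subS])
    fix d assume d: "d \<le> \<rho>"
    show "graded_piece a N d \<subseteq> S"
    proof (cases "lo \<le> d")
      case True
      then show ?thesis using gen[OF subS BS] d by simp
    next
      case False
      show ?thesis
      proof
        fix f assume f: "f \<in> graded_piece a N d"
        have "f r = 0" for r
        proof (cases "r < n")
          case True
          then have "Poly_Mapping.keys (f r) = {}"
            using f lo[of r] False by (fastforce simp: homogeneous_def graded_piece_def)
          then show ?thesis by simp
        qed (use submodule_free[OF N] f in \<open>simp add: graded_piece_def\<close>)
        then have "f = (\<lambda>_. 0)" by blast
        then show "f \<in> S" using subS by (simp add: is_submodule_def)
      qed
    qed
  qed
  moreover have "S \<subseteq> N"
  proof
    fix f assume "f \<in> S"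
    then obtain p where f: "f = (\<lambda>r. \<Sum>c\<in>C. p c * snd c r)" by (auto simp: S_def mult.commute)
    show "f \<in> N" unfolding f
      by (intro submodule_sum[OF N] submodule_scale[OF N]) (use BN in \<open>auto simp: C_def\<close>)
  qed
  ultimately have "range (\<lambda>p r. \<Sum>c\<in>C. snd c r * p c) = N" unfolding S_def by simp
  then have "\<exists>b' A. presents a N (card C) b' A"
    using Bh by (intro presents_finite[of C fst a snd] \<open>finite C\<close>) (auto simp: C_def)
  then show ?thesis by blast
qed

text \<open>
  If a syzygy of a presentation with the least number of columns had a coefficient with constant term
  \<open>\<kappa> \<noteq> 0\<close>, then in the appropriate degree this coefficient would be the unit \<open>\<kappa>\<close>, and the corresponding
  column could be expressed by the others and dropped.
\<close>
lemma minimal_presentation_exists: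
  fixes N :: "(nat \<Rightarrow> ('v::finite, 'k::field) mpoly) set"
  assumes N: "graded_submodule a n N" and reg: "module_reg_le a N \<rho>"
  shows "\<exists>k b A. presents a N k b A \<and> no_constants (kernel k A)"
proof -
  define k where "k = (LEAST k. \<exists>b A. presents a N k b A)"
  have "\<exists>b A. presents a N k b A"
    unfolding k_def using presentation_exists[OF N reg] by (rule LeastI_ex)
  then obtain b A where A: "presents a N k b A" by blast
  have least: "k \<le> l" if "presents a N l b' A'" for l b' A'
    unfolding k_def using that by (intro Least_le) blast
  have hom: "\<And>r c. c < k \<Longrightarrow> homogeneous (b c - a r) (A r c)" and range: "range (mat_apply k A) = N"
    using A by (auto simp: presents_def)
  have "no_constants (kernel k A)"
    unfolding no_constants_def
  proof (intro ballI allI, rule ccontr)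
    fix w c0 assume w: "w \<in> kernel k A" and c0: "Poly_Mapping.lookup (w c0) 0 \<noteq> 0"
    define \<kappa> where "\<kappa> = Poly_Mapping.lookup (w c0) 0"
    have c0k: "c0 < k"
    proof (rule ccontr)
      assume "\<not> c0 < k"
      then have "w c0 = 0" using w by (simp add: kernel_def free_mod_def)
      with c0 show False by simp
    qed
    \<comment> \<open>The component of the syzygy in degree \<open>b c0\<close>, where its coefficient at \<open>c0\<close> is a constant.\<close>
    define u where "u c = hom_part (b c0 - b c) (w c)" for c
    have "mat_apply k A u r = 0" for r
    proof -
      have "mat_apply k A u r = hom_part (b c0 - a r) (mat_apply k A w r)"
        unfolding u_def[abs_def] by (rule hom_part_mat_apply[OF hom])
      then show ?thesis using w by (simp add: kernel_def)
    qed
    moreover have u0: "u c0 = Poly_Mapping.single 0 \<kappa>"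
      by (rule poly_mapping_eqI) (auto simp: u_def lookup_hom_part lookup_single when_def \<kappa>_def)
    ultimately have rel: "A r c0 * Poly_Mapping.single 0 \<kappa> + (\<Sum>c\<in>{..<k} - {c0}. A r c * u c) = 0" for r
      using c0k unfolding mat_apply_def by (subst (asm) sum.remove[of _ c0]) auto
    have A0: "A r c0 = - (\<Sum>c\<in>{..<k} - {c0}. A r c * u c) * Poly_Mapping.single 0 (inverse \<kappa>)" for r
    proof -
      have "A r c0 = A r c0 * Poly_Mapping.single 0 \<kappa> * Poly_Mapping.single 0 (inverse \<kappa>)"
        using c0 by (simp add: mult.assoc mult_single \<kappa>_def)
      also have "A r c0 * Poly_Mapping.single 0 \<kappa> = - (\<Sum>c\<in>{..<k} - {c0}. A r c * u c)"
        using rel by (simp add: eq_neg_iff_add_eq_0)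
      finally show ?thesis .
    qed
    have "range (\<lambda>p r. \<Sum>c\<in>{..<k} - {c0}. A r c * p c) = N"
      unfolding range[symmetric]
    proof (intro subset_antisym image_subsetI)
      fix p :: "nat \<Rightarrow> ('v, 'k) mpoly"
      have "(\<lambda>r. \<Sum>c\<in>{..<k} - {c0}. A r c * p c) = mat_apply k A (\<lambda>c. if c = c0 then 0 else p c)"
        unfolding mat_apply_def fun_eq_iff by (intro allI sum.mono_neutral_cong_left) auto
      then show "(\<lambda>r. \<Sum>c\<in>{..<k} - {c0}. A r c * p c) \<in> range (mat_apply k A)" by blast
      define q where "q c = p c - u c * (Poly_Mapping.single 0 (inverse \<kappa>) * p c0)" for c
      have "mat_apply k A p r = (\<Sum>c\<in>{..<k} - {c0}. A r c * q c)" for r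
      proof -
        have "mat_apply k A p r = A r c0 * p c0 + (\<Sum>c\<in>{..<k} - {c0}. A r c * p c)"
          using c0k unfolding mat_apply_def by (subst sum.remove[of _ c0]) auto
        also have "A r c0 * p c0 = - (\<Sum>c\<in>{..<k} - {c0}. A r c * (u c * (Poly_Mapping.single 0 (inverse \<kappa>) * p c0)))"
          by (subst A0) (simp add: sum_distrib_right mult.assoc)
        finally show ?thesis by (simp add: q_def right_diff_distrib sum_subtractf)
      qed
      then have "mat_apply k A p = (\<lambda>r. \<Sum>c\<in>{..<k} - {c0}. A r c * q c)" by blast
      then show "mat_apply k A p \<in> range (\<lambda>p r. \<Sum>c\<in>{..<k} - {c0}. A r c * p c)" by blast
    qed
    then have "\<exists>b' A'. presents a N (card ({..<k} - {c0})) b' A'"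
      using hom by (intro presents_finite[of _ b a "\<lambda>c r. A r c"]) auto
    then show False using least c0k by fastforce
  qed
  then show ?thesis using A by blast
qed

section \<open>Minimal graded free resolutions\<close>
lemma lookup_mult_0:
  fixes p q :: "('v::finite, 'k::field) mpoly"
  assumes "Poly_Mapping.lookup p 0 = 0"
  shows "Poly_Mapping.lookup (q * p) 0 = 0"
proof (rule ccontr)
  assume "\<not> ?thesis"
  then have "0 \<in> Poly_Mapping.keys (q * p)" by (simp add: in_keys_iff)
  then obtain x y where xy: "0 = x + y" "y \<in> Poly_Mapping.keys p" using keys_mult[of q p] by blast
  then have "mon_degree y = 0" by (metis add_is_0 mon_degree_0_iff mon_degree_add)
  then show False using xy(2) assms by (simp add: in_keys_iff)
qed

text \<open>Used for the irrelevant ideal, the edge ideal and its powers.\<close>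
lemma ideal_gen_monomial_ideal:
  fixes G :: "('v::finite, 'k::field) mpoly set"
  assumes U: "\<And>m m'. m \<in> U \<Longrightarrow> m \<subseteq># m' \<Longrightarrow> m' \<in> U" and G: "G \<subseteq> monomial_ideal U"
    and gen: "\<And>m c. mon_mset m \<in> U \<Longrightarrow> \<exists>g\<in>G. \<exists>q. Poly_Mapping.single m c = q * g"
  shows "ideal_gen G = monomial_ideal U"
proof -
  interpret m: Modules.module "(*) :: ('v, 'k) mpoly \<Rightarrow> _ \<Rightarrow> _" by (rule module_mult)
  show ?thesis
    unfolding ideal_gen_def
  proof
    have "m.subspace (monomial_ideal U)"
      by (intro m.subspaceI monomial_ideal_0 monomial_ideal_add monomial_ideal_mult[OF U])
    then show "m.span G \<subseteq> monomial_ideal U" by (rule m.span_minimal[OF G])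
    show "monomial_ideal U \<subseteq> m.span G"
    proof
      fix p :: "('v, 'k) mpoly" assume p: "p \<in> monomial_ideal U"
      have "(\<Sum>m\<in>Poly_Mapping.keys p. Poly_Mapping.single m (Poly_Mapping.lookup p m)) \<in> m.span G"
      proof (rule m.span_sum)
        fix m assume "m \<in> Poly_Mapping.keys p"
        then have "mon_mset m \<in> U" using p by (simp add: monomial_ideal_def)
        from gen[OF this] obtain g q where "g \<in> G" "Poly_Mapping.single m (Poly_Mapping.lookup p m) = q * g" by blast
        then show "Poly_Mapping.single m (Poly_Mapping.lookup p m) \<in> m.span G"
          by (simp add: m.span_scale m.span_base)
      qed
      then show "p \<in> m.span G" by (simp flip: sum_monomials)
    qed
  qed
qed

lemma irrelevant_ideal_eq: "irrelevant_ideal = {p :: ('v::finite, 'k::field) mpoly. Poly_Mapping.lookup p 0 = 0}"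
proof -
  have mon0: "mon_mset m = {#} \<longleftrightarrow> m = 0" for m :: "'v \<Rightarrow>\<^sub>0 nat"
    by (simp add: multiset_eq_iff poly_mapping_eq_iff fun_eq_iff)
  have "irrelevant_ideal = (monomial_ideal {m. m \<noteq> {#}} :: ('v, 'k) mpoly set)"
    unfolding irrelevant_ideal_def
  proof (rule ideal_gen_monomial_ideal)
    show "range Var \<subseteq> (monomial_ideal {m. m \<noteq> {#}} :: ('v, 'k) mpoly set)"
      by (auto simp: monomial_ideal_def Var_def)
    fix m :: "'v \<Rightarrow>\<^sub>0 nat" and c :: 'k
    assume "mon_mset m \<in> {m. m \<noteq> {#}}"
    then obtain v where v: "0 < Poly_Mapping.lookup m v"
      by (auto simp: mon0 poly_mapping_eq_iff fun_eq_iff)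
    then have "m - Poly_Mapping.single v 1 + Poly_Mapping.single v 1 = m"
      by (intro poly_mapping_eqI) (auto simp: lookup_add lookup_minus lookup_single when_def)
    then have "Poly_Mapping.single m c = Poly_Mapping.single (m - Poly_Mapping.single v 1) c * Var v"
      by (simp add: Var_def mult_single)
    then show "\<exists>g\<in>range Var. \<exists>q. Poly_Mapping.single m c = q * g" by blast
  qed auto
  also have "\<dots> = {p. Poly_Mapping.lookup p 0 = 0}"
    by (auto simp: monomial_ideal_def mon0 in_keys_iff)
  finally show ?thesis .
qed

text \<open>Vectors and matrices of fixed dimension as functions that vanish outside their range.\<close>
definition vec_fun :: "'a::zero vec \<Rightarrow> nat \<Rightarrow> 'a"
  where "vec_fun w = (\<lambda>c. if c < dim_vec w then w $ c else 0)"

definition mat_fun :: "'a::zero mat \<Rightarrow> nat \<Rightarrow> nat \<Rightarrow> 'a"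
  where "mat_fun M = (\<lambda>r c. if r < dim_row M \<and> c < dim_col M then M $$ (r, c) else 0)"

lemma vec_fun_image: "vec_fun ` carrier_vec k = free_mod k"
proof (intro subset_antisym subsetI)
  fix f :: "nat \<Rightarrow> 'a" assume "f \<in> free_mod k"
  then have "f = vec_fun (vec k f)" by (auto simp: vec_fun_def free_mod_def)
  then show "f \<in> vec_fun ` carrier_vec k" by (rule image_eqI) simp
qed (auto simp: vec_fun_def free_mod_def)

lemma vec_fun_eq_iff: "v \<in> carrier_vec k \<Longrightarrow> w \<in> carrier_vec k \<Longrightarrow> vec_fun v = vec_fun w \<longleftrightarrow> v = w"
  by (auto simp: vec_fun_def fun_eq_iff vec_eq_iff split: if_splits)

lemma vec_fun_zero: "vec_fun (0\<^sub>v k) = (\<lambda>_. 0)"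
  by (auto simp: vec_fun_def)

lemma mat_apply_vec_fun:
  assumes "M \<in> carrier_mat n k" "w \<in> carrier_vec k"
  shows "mat_apply k (mat_fun M) (vec_fun w) = vec_fun (M *\<^sub>v w)"
proof
  fix r
  show "mat_apply k (mat_fun M) (vec_fun w) r = vec_fun (M *\<^sub>v w) r"
    using assms by (cases "r < n")
      (auto simp: mat_apply_def mat_fun_def vec_fun_def scalar_prod_def lessThan_atLeast0 intro!: sum.cong)
qed

lemma mat_apply_row:
  assumes "u \<in> carrier_vec k" "w \<in> carrier_vec k"
  shows "mat_apply k (\<lambda>r c. in_first (vec_fun u c) r) (vec_fun w) = in_first (u \<bullet> w)"
  using assms by (auto simp: mat_apply_def vec_fun_def in_first_def scalar_prod_def lessThan_atLeast0 fun_eq_iff intro!: sum.cong)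

lemma in_first_eq_0: "in_first p = (\<lambda>_. 0) \<longleftrightarrow> p = 0"
  by (auto simp: in_first_def fun_eq_iff)

lemma image_vec_fun_Collect:
  "vec_fun ` {M *\<^sub>v w | w. w \<in> carrier_vec k} = range (mat_apply k (mat_fun M))" if "M \<in> carrier_mat n k"
proof -
  have "vec_fun ` {M *\<^sub>v w | w. w \<in> carrier_vec k} = (\<lambda>w. vec_fun (M *\<^sub>v w)) ` carrier_vec k" by blast
  also have "\<dots> = (\<lambda>w. mat_apply k (mat_fun M) (vec_fun w)) ` carrier_vec k"
    using that by (intro image_cong refl) (simp add: mat_apply_vec_fun)
  also have "\<dots> = mat_apply k (mat_fun M) ` vec_fun ` carrier_vec k" by blast
  finally show ?thesis by (simp add: vec_fun_image range_mat_apply)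
qed

lemma image_vec_fun_kernel:
  assumes "M \<in> carrier_mat n k"
  shows "vec_fun ` {w \<in> carrier_vec k. M *\<^sub>v w = 0\<^sub>v n} = kernel k (mat_fun M)"
proof -
  have "M *\<^sub>v w = 0\<^sub>v n \<longleftrightarrow> mat_apply k (mat_fun M) (vec_fun w) = (\<lambda>_. 0)" if "w \<in> carrier_vec k" for w
    using assms that vec_fun_eq_iff[of "M *\<^sub>v w" n "0\<^sub>v n"] by (simp add: mat_apply_vec_fun vec_fun_zero)
  then have "vec_fun ` {w \<in> carrier_vec k. M *\<^sub>v w = 0\<^sub>v n} = {f \<in> vec_fun ` carrier_vec k. mat_apply k (mat_fun M) f = (\<lambda>_. 0)}"
    by blast
  then show ?thesis by (simp add: vec_fun_image kernel_def)
qed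

lemma image_vec_fun_row_kernel:
  assumes "u \<in> carrier_vec k"
  shows "vec_fun ` {w \<in> carrier_vec k. u \<bullet> w = 0} = kernel k (\<lambda>r c. in_first (vec_fun u c) r)"
proof -
  have "u \<bullet> w = 0 \<longleftrightarrow> mat_apply k (\<lambda>r c. in_first (vec_fun u c) r) (vec_fun w) = (\<lambda>_. 0)" if "w \<in> carrier_vec k" for w
    using assms that by (simp add: mat_apply_row in_first_eq_0)
  then have "vec_fun ` {w \<in> carrier_vec k. u \<bullet> w = 0} =
      {f \<in> vec_fun ` carrier_vec k. mat_apply k (\<lambda>r c. in_first (vec_fun u c) r) f = (\<lambda>_. 0)}"
    by blast
  then show ?thesis by (simp add: vec_fun_image kernel_def)
qed

lemma image_vec_fun_row:
  assumes "u \<in> carrier_vec k"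
  shows "in_first ` {u \<bullet> w | w. w \<in> carrier_vec k} = range (mat_apply k (\<lambda>r c. in_first (vec_fun u c) r))"
proof -
  have "in_first ` {u \<bullet> w | w. w \<in> carrier_vec k} = (\<lambda>w. in_first (u \<bullet> w)) ` carrier_vec k" by blast
  also have "\<dots> = (\<lambda>w. mat_apply k (\<lambda>r c. in_first (vec_fun u c) r) (vec_fun w)) ` carrier_vec k"
    using assms by (intro image_cong refl) (simp add: mat_apply_row)
  also have "\<dots> = mat_apply k (\<lambda>r c. in_first (vec_fun u c) r) ` vec_fun ` carrier_vec k" by blast
  finally show ?thesis by (simp add: vec_fun_image range_mat_apply)
qed

lemma mat_apply_no_constants:
  fixes A :: "nat \<Rightarrow> nat \<Rightarrow> ('v::finite, 'k::field) mpoly"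
  assumes "\<And>r c. c < k \<Longrightarrow> Poly_Mapping.lookup (A r c) 0 = 0"
  shows "no_constants (range (mat_apply k A))"
proof -
  have "Poly_Mapping.lookup (A r c * p) 0 = 0" if "c < k" for r c p
    using lookup_mult_0[OF assms[OF that], of p r] by (simp add: mult.commute)
  then show ?thesis
    by (auto simp: no_constants_def mat_apply_def lookup_sum intro!: sum.neutral)
qed

lemma no_constants_columns:
  assumes "no_constants (range (mat_apply k A))" "c < k"
  shows "Poly_Mapping.lookup (A r c) 0 = 0"
  using assms mat_apply_unit[OF assms(2), of A r] unfolding no_constants_def by (metis rangeI)

context minimal_graded_free_resolution
begin

text \<open>
  Along the resolution the bound grows by one at each step by \<open>kernel_reg_le\<close>, and it applies to the degrees of
  the generators by \<open>generator_degree_le\<close>. The augmentation is treated as the matrix with index \<open>0\<close>.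
\<close>
lemma shifts_le:
  assumes "koszul_reg_le J \<rho>"
  shows "j \<in> set (sh i) \<Longrightarrow> j \<le> \<rho> + int i"
proof -
  define A where "A i = (case i of 0 \<Rightarrow> \<lambda>r c. in_first (vec_fun aug c) r | Suc i \<Rightarrow> mat_fun (D i))" for i
  define a where "a i = (case i of 0 \<Rightarrow> \<lambda>_. 0 | Suc i \<Rightarrow> (!) (sh i))" for i
  let ?k = "\<lambda>i. length (sh i)"
  have hom: "homogeneous (sh i ! c - a i r) (A i r c)" if "c < ?k i" for i r c
    using that aug_carrier aug_homogeneous D_homogeneous D_carrier[of "i - 1"]
    by (cases i) (auto simp: A_def a_def in_first_def vec_fun_def mat_fun_def)
  have range_0: "range (mat_apply (?k 0) (A 0)) = in_first ` J"
    using image_vec_fun_row[OF aug_carrier] aug_onto by (simp add: A_def)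
  have range_Suc: "range (mat_apply (?k (Suc i)) (A (Suc i))) = kernel (?k i) (A i)" for i
  proof (cases i)
    case 0
    then show ?thesis
      using image_vec_fun_Collect[OF D_carrier[of 0]] exact_0 image_vec_fun_row_kernel[OF aug_carrier]
      by (simp add: A_def)
  next
    case (Suc l)
    then show ?thesis
      using image_vec_fun_Collect[OF D_carrier[of "Suc l"]] exact_Suc[of l] image_vec_fun_kernel[OF D_carrier[of l]]
      by (simp add: A_def)
  qed
  have "Poly_Mapping.lookup (A (Suc i) r c) 0 = 0" if "c < ?k (Suc i)" for i r c
    using that minimal[of r i c] D_carrier[of i] by (auto simp: A_def mat_fun_def irrelevant_ideal_eq)
  then have minimal': "no_constants (kernel (?k i) (A i))" for i
    unfolding range_Suc[symmetric] by (intro mat_apply_no_constants)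
  have reg: "module_reg_le (a i) (range (mat_apply (?k i) (A i))) (\<rho> + int i)" for i
  proof (induction i)
    case 0
    then show ?case using module_reg_le_ideal[OF assms] unfolding range_0 by (simp add: a_def)
  next
    case (Suc i)
    have "module_reg_le ((!) (sh i)) (kernel (?k i) (A i)) (\<rho> + int i + 1)"
      by (rule kernel_reg_le[OF _ Suc.IH minimal']) (rule hom)
    then show ?case unfolding range_Suc by (simp add: a_def add_ac)
  qed
  assume "j \<in> set (sh i)"
  then obtain c where c: "c < ?k i" "j = sh i ! c" by (metis in_set_conv_nth)
  show "j \<le> \<rho> + int i"
    unfolding c(2) by (rule generator_degree_le[OF _ reg minimal' c(1)]) (rule hom)
qed

end

lemma mat_apply_cong: "(\<And>r c. c < k \<Longrightarrow> A r c = B r c) \<Longrightarrow> mat_apply k A = mat_apply k B"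
  by (simp add: mat_apply_def fun_eq_iff)

lemma inj_on_vec_fun: "inj_on vec_fun (carrier_vec k)"
  by (rule inj_onI) (simp add: vec_fun_eq_iff)

lemma inj_in_first: "inj in_first"
  by (rule injI) (metis in_first_def)

text \<open>
  Minimal presentations are chosen one after the other, each one of the kernel of the one before. By
  \<open>kernel_reg_le\<close> the kernel inherits a bound on its Koszul homology, which is what makes it finitely
  generated.
\<close>
lemma minimal_resolution_exists:
  fixes J :: "('v::finite, 'k::field) mpoly set"
  assumes J: "graded_submodule (\<lambda>_. 0) 1 (in_first ` J)" and reg: "koszul_reg_le J \<rho>"
  shows "\<exists>sh aug D. minimal_graded_free_resolution J sh aug D"
proof -
  \<comment> \<open>A state consists of the rank and the degrees of a free module and of a submodule of it, still to be resolved.\<close>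
  define P where "P i st \<longleftrightarrow> (i = 0 \<longrightarrow> st = (1, (\<lambda>_. 0), in_first ` J)) \<and>
    (case st of (n, a, N) \<Rightarrow> graded_submodule a n N \<and> (\<exists>\<rho>. module_reg_le a N \<rho>))"
    for i :: nat and st :: "nat \<times> (nat \<Rightarrow> int) \<times> (nat \<Rightarrow> ('v, 'k) mpoly) set"
  define Q where "Q st st' \<longleftrightarrow> (case st of (n, a, N) \<Rightarrow> case st' of (k, b, Z) \<Rightarrow>
    \<exists>A. presents a N k b A \<and> no_constants Z \<and> Z = kernel k A)"
    for st st' :: "nat \<times> (nat \<Rightarrow> int) \<times> (nat \<Rightarrow> ('v, 'k) mpoly) set"
  have "\<exists>f. \<forall>i. P i (f i) \<and> Q (f i) (f (Suc i))"
  proof (rule dependent_nat_choice)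
    show "\<exists>st. P 0 st"
      using J module_reg_le_ideal[OF reg] unfolding P_def by (intro exI[of _ "(1, (\<lambda>_. 0), in_first ` J)"]) auto
    fix st i assume "P i st"
    then obtain n a N \<rho> where st: "st = (n, a, N)" and N: "graded_submodule a n N" "module_reg_le a N \<rho>"
      unfolding P_def by (cases st) auto
    obtain k b A where A: "presents a N k b A" "no_constants (kernel k A)"
      using minimal_presentation_exists[OF N] by blast
    have hom: "\<And>r c. c < k \<Longrightarrow> homogeneous (b c - a r) (A r c)" and ran: "range (mat_apply k A) = N"
      using A(1) by (auto simp: presents_def)
    have "graded_submodule b k (kernel k A)" by (rule graded_submodule_kernel[OF hom])
    moreover have "module_reg_le b (kernel k A) (\<rho> + 1)"
      using N(2) A(2) unfolding ran[symmetric] by (intro kernel_reg_le[OF hom])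
    ultimately have "P (Suc i) (k, b, kernel k A)" by (auto simp: P_def)
    moreover have "Q st (k, b, kernel k A)" using A by (auto simp: Q_def st)
    ultimately show "\<exists>st'. P (Suc i) st' \<and> Q st st'" by blast
  qed
  then obtain f where f: "\<And>i. P i (f i)" "\<And>i. Q (f i) (f (Suc i))" by blast
  define n where "n i = fst (f i)" for i
  define a where "a i = fst (snd (f i))" for i
  define N where "N i = snd (snd (f i))" for i
  have sub: "graded_submodule (a i) (n i) (N i)" for i
    using f(1)[of i] by (auto simp: P_def n_def a_def N_def split: prod.splits)
  have init: "n 0 = 1" "a 0 = (\<lambda>_. 0)" "N 0 = in_first ` J"
    using f(1)[of 0] by (simp_all add: P_def n_def a_def N_def)
  have "\<exists>A. presents (a i) (N i) (n (Suc i)) (a (Suc i)) A \<and> no_constants (N (Suc i)) \<and> N (Suc i) = kernel (n (Suc i)) A" for i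
    using f(2)[of i] by (auto simp: Q_def n_def a_def N_def split: prod.splits)
  then obtain A where A: "\<And>i. presents (a i) (N i) (n (Suc i)) (a (Suc i)) (A i)"
    and noc: "\<And>i. no_constants (N (Suc i))" and ker: "\<And>i. N (Suc i) = kernel (n (Suc i)) (A i)"
    by metis
  have hom: "\<And>i r c. c < n (Suc i) \<Longrightarrow> homogeneous (a (Suc i) c - a i r) (A i r c)"
    and ran: "\<And>i. range (mat_apply (n (Suc i)) (A i)) = N i"
    using A by (auto simp: presents_def)
  \<comment> \<open>The columns lie in the free module of rank \<open>n i\<close>, so no information is lost when \<open>A i\<close> is cut down to a matrix.\<close>
  have A_free: "A i r c = 0" if "c < n (Suc i)" "n i \<le> r" for i r c
  proof -
    have "mat_apply (n (Suc i)) (A i) (\<lambda>j. if j = c then 1 else 0) \<in> N i" unfolding ran[symmetric] by blast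
    from submodule_free[OF sub this that(2)] show ?thesis using mat_apply_unit[OF that(1), of "A i" r] by simp
  qed
  define sh where "sh i = map (a (Suc i)) [0..<n (Suc i)]" for i
  define aug where "aug = vec (n 1) (A 0 0)"
  define D where "D i = mat (n (Suc i)) (n (Suc (Suc i))) (\<lambda>(r, c). A (Suc i) r c)" for i
  have len: "length (sh i) = n (Suc i)" for i by (simp add: sh_def)
  have aug: "aug \<in> carrier_vec (n 1)" by (simp add: aug_def)
  have D: "D i \<in> carrier_mat (n (Suc i)) (n (Suc (Suc i)))" for i by (simp add: D_def)
  have mat_aug: "mat_apply (n 1) (\<lambda>r c. in_first (vec_fun aug c) r) = mat_apply (n 1) (A 0)"
    using A_free[of _ 0] init(1) by (intro mat_apply_cong) (auto simp: in_first_def vec_fun_def aug_def)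
  have mat_D: "mat_apply (n (Suc (Suc i))) (mat_fun (D i)) = mat_apply (n (Suc (Suc i))) (A (Suc i))" for i
    using A_free[of _ "Suc i"] by (intro mat_apply_cong) (auto simp: mat_fun_def D_def)
  have "minimal_graded_free_resolution J sh aug D"
  proof
    show "aug \<in> carrier_vec (length (sh 0))" using aug by (simp add: len)
    show "D i \<in> carrier_mat (length (sh i)) (length (sh (Suc i)))" for i using D by (simp add: len)
    show "homogeneous (sh 0 ! r) (aug $ r)" if "r < length (sh 0)" for r
      using that hom[of r 0 0] by (simp add: len aug_def sh_def init)
    show "homogeneous (sh (Suc i) ! c - sh i ! r) (D i $$ (r, c))" if "r < length (sh i)" "c < length (sh (Suc i))" for r i c
      using that hom[of c "Suc i" r] by (simp add: len D_def sh_def)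
    show "D i $$ (r, c) \<in> irrelevant_ideal" if "r < length (sh i)" "c < length (sh (Suc i))" for r i c
      using that no_constants_columns[OF noc[of i, folded ran[of "Suc i"]], of c r]
      by (simp add: len D_def irrelevant_ideal_eq)
    have "in_first ` {aug \<bullet> w | w. w \<in> carrier_vec (n 1)} = in_first ` J"
      unfolding image_vec_fun_row[OF aug] mat_aug using ran[of 0] init(3) by simp
    then show "{aug \<bullet> w | w. w \<in> carrier_vec (length (sh 0))} = J"
      by (simp add: len inj_image_eq_iff[OF inj_in_first])
    have "vec_fun ` {D 0 *\<^sub>v w | w. w \<in> carrier_vec (n 2)} = vec_fun ` {w \<in> carrier_vec (n 1). aug \<bullet> w = 0}"
      using image_vec_fun_Collect[OF D[of 0]] mat_D[of 0] ran[of 1] ker[of 0] image_vec_fun_row_kernel[OF aug] mat_aug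
      by (simp add: numeral_2_eq_2 kernel_def)
    moreover have "{D 0 *\<^sub>v w | w. w \<in> carrier_vec (n 2)} \<subseteq> carrier_vec (n 1)"
      using D[of 0] by (auto simp: numeral_2_eq_2)
    ultimately show "{D 0 *\<^sub>v w | w. w \<in> carrier_vec (length (sh 1))} = {w \<in> carrier_vec (length (sh 0)). aug \<bullet> w = 0}"
      using inj_on_image_eq_iff[OF inj_on_vec_fun[of "n 1"], of _ "{w \<in> carrier_vec (n 1). aug \<bullet> w = 0}"]
      by (simp add: len numeral_2_eq_2)
    fix i
    have "vec_fun ` {D (Suc i) *\<^sub>v w | w. w \<in> carrier_vec (n (Suc (Suc (Suc i))))} =
        vec_fun ` {w \<in> carrier_vec (n (Suc (Suc i))). D i *\<^sub>v w = 0\<^sub>v (n (Suc i))}"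
      using image_vec_fun_Collect[OF D[of "Suc i"]] mat_D[of "Suc i"] ran[of "Suc (Suc i)"] ker[of "Suc i"]
        image_vec_fun_kernel[OF D[of i]] mat_D[of i]
      by (simp add: kernel_def)
    moreover have "{D (Suc i) *\<^sub>v w | w. w \<in> carrier_vec (n (Suc (Suc (Suc i))))} \<subseteq> carrier_vec (n (Suc (Suc i)))"
      using D[of "Suc i"] by auto
    ultimately show "{D (Suc i) *\<^sub>v w | w. w \<in> carrier_vec (length (sh (Suc (Suc i))))}
          = {w \<in> carrier_vec (length (sh (Suc i))). D i *\<^sub>v w = 0\<^sub>v (length (sh i))}"
      using inj_on_image_eq_iff[OF inj_on_vec_fun[of "n (Suc (Suc i))"], of _ "{w \<in> carrier_vec (n (Suc (Suc i))). D i *\<^sub>v w = 0\<^sub>v (n (Suc i))}"]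
      by (simp add: len)
  qed
  then show ?thesis by blast
qed

lemma monomial_ideal_graded:
  assumes U: "\<And>m m'. m \<in> U \<Longrightarrow> m \<subseteq># m' \<Longrightarrow> m' \<in> U"
  shows "graded_submodule (\<lambda>_. 0) 1 (in_first ` (monomial_ideal U :: ('v::finite, 'k::field) mpoly set))"
  unfolding graded_submodule_def is_submodule_def
proof (intro conjI ballI allI)
  let ?N = "in_first ` (monomial_ideal U :: ('v, 'k) mpoly set)"
  show "?N \<subseteq> free_mod 1" by (auto simp: in_first_def free_mod_def)
  show "(\<lambda>_. 0) \<in> ?N" by (rule image_eqI[of _ _ 0]) (auto simp: in_first_def)
  fix f assume "f \<in> ?N"
  then obtain p where p: "p \<in> monomial_ideal U" "f = in_first p" by blast
  show "(\<lambda>r. q * f r) \<in> ?N" for q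
    by (rule image_eqI[of _ _ "q * p"]) (auto simp: p in_first_def intro: monomial_ideal_mult[OF U])
  show "component (\<lambda>_. 0) d f \<in> ?N" for d
  proof (rule image_eqI[of _ _ "hom_part d p"])
    show "component (\<lambda>_. 0) d f = in_first (hom_part d p)"
      by (auto simp: component_def p in_first_def)
    show "hom_part d p \<in> monomial_ideal U"
      using p(1) by (auto simp: monomial_ideal_def hom_part_def keys_restrict_keys)
  qed
  fix g assume "g \<in> ?N"
  then obtain q where q: "q \<in> monomial_ideal U" "g = in_first q" by blast
  show "(\<lambda>r. f r + g r) \<in> ?N"
    by (rule image_eqI[of _ _ "p + q"]) (auto simp: p q in_first_def intro: monomial_ideal_add)
qed

lemma regularity_monomial_ideal_le:
  fixes U :: "'v::finite multiset set"
  assumes U: "\<And>m m'. m \<in> U \<Longrightarrow> m \<subseteq># m' \<Longrightarrow> m' \<in> U"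
    and reg: "koszul_reg_le (monomial_ideal U :: ('v, 'k::field) mpoly set) \<rho>"
  shows "regularity (monomial_ideal U :: ('v, 'k) mpoly set) \<le> ereal (of_int \<rho>)"
proof -
  let ?J = "monomial_ideal U :: ('v, 'k) mpoly set"
  have "\<exists>aug D. minimal_graded_free_resolution ?J (resolution_shifts ?J) aug D"
    unfolding resolution_shifts_def
    by (rule someI_ex[of "\<lambda>sh. \<exists>aug D. minimal_graded_free_resolution ?J sh aug D"])
      (rule minimal_resolution_exists[OF monomial_ideal_graded[OF U] reg])
  then obtain aug D where res: "minimal_graded_free_resolution ?J (resolution_shifts ?J) aug D" by blast
  show ?thesis
    unfolding regularity_def
  proof (rule Sup_least)
    fix x assume "x \<in> {ereal (of_int (j - int i)) | i j. graded_betti ?J i j \<noteq> 0}"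
    then obtain i j where x: "x = ereal (of_int (j - int i))" and "graded_betti ?J i j \<noteq> 0" by blast
    then have "j \<in> set (resolution_shifts ?J i)" by (simp add: graded_betti_def count_list_0_iff)
    then have "j \<le> \<rho> + int i" by (rule minimal_graded_free_resolution.shifts_le[OF res reg])
    then show "x \<le> ereal (of_int \<rho>)" unfolding x by simp
  qed
qed

section \<open>Powers of edge ideals\<close>
context finite_simple_graph
begin

lemma nu_superadditive: "\<nu> a + \<nu> b \<le> \<nu> (a + b)"
proof -
  obtain F where F: "packing a F" "size F = \<nu> a" by (rule obtain_packing)
  obtain G where G: "packing b G" "size G = \<nu> b" by (rule obtain_packing)
  have "packing (a + b) (F + G)"
    using F(1) G(1) by (auto simp: packing_def intro: subset_mset.add_mono)
  from packing_le[OF this] F(2) G(2) show ?thesis by simp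
qed

text \<open>Splits off one edge of a maximum packing.\<close>
lemma edge_factor:
  assumes "s < \<nu> (mon_mset m)"
  obtains u v m' where "{u, v} \<in> E" "m = Poly_Mapping.single u 1 + Poly_Mapping.single v 1 + m'"
    "s \<le> \<nu> (mon_mset m')"
proof -
  obtain F where F: "packing (mon_mset m) F" "size F = \<nu> (mon_mset m)" by (rule obtain_packing)
  then obtain e G where G: "F = add_mset e G" using assms by (metis gr_implies_not_zero multiset_cases size_empty)
  then have e: "e \<in> E" using F(1) by (simp add: packing_def)
  obtain u v where uv: "e = {u, v}" "u \<noteq> v" using card_edge[OF e] by (auto simp: card_2_iff)
  have sub: "{#u, v#} + vertex_mset G \<subseteq># mon_mset m" using F(1) uv by (simp add: packing_def G)
  define m' where "m' = m - (Poly_Mapping.single u 1 + Poly_Mapping.single v 1)"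
  have cnt: "count {#u, v#} x + count (vertex_mset G) x \<le> Poly_Mapping.lookup m x" for x
    using mset_subset_eq_count[OF sub, of x] by (simp only: count_union count_mon_mset)
  have "m = Poly_Mapping.single u 1 + Poly_Mapping.single v 1 + m'"
  proof (rule poly_mapping_eqI)
    fix x
    show "Poly_Mapping.lookup m x = Poly_Mapping.lookup (Poly_Mapping.single u 1 + Poly_Mapping.single v 1 + m') x"
      using cnt[of x] uv(2) by (auto simp: m'_def lookup_add lookup_minus lookup_single when_def)
  qed
  moreover have "packing (mon_mset m') G"
    unfolding packing_def subseteq_mset_def
  proof (intro conjI allI)
    show "set_mset G \<subseteq> E" using F(1) by (simp add: packing_def G)
    fix x
    show "count (vertex_mset G) x \<le> count (mon_mset m') x"
      using cnt[of x] uv(2) by (auto simp: m'_def lookup_add lookup_minus lookup_single when_def)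
  qed
  then have "s \<le> \<nu> (mon_mset m')" using packing_le[of "mon_mset m'" G] F(2) assms by (simp add: G)
  ultimately show thesis using that e uv by blast
qed

lemma nu_upward: "m \<in> {m. s \<le> \<nu> m} \<Longrightarrow> m \<subseteq># m' \<Longrightarrow> m' \<in> {m. s \<le> \<nu> m}"
  using nu_mono[of m m'] by simp

lemma edge_ideal_eq: "(edge_ideal E :: ('v, 'k::field) mpoly set) = monomial_ideal {m. 1 \<le> \<nu> m}"
  unfolding edge_ideal_def
proof (rule ideal_gen_monomial_ideal)
  show "{Var u * Var v | u v. {u, v} \<in> E} \<subseteq> (monomial_ideal {m. 1 \<le> \<nu> m} :: ('v, 'k) mpoly set)"
  proof safe
    fix u v assume "{u, v} \<in> E"
    from nu_edge[OF this, of "{#}"] show "Var u * Var v \<in> (monomial_ideal {m. 1 \<le> \<nu> m} :: ('v, 'k) mpoly set)"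
      by (simp add: monomial_ideal_def Var_def mult_single mon_mset_add add_mset_commute)
  qed
  fix m :: "'v \<Rightarrow>\<^sub>0 nat" and c :: 'k
  assume "mon_mset m \<in> {m. 1 \<le> \<nu> m}"
  then have "0 < \<nu> (mon_mset m)" by simp
  then obtain u v m' where uv: "{u, v} \<in> E" "m = Poly_Mapping.single u 1 + Poly_Mapping.single v 1 + m'"
    by (rule edge_factor)
  have "Poly_Mapping.single m c = Poly_Mapping.single m' c * (Var u * Var v)"
    by (simp add: uv(2) Var_def mult_single add_ac)
  then show "\<exists>g\<in>{Var u * Var v | u v. {u, v} \<in> E}. \<exists>q. Poly_Mapping.single m c = q * g"
    using uv(1) by blast
qed (rule nu_upward)

lemma ideal_power_edge_ideal_eq:
  "ideal_power (edge_ideal E :: ('v, 'k::field) mpoly set) s = monomial_ideal {m. s \<le> \<nu> m}"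
proof (induction s)
  case 0
  show ?case by (simp add: monomial_ideal_def)
next
  case (Suc s)
  show ?case
    unfolding ideal_power.simps Suc.IH
  proof (rule ideal_gen_monomial_ideal)
    show "{a * b | a b. a \<in> edge_ideal E \<and> b \<in> monomial_ideal {m. s \<le> \<nu> m}}
        \<subseteq> (monomial_ideal {m. Suc s \<le> \<nu> m} :: ('v, 'k) mpoly set)"
    proof safe
      fix a b :: "('v, 'k) mpoly"
      assume a: "a \<in> edge_ideal E" and b: "b \<in> monomial_ideal {m. s \<le> \<nu> m}"
      show "a * b \<in> monomial_ideal {m. Suc s \<le> \<nu> m}"
        unfolding monomial_ideal_def
      proof safe
        fix m assume "m \<in> Poly_Mapping.keys (a * b)"
        then obtain x y where xy: "m = x + y" "x \<in> Poly_Mapping.keys a" "y \<in> Poly_Mapping.keys b"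
          using keys_mult[of a b] by blast
        then have "1 \<le> \<nu> (mon_mset x)" "s \<le> \<nu> (mon_mset y)"
          using a b by (auto simp: edge_ideal_eq monomial_ideal_def)
        then show "Suc s \<le> \<nu> (mon_mset m)"
          using nu_superadditive[of "mon_mset x" "mon_mset y"] by (simp add: xy(1) mon_mset_add)
      qed
    qed
    fix m :: "'v \<Rightarrow>\<^sub>0 nat" and c :: 'k
    assume "mon_mset m \<in> {m. Suc s \<le> \<nu> m}"
    then have "s < \<nu> (mon_mset m)" by simp
    then obtain u v m' where uv: "{u, v} \<in> E" "m = Poly_Mapping.single u 1 + Poly_Mapping.single v 1 + m'"
      and m': "s \<le> \<nu> (mon_mset m')"
      by (rule edge_factor)
    have "Poly_Mapping.single m c = 1 * (Var u * Var v * Poly_Mapping.single m' c)"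
      by (simp add: uv(2) Var_def mult_single add_ac)
    moreover have "Var u * Var v \<in> (edge_ideal E :: ('v, 'k) mpoly set)"
      using nu_edge[OF uv(1), of "{#}"]
      by (simp add: edge_ideal_eq monomial_ideal_def Var_def mult_single mon_mset_add add_mset_commute)
    moreover have "Poly_Mapping.single m' c \<in> monomial_ideal {m. s \<le> \<nu> m}"
      using m' by (simp add: monomial_ideal_def)
    ultimately show "\<exists>g\<in>{a * b | a b. a \<in> edge_ideal E \<and> b \<in> monomial_ideal {m. s \<le> \<nu> m}}.
        \<exists>q. Poly_Mapping.single m c = q * g"
      by blast
  qed (rule nu_upward)
qed

lemma regularity_power_le_dominating:
  assumes "M \<subseteq> E" "\<And>e. e \<in> E \<Longrightarrow> e \<inter> \<Union>M \<noteq> {}" and "1 \<le> s"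
  shows "regularity (ideal_power (edge_ideal E :: ('v, 'k::field) mpoly set) s)
    \<le> ereal (2 * real s + real (card M) - 1)"
proof -
  have "koszul_reg_le (monomial_ideal {m. s \<le> \<nu> m} :: ('v, 'k) mpoly set) (2 * int s + int (card M) - 1)"
    by (rule power_bound[where R = "\<lambda>U. koszul_reg_le (monomial_ideal U :: ('v, 'k) mpoly set)"])
      (use assms koszul_reg_le_empty koszul_reg_le_UNIV koszul_reg_le_step in blast)+
  from regularity_monomial_ideal_le[OF nu_upward this] show ?thesis
    unfolding ideal_power_edge_ideal_eq by simp
qed

end

text \<open>An edge disjoint from all edges of \<open>M\<close> could be added to \<open>M\<close>.\<close>
lemma maximal_matching_meets:
  assumes E: "simple_graph E" and M: "maximal_matching E M" and e: "e \<in> E"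
  shows "e \<inter> \<Union>M \<noteq> {}"
proof
  assume disj: "e \<inter> \<Union>M = {}"
  have "card e = 2" using E e by (simp add: simple_graph_def)
  then have "e \<noteq> {}" by auto
  have "matching E (insert e M)"
    using M e disj by (auto simp: maximal_matching_def matching_def disjoint_def)
  then have "insert e M = M" using M unfolding maximal_matching_def by blast
  then show False using disj \<open>e \<noteq> {}\<close> by blast
qed

lemma min_match_attained:
  obtains M where "maximal_matching E M" "card M = min_match E"
proof -
  have "finite {M. matching E M}" "{} \<in> {M. matching E M}" by (auto simp: matching_def disjoint_def)
  then obtain M where "M \<in> {M. matching E M}" "\<forall>M'\<in>{M. matching E M}. M \<subseteq> M' \<longrightarrow> M = M'"
    using finite_has_maximal[of "{M. matching E M}"] by blast
  then have "maximal_matching E M" by (auto simp: maximal_matching_def)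
  then have "min_match E \<in> card ` {M. maximal_matching E M}"
    unfolding min_match_def by (intro Min_in) auto
  then show thesis using that by auto
qed

theorem corollary3p7:
  fixes E :: "'v::finite set set" and s :: nat
  assumes "simple_graph E" and "s \<ge> 1"
  shows "regularity (ideal_power (edge_ideal E :: ('v, 'k::field) mpoly set) s)
    \<le> ereal (2 * real s + real (min_match E) - 1)"
proof -
  interpret finite_simple_graph E
    using assms(1) by unfold_locales (simp add: simple_graph_def)
  obtain M where M: "maximal_matching E M" "card M = min_match E" by (rule min_match_attained)
  have "M \<subseteq> E" using M(1) by (simp add: maximal_matching_def matching_def)
  from regularity_power_le_dominating[OF this maximal_matching_meets[OF assms(1) M(1)] assms(2)]
  show ?thesis by (simp add: M(2))
qed

end
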